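(* Let $K$ be a field. For any $K$-vector space $V$, the free 2-associative algebra $2as(V)$ and the free $B_\infty$-algebra $B_\infty(V)$ are related by isomorphisms $$\bar\phi:\mathrm{Prim}(2as(V))\cong B_\infty(V)\quad\text{as } B_\infty\text{-algebras},$$ $$\phi:2as(V)\cong T^{fc}(B_\infty(V))\quad\text{as 2-associative bialgebras}.$$
   Context: All vector spaces are over a field $K$. 2-associative algebra: a vector space with two associative products $*$ and $\cdot$ having a common unit $1$. $2as(V)$ is the free (unital) 2-associative algebra on $V$. A 2-associative bialgebra $(\mathcal H,*,\cdot,\Delta)$: $(\mathcal H,*,\Delta)$ is a (unital, counital) bialgebra and $(\mathcal H,\cdot,\Delta)$ is a unital infinitesimal bialgebra, i.e. $\cdot$ is unital associative, $\Delta$ is counital coassociative and $\Delta(x\cdot y)=(x\otimes1)\cdot\Delta(y)+\Delta(x)\cdot(1\otimes y)-x\otimes y$, where $(a\otimes b)\cdot(a'\otimes b')=a\cdot a'\otimes b\cdot b'$. $2as(V)$ carries the unique coproduct making it a 2-associative bialgebra in which the elements of $V$ are primitive. $\mathrm{Prim}\,\mathcal H=\{x:\Delta(x)=x\otimes1+1\otimes x\}$. $B_\infty$-algebra. A vector space $R$ with linear maps $M_{pq}:R^{\otimes p}\otimes R^{\otimes q}\to R$ ($p,q\ge0$) with $M_{00}=0$, $M_{10}=M_{01}=\mathrm{Id}$, $M_{n0}=M_{0n}=0$ for $n\ge2$, satisfying for all $i,j,k\ge1$ the relation $$\sum_{l=1}^{i+j}\sum_{(\underline a,\underline b)}M_{lk}\circ(M^l_{(\underline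 a,\underline b)}\otimes\mathrm{Id}^{\otimes k})=\sum_{m=1}^{j+k}\sum_{(\underline b,\underline c)}M_{im}\circ(\mathrm{Id}^{\otimes i}\otimes M^m_{(\underline b,\underline c)}),$$ where the inner sum on the left runs over pairs of $l$-tuples of non-negative integers $\underline a,\underline b$ with $\sum a_s=i$, $\sum b_s=j$, the inner sum on the right over pairs of $m$-tuples of non-negative integers with $\sum b_s=j$, $\sum c_s=k$, and $M^l_{(\underline a,\underline b)}=M_{a_1b_1}\cdots M_{a_lb_l}:R^{\otimes p}\otimes R^{\otimes q}\to R^{\otimes l}$ (with $p=\sum a_s$, $q=\sum b_s$) sends $(u_1\cdots u_p,v_1\cdots v_q)$ to $M_{a_1b_1}(u_1\cdots u_{a_1},v_1\cdots v_{b_1})\otimes M_{a_2b_2}(u_{a_1+1}\cdots u_{a_1+a_2},v_{b_1+1}\cdots v_{b_1+b_2})\otimes\cdots\otimes M_{a_lb_l}(\cdots u_p,\cdots v_q)$. Morphisms are linear maps commuting with all $M_{pq}$; $B_\infty(V)$ is the free $B_\infty$-algebra on $V$. From 2-associative algebras to $B_\infty$-algebras. Any 2-associative algebra $(A,*,\cdot)$ becomes a $B_\infty$-algebra $A_{B_\infty}$ with operations defined inductively by $M_{00}=0$, $M_{10}=M_{01}=\mathrm{Id}$, $M_{n0}=M_{0n}=0$ for $n\ge2$, and for $p,q\ge1$ $$M_{pq}(u_1\cdots u_p,v_1\cdots v_q)=(u_1\cdot\ldots\cdot u_p)*(v_1\cdot\ldots\cdot v_q)-\sum_{k\ge2}\sum_{(\underline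 i,\underline j)}\nu^{k-1}\big(M_{i_1j_1}\cdots M_{i_kj_k}(u_1\cdots u_p,v_1\cdots v_q)\big),$$ where $\sum i_s=p$, $\sum j_s=q$ and $\nu^{k-1}$ multiplies the $k$ tensor factors with $\cdot$. For a 2-associative bialgebra $\mathcal H$, $\mathrm{Prim}\,\mathcal H$ is a sub-$B_\infty$-algebra of $\mathcal H_{B_\infty}$; this is the $B_\infty$-structure on $\mathrm{Prim}(2as(V))$. $T^{fc}(R)$ for a $B_\infty$-algebra $R$: the vector space $\bigoplus_{n\ge0}R^{\otimes n}$ with $\cdot$ = concatenation, $\Delta$ = deconcatenation, $\Delta(r_1\cdots r_n)=\sum_{i=0}^nr_1\cdots r_i\otimes r_{i+1}\cdots r_n$, and the associative product $*$ with unit $1\in R^{\otimes 0}$ given by $u_1\cdots u_p*v_1\cdots v_q=\sum_{k\ge1}\sum_{(\underline i,\underline j)}M_{i_1j_1}\cdots M_{i_kj_k}(u_1\cdots u_p,v_1\cdots v_q)$, the sum over $k$-tuples of non-negative integers with $\sum i_s=p$, $\sum j_s=q$. It is a 2-associative bialgebra. *)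

theory Defs
  imports "HOL-Algebra.Module"
begin

text \<open>
  Vector spaces over a field \<open>K\<close> are the structures \<open>V\<close> with \<open>field K\<close> and \<open>module K V\<close>; the
  ring multiplication and unit that a module record carries are junk unless stated otherwise.
  A map defined on a tensor product of vector spaces is rendered as a multilinear function of
  lists or tuples of vectors.
\<close>

definition linear_map ::
  "('k, 'x) ring_scheme \<Rightarrow> ('k, 'a, 'y) module_scheme \<Rightarrow> ('k, 'b, 'z) module_scheme \<Rightarrow> ('a \<Rightarrow> 'b) \<Rightarrow> bool"
  where "linear_map K A B f \<longleftrightarrow>
    f \<in> carrier A \<rightarrow> carrier B \<and>
    (\<forall>x\<in>carrier A. \<forall>y\<in>carrier A. f (x \<oplus>\<^bsub>A\<^esub> y) = f x \<oplus>\<^bsub>B\<^esub> f y) \<and>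
    (\<forall>c\<in>carrier K. \<forall>x\<in>carrier A. f (c \<odot>\<^bsub>A\<^esub> x) = c \<odot>\<^bsub>B\<^esub> f x)"

definition self_module :: "('k, 'x) ring_scheme \<Rightarrow> ('k, 'k) module"
  where "self_module K =
    \<lparr>carrier = carrier K, mult = mult K, one = one K, zero = zero K, add = add K, smult = mult K\<rparr>"

definition lsum :: "('a, 'x) ring_scheme \<Rightarrow> 'a list \<Rightarrow> 'a"
  where "lsum R xs = foldr (add R) xs (zero R)"


section \<open>Linear algebras presented by generators and relations\<close>

text \<open>
  A presentation consists of a set of multilinear operation symbols with their arities, a set of
  generators, and a set of relations between terms.  The structure presented is the set of all
  terms modulo the least congruence that contains the relations, the vector space axioms and the
  multilinearity of the operations.  Without operation symbols this is the quotient of the free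
  vector space on the generators by the subspace spanned by the relations.
\<close>

datatype ('k, 'g, 'o) lterm =
    Gen 'g
  | Zero
  | Plus "('k, 'g, 'o) lterm" "('k, 'g, 'o) lterm"
  | Scale 'k "('k, 'g, 'o) lterm"
  | Op 'o "('k, 'g, 'o) lterm list"

record ('k, 'g, 'o) presentation =
  ops :: "('o \<times> nat) set"
  gens :: "'g set"
  rels :: "(('k, 'g, 'o) lterm \<times> ('k, 'g, 'o) lterm) set"

inductive_set lterms ::
  "('k, 'x) ring_scheme \<Rightarrow> ('o \<times> nat) set \<Rightarrow> 'g set \<Rightarrow> ('k, 'g, 'o) lterm set"
  for K :: "('k, 'x) ring_scheme" and F :: "('o \<times> nat) set" and G :: "'g set"
  where
    "g \<in> G \<Longrightarrow> Gen g \<in> lterms K F G"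
  | "Zero \<in> lterms K F G"
  | "\<lbrakk>s \<in> lterms K F G; t \<in> lterms K F G\<rbrakk> \<Longrightarrow> Plus s t \<in> lterms K F G"
  | "\<lbrakk>c \<in> carrier K; t \<in> lterms K F G\<rbrakk> \<Longrightarrow> Scale c t \<in> lterms K F G"
  | "\<lbrakk>ts \<in> lists (lterms K F G); (f, length ts) \<in> F\<rbrakk> \<Longrightarrow> Op f ts \<in> lterms K F G"

abbreviation pterms ::
  "('k, 'x) ring_scheme \<Rightarrow> ('k, 'g, 'o) presentation \<Rightarrow> ('k, 'g, 'o) lterm set"
  where "pterms K P \<equiv> lterms K (ops P) (gens P)"

inductive_set lcong ::
  "('k, 'x) ring_scheme \<Rightarrow> ('k, 'g, 'o) presentation \<Rightarrow> (('k, 'g, 'o) lterm \<times> ('k, 'g, 'o) lterm) set"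
  for K :: "('k, 'x) ring_scheme" and P :: "('k, 'g, 'o) presentation"
  where
    rel: "(s, t) \<in> rels P \<Longrightarrow> (s, t) \<in> lcong K P"
  | refl: "t \<in> pterms K P \<Longrightarrow> (t, t) \<in> lcong K P"
  | sym: "(s, t) \<in> lcong K P \<Longrightarrow> (t, s) \<in> lcong K P"
  | trans: "\<lbrakk>(s, t) \<in> lcong K P; (t, u) \<in> lcong K P\<rbrakk> \<Longrightarrow> (s, u) \<in> lcong K P"
  | plus_cong: "\<lbrakk>(s, s') \<in> lcong K P; (t, t') \<in> lcong K P\<rbrakk> \<Longrightarrow> (Plus s t, Plus s' t') \<in> lcong K P"
  | scale_cong: "\<lbrakk>c \<in> carrier K; (t, t') \<in> lcong K P\<rbrakk> \<Longrightarrow> (Scale c t, Scale c t') \<in> lcong K P"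
  | op_cong: "\<lbrakk>(t, t') \<in> lcong K P; ss \<in> lists (pterms K P); us \<in> lists (pterms K P);
        (f, length (ss @ t # us)) \<in> ops P\<rbrakk>
      \<Longrightarrow> (Op f (ss @ t # us), Op f (ss @ t' # us)) \<in> lcong K P"
  | plus_assoc: "\<lbrakk>s \<in> pterms K P; t \<in> pterms K P; u \<in> pterms K P\<rbrakk>
      \<Longrightarrow> (Plus (Plus s t) u, Plus s (Plus t u)) \<in> lcong K P"
  | plus_comm: "\<lbrakk>s \<in> pterms K P; t \<in> pterms K P\<rbrakk> \<Longrightarrow> (Plus s t, Plus t s) \<in> lcong K P"
  | plus_zero: "t \<in> pterms K P \<Longrightarrow> (Plus t Zero, t) \<in> lcong K P"
  | scale_add: "\<lbrakk>c \<in> carrier K; d \<in> carrier K; t \<in> pterms K P\<rbrakk>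
      \<Longrightarrow> (Scale (c \<oplus>\<^bsub>K\<^esub> d) t, Plus (Scale c t) (Scale d t)) \<in> lcong K P"
  | scale_plus: "\<lbrakk>c \<in> carrier K; s \<in> pterms K P; t \<in> pterms K P\<rbrakk>
      \<Longrightarrow> (Scale c (Plus s t), Plus (Scale c s) (Scale c t)) \<in> lcong K P"
  | scale_mult: "\<lbrakk>c \<in> carrier K; d \<in> carrier K; t \<in> pterms K P\<rbrakk>
      \<Longrightarrow> (Scale (c \<otimes>\<^bsub>K\<^esub> d) t, Scale c (Scale d t)) \<in> lcong K P"
  | scale_one: "t \<in> pterms K P \<Longrightarrow> (Scale \<one>\<^bsub>K\<^esub> t, t) \<in> lcong K P"
  | scale_zero: "t \<in> pterms K P \<Longrightarrow> (Scale \<zero>\<^bsub>K\<^esub> t, Zero) \<in> lcong K P"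
  | op_plus: "\<lbrakk>ss \<in> lists (pterms K P); t \<in> pterms K P; t' \<in> pterms K P; us \<in> lists (pterms K P);
        (f, length (ss @ t # us)) \<in> ops P\<rbrakk>
      \<Longrightarrow> (Op f (ss @ Plus t t' # us), Plus (Op f (ss @ t # us)) (Op f (ss @ t' # us))) \<in> lcong K P"
  | op_scale: "\<lbrakk>ss \<in> lists (pterms K P); c \<in> carrier K; t \<in> pterms K P; us \<in> lists (pterms K P);
        (f, length (ss @ t # us)) \<in> ops P\<rbrakk>
      \<Longrightarrow> (Op f (ss @ Scale c t # us), Scale c (Op f (ss @ t # us))) \<in> lcong K P"

definition cls ::
  "('k, 'x) ring_scheme \<Rightarrow> ('k, 'g, 'o) presentation \<Rightarrow> ('k, 'g, 'o) lterm \<Rightarrow> ('k, 'g, 'o) lterm set"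
  where "cls K P t = lcong K P `` {t}"

definition rep :: "'t set \<Rightarrow> 't"
  where "rep X = (SOME t. t \<in> X)"

definition presented ::
  "('k, 'x) ring_scheme \<Rightarrow> ('k, 'g, 'o) presentation \<Rightarrow> ('k, ('k, 'g, 'o) lterm set) module"
  where "presented K P =
    \<lparr>carrier = pterms K P // lcong K P,
     mult = undefined,
     one = undefined,
     zero = cls K P Zero,
     add = (\<lambda>X Y. cls K P (Plus (rep X) (rep Y))),
     smult = (\<lambda>c X. cls K P (Scale c (rep X)))\<rparr>"

definition presented_op ::
  "('k, 'x) ring_scheme \<Rightarrow> ('k, 'g, 'o) presentation \<Rightarrow> 'o \<Rightarrow> ('k, 'g, 'o) lterm set list
    \<Rightarrow> ('k, 'g, 'o) lterm set"
  where "presented_op K P f Xs = cls K P (Op f (map rep Xs))"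

text \<open>
  \<open>lin_lift W f\<close> is the linear map into \<open>W\<close> that extends \<open>f\<close> from the generators to the vector
  space they present; it is meant for presentations without operation symbols (operation type
  \<^typ>\<open>unit\<close>, empty set of operations) whose relations are respected by \<open>f\<close>.
\<close>

primrec leval :: "('k, 'w, 'y) module_scheme \<Rightarrow> ('g \<Rightarrow> 'w) \<Rightarrow> ('k, 'g, unit) lterm \<Rightarrow> 'w"
  where
    "leval W f (Gen g) = f g"
  | "leval W f Zero = \<zero>\<^bsub>W\<^esub>"
  | "leval W f (Plus s t) = leval W f s \<oplus>\<^bsub>W\<^esub> leval W f t"
  | "leval W f (Scale c t) = c \<odot>\<^bsub>W\<^esub> leval W f t"
  | "leval W f (Op u ts) = undefined"

definition lin_lift ::
  "('k, 'w, 'y) module_scheme \<Rightarrow> ('g \<Rightarrow> 'w) \<Rightarrow> ('k, 'g, unit) lterm set \<Rightarrow> 'w"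
  where "lin_lift W f X = leval W f (rep X)"


section \<open>Tensor products\<close>

type_synonym ('k, 'a, 'b) tensor = "('k, 'a \<times> 'b, unit) lterm set"

definition tensor_pres ::
  "('k, 'x) ring_scheme \<Rightarrow> ('k, 'a, 'y) module_scheme \<Rightarrow> ('k, 'b, 'z) module_scheme
    \<Rightarrow> ('k, 'a \<times> 'b, unit) presentation"
  where "tensor_pres K A B =
    \<lparr>ops = {},
     gens = carrier A \<times> carrier B,
     rels =
       {(Gen (a \<oplus>\<^bsub>A\<^esub> a', b), Plus (Gen (a, b)) (Gen (a', b))) | a a' b.
          a \<in> carrier A \<and> a' \<in> carrier A \<and> b \<in> carrier B} \<union>
       {(Gen (a, b \<oplus>\<^bsub>B\<^esub> b'), Plus (Gen (a, b)) (Gen (a, b'))) | a b b'.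
          a \<in> carrier A \<and> b \<in> carrier B \<and> b' \<in> carrier B} \<union>
       {(Gen (c \<odot>\<^bsub>A\<^esub> a, b), Scale c (Gen (a, b))) | c a b.
          c \<in> carrier K \<and> a \<in> carrier A \<and> b \<in> carrier B} \<union>
       {(Gen (a, c \<odot>\<^bsub>B\<^esub> b), Scale c (Gen (a, b))) | c a b.
          c \<in> carrier K \<and> a \<in> carrier A \<and> b \<in> carrier B}\<rparr>"

definition tensor ::
  "('k, 'x) ring_scheme \<Rightarrow> ('k, 'a, 'y) module_scheme \<Rightarrow> ('k, 'b, 'z) module_scheme
    \<Rightarrow> ('k, ('k, 'a, 'b) tensor) module"
  where "tensor K A B = presented K (tensor_pres K A B)"

definition ptens ::
  "('k, 'x) ring_scheme \<Rightarrow> ('k, 'a, 'y) module_scheme \<Rightarrow> ('k, 'b, 'z) module_scheme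
    \<Rightarrow> 'a \<Rightarrow> 'b \<Rightarrow> ('k, 'a, 'b) tensor"
  where "ptens K A B a b = cls K (tensor_pres K A B) (Gen (a, b))"

text \<open>\<open>map_tensor K C D f g\<close> is \<open>f \<otimes> g\<close> with values in \<open>C \<otimes> D\<close>.\<close>

definition map_tensor ::
  "('k, 'x) ring_scheme \<Rightarrow> ('k, 'c, 'y) module_scheme \<Rightarrow> ('k, 'd, 'z) module_scheme
    \<Rightarrow> ('a \<Rightarrow> 'c) \<Rightarrow> ('b \<Rightarrow> 'd) \<Rightarrow> ('k, 'a, 'b) tensor \<Rightarrow> ('k, 'c, 'd) tensor"
  where "map_tensor K C D f g = lin_lift (tensor K C D) (\<lambda>(a, b). ptens K C D (f a) (g b))"

definition tensor_assoc ::
  "('k, 'x) ring_scheme \<Rightarrow> ('k, 'a, 'y) module_scheme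
    \<Rightarrow> ('k, ('k, 'a, 'a) tensor, 'a) tensor \<Rightarrow> ('k, 'a, ('k, 'a, 'a) tensor) tensor"
  where "tensor_assoc K A =
    lin_lift (tensor K A (tensor K A A))
      (\<lambda>(t, c). lin_lift (tensor K A (tensor K A A))
         (\<lambda>(a, b). ptens K A (tensor K A A) a (ptens K A A b c)) t)"

definition tensor_mult ::
  "('k, 'x) ring_scheme \<Rightarrow> ('k, 'a, 'y) module_scheme
    \<Rightarrow> ('k, 'a, 'a) tensor \<Rightarrow> ('k, 'a, 'a) tensor \<Rightarrow> ('k, 'a, 'a) tensor"
  where "tensor_mult K A s t =
    lin_lift (tensor K A A)
      (\<lambda>(a, b). lin_lift (tensor K A A)
         (\<lambda>(a', b'). ptens K A A (a \<otimes>\<^bsub>A\<^esub> a') (b \<otimes>\<^bsub>A\<^esub> b')) t) s"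


section \<open>2-associative algebras and bialgebras\<close>

text \<open>The ring multiplication is the product \<open>*\<close>, the ring unit is the common unit.\<close>

record ('k, 'a) two_as = "('k, 'a) module" +
  dot :: "'a \<Rightarrow> 'a \<Rightarrow> 'a"

record ('k, 'a) two_as_bialg = "('k, 'a) two_as" +
  comult :: "'a \<Rightarrow> ('k, 'a, 'a) tensor"

definition assoc_algebra :: "('k, 'x) ring_scheme \<Rightarrow> ('k, 'a, 'y) module_scheme \<Rightarrow> bool"
  where "assoc_algebra K A \<longleftrightarrow> module K A \<and> ring A \<and>
    (\<forall>c\<in>carrier K. \<forall>x\<in>carrier A. \<forall>y\<in>carrier A.
       (c \<odot>\<^bsub>A\<^esub> x) \<otimes>\<^bsub>A\<^esub> y = c \<odot>\<^bsub>A\<^esub> (x \<otimes>\<^bsub>A\<^esub> y) \<and>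
       x \<otimes>\<^bsub>A\<^esub> (c \<odot>\<^bsub>A\<^esub> y) = c \<odot>\<^bsub>A\<^esub> (x \<otimes>\<^bsub>A\<^esub> y))"

definition dot_alg :: "('k, 'a, 'y) two_as_scheme \<Rightarrow> ('k, 'a, 'y) two_as_scheme"
  where "dot_alg A = A\<lparr>mult := dot A\<rparr>"

definition two_as_algebra :: "('k, 'x) ring_scheme \<Rightarrow> ('k, 'a, 'y) two_as_scheme \<Rightarrow> bool"
  where "two_as_algebra K A \<longleftrightarrow> assoc_algebra K A \<and> assoc_algebra K (dot_alg A)"

definition coassociative :: "('k, 'x) ring_scheme \<Rightarrow> ('k, 'a, 'y) two_as_bialg_scheme \<Rightarrow> bool"
  where "coassociative K H \<longleftrightarrow>
    linear_map K H (tensor K H H) (comult H) \<and>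
    (\<forall>x\<in>carrier H.
       tensor_assoc K H (map_tensor K (tensor K H H) H (comult H) id (comult H x)) =
       map_tensor K H (tensor K H H) id (comult H) (comult H x))"

definition counit ::
  "('k, 'x) ring_scheme \<Rightarrow> ('k, 'a, 'y) two_as_bialg_scheme \<Rightarrow> ('a \<Rightarrow> 'k) \<Rightarrow> bool"
  where "counit K H e \<longleftrightarrow>
    linear_map K H (self_module K) e \<and>
    (\<forall>x\<in>carrier H.
       lin_lift H (\<lambda>(a, b). e a \<odot>\<^bsub>H\<^esub> b) (comult H x) = x \<and>
       lin_lift H (\<lambda>(a, b). e b \<odot>\<^bsub>H\<^esub> a) (comult H x) = x)"

definition bialgebra :: "('k, 'x) ring_scheme \<Rightarrow> ('k, 'a, 'y) two_as_bialg_scheme \<Rightarrow> bool"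
  where "bialgebra K H \<longleftrightarrow>
    assoc_algebra K H \<and>
    coassociative K H \<and>
    comult H \<one>\<^bsub>H\<^esub> = ptens K H H \<one>\<^bsub>H\<^esub> \<one>\<^bsub>H\<^esub> \<and>
    (\<forall>x\<in>carrier H. \<forall>y\<in>carrier H.
       comult H (x \<otimes>\<^bsub>H\<^esub> y) = tensor_mult K H (comult H x) (comult H y)) \<and>
    (\<exists>e. counit K H e \<and> e \<one>\<^bsub>H\<^esub> = \<one>\<^bsub>K\<^esub> \<and>
      (\<forall>x\<in>carrier H. \<forall>y\<in>carrier H. e (x \<otimes>\<^bsub>H\<^esub> y) = e x \<otimes>\<^bsub>K\<^esub> e y))"

definition inf_bialgebra :: "('k, 'x) ring_scheme \<Rightarrow> ('k, 'a, 'y) two_as_bialg_scheme \<Rightarrow> bool"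
  where "inf_bialgebra K H \<longleftrightarrow>
    assoc_algebra K H \<and>
    coassociative K H \<and>
    (\<exists>e. counit K H e) \<and>
    (\<forall>x\<in>carrier H. \<forall>y\<in>carrier H.
       comult H (x \<otimes>\<^bsub>H\<^esub> y) =
         tensor_mult K H (ptens K H H x \<one>\<^bsub>H\<^esub>) (comult H y)
         \<oplus>\<^bsub>tensor K H H\<^esub> tensor_mult K H (comult H x) (ptens K H H \<one>\<^bsub>H\<^esub> y)
         \<ominus>\<^bsub>tensor K H H\<^esub> ptens K H H x y)"

definition two_as_bialgebra :: "('k, 'x) ring_scheme \<Rightarrow> ('k, 'a, 'y) two_as_bialg_scheme \<Rightarrow> bool"
  where "two_as_bialgebra K H \<longleftrightarrow> bialgebra K H \<and> inf_bialgebra K (dot_alg H)"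

definition Prim :: "('k, 'x) ring_scheme \<Rightarrow> ('k, 'a, 'y) two_as_bialg_scheme \<Rightarrow> 'a set"
  where "Prim K H =
    {x \<in> carrier H. comult H x = ptens K H H x \<one>\<^bsub>H\<^esub> \<oplus>\<^bsub>tensor K H H\<^esub> ptens K H H \<one>\<^bsub>H\<^esub> x}"

definition two_as_bialg_iso ::
  "('k, 'x) ring_scheme \<Rightarrow> ('k, 'a, 'y) two_as_bialg_scheme \<Rightarrow> ('k, 'b, 'z) two_as_bialg_scheme
    \<Rightarrow> ('a \<Rightarrow> 'b) \<Rightarrow> bool"
  where "two_as_bialg_iso K H L f \<longleftrightarrow>
    two_as_bialgebra K H \<and> two_as_bialgebra K L \<and>
    bij_betw f (carrier H) (carrier L) \<and>
    linear_map K H L f \<and>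
    f \<one>\<^bsub>H\<^esub> = \<one>\<^bsub>L\<^esub> \<and>
    (\<forall>x\<in>carrier H. \<forall>y\<in>carrier H. f (x \<otimes>\<^bsub>H\<^esub> y) = f x \<otimes>\<^bsub>L\<^esub> f y) \<and>
    (\<forall>x\<in>carrier H. \<forall>y\<in>carrier H. f (dot H x y) = dot L (f x) (f y)) \<and>
    (\<forall>x\<in>carrier H. comult L (f x) = map_tensor K L L f f (comult H x)) \<and>
    (\<forall>e e'. counit K H e \<and> counit K L e' \<longrightarrow> (\<forall>x\<in>carrier H. e' (f x) = e x))"


section \<open>The free 2-associative algebra\<close>

datatype two_as_op = One_op | Star_op | Dot_op

definition free_two_as_pres ::
  "('k, 'x) ring_scheme \<Rightarrow> ('k, 'v, 'y) module_scheme \<Rightarrow> ('k, 'v, two_as_op) presentation"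
  where "free_two_as_pres K V =
    (let F = {(One_op, 0), (Star_op, 2), (Dot_op, 2)};
         T = lterms K F (carrier V)
     in
      \<lparr>ops = F,
       gens = carrier V,
       rels =
         {(Gen (v \<oplus>\<^bsub>V\<^esub> w), Plus (Gen v) (Gen w)) | v w. v \<in> carrier V \<and> w \<in> carrier V} \<union>
         {(Gen (c \<odot>\<^bsub>V\<^esub> v), Scale c (Gen v)) | c v. c \<in> carrier K \<and> v \<in> carrier V} \<union>
         {(Op f [Op f [s, t], u], Op f [s, Op f [t, u]]) | f s t u.
            f \<in> {Star_op, Dot_op} \<and> s \<in> T \<and> t \<in> T \<and> u \<in> T} \<union>
         {(Op f [Op One_op [], t], t) | f t. f \<in> {Star_op, Dot_op} \<and> t \<in> T} \<union>
         {(Op f [t, Op One_op []], t) | f t. f \<in> {Star_op, Dot_op} \<and> t \<in> T}\<rparr>)"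

definition free_two_as ::
  "('k, 'x) ring_scheme \<Rightarrow> ('k, 'v, 'y) module_scheme \<Rightarrow> ('k, ('k, 'v, two_as_op) lterm set) two_as"
  where "free_two_as K V =
    (let P = free_two_as_pres K V; Q = presented K P
     in
      \<lparr>carrier = carrier Q,
       mult = (\<lambda>X Y. presented_op K P Star_op [X, Y]),
       one = presented_op K P One_op [],
       zero = zero Q,
       add = add Q,
       smult = smult Q,
       dot = (\<lambda>X Y. presented_op K P Dot_op [X, Y])\<rparr>)"

definition with_comult ::
  "('k, 'a) two_as \<Rightarrow> ('a \<Rightarrow> ('k, 'a, 'a) tensor) \<Rightarrow> ('k, 'a) two_as_bialg"
  where "with_comult A \<Delta> =
    \<lparr>carrier = carrier A, mult = mult A, one = one A, zero = zero A, add = add A, smult = smult A,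
     dot = dot A, comult = \<Delta>\<rparr>"

text \<open>
  The unique coproduct that makes the free 2-associative algebra a 2-associative bialgebra in which
  the elements of \<open>V\<close> are primitive; it is taken to be extensional because only its values on the
  carrier are determined.
\<close>

definition free_two_as_bialg ::
  "('k, 'x) ring_scheme \<Rightarrow> ('k, 'v, 'y) module_scheme
    \<Rightarrow> ('k, ('k, 'v, two_as_op) lterm set) two_as_bialg"
  where "free_two_as_bialg K V =
    with_comult (free_two_as K V)
      (THE \<Delta>. \<Delta> \<in> extensional (carrier (free_two_as K V)) \<and>
        two_as_bialgebra K (with_comult (free_two_as K V) \<Delta>) \<and>
        (\<forall>v\<in>carrier V. cls K (free_two_as_pres K V) (Gen v)
           \<in> Prim K (with_comult (free_two_as K V) \<Delta>)))"


section \<open>$B_\infty$-algebras\<close>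

text \<open>\<open>tuples k n\<close> enumerates the \<open>k\<close>-tuples of natural numbers with sum \<open>n\<close>.\<close>

definition tuples :: "nat \<Rightarrow> nat \<Rightarrow> nat list list"
  where "tuples k n = filter (\<lambda>a. sum_list a = n) (List.n_lists k [0..<Suc n])"

definition tuple_pairs :: "nat \<Rightarrow> nat \<Rightarrow> nat \<Rightarrow> (nat list \<times> nat list) list"
  where "tuple_pairs k p q = List.product (tuples k p) (tuples k q)"

fun blocks :: "nat list \<Rightarrow> 'a list \<Rightarrow> 'a list list"
  where
    "blocks [] us = []"
  | "blocks (a # as) us = take a us # blocks as (drop a us)"

text \<open>\<open>brace R [u\<^sub>1,\<dots>,u\<^sub>p] [v\<^sub>1,\<dots>,v\<^sub>q]\<close> is $M_{pq}(u_1\cdots u_p, v_1\cdots v_q)$.\<close>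

record ('k, 'a) binf = "('k, 'a) module" +
  brace :: "'a list \<Rightarrow> 'a list \<Rightarrow> 'a"

text \<open>
  The list of tensor factors of
  $M_{a_1b_1}\cdots M_{a_lb_l}(u_1\cdots u_p, v_1\cdots v_q)$.
\<close>

definition brace_blocks ::
  "('a list \<Rightarrow> 'a list \<Rightarrow> 'a) \<Rightarrow> nat list \<times> nat list \<Rightarrow> 'a list \<Rightarrow> 'a list \<Rightarrow> 'a list"
  where "brace_blocks M ab us vs =
    map (\<lambda>(x, y). M x y) (zip (blocks (fst ab) us) (blocks (snd ab) vs))"

definition binf_left :: "('k, 'a, 'y) binf_scheme \<Rightarrow> 'a list \<Rightarrow> 'a list \<Rightarrow> 'a list \<Rightarrow> 'a"
  where "binf_left R us vs ws =
    lsum R (concat (map (\<lambda>l. map (\<lambda>ab. brace R (brace_blocks (brace R) ab us vs) ws)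
                               (tuple_pairs l (length us) (length vs)))
                     [1..<Suc (length us + length vs)]))"

definition binf_right :: "('k, 'a, 'y) binf_scheme \<Rightarrow> 'a list \<Rightarrow> 'a list \<Rightarrow> 'a list \<Rightarrow> 'a"
  where "binf_right R us vs ws =
    lsum R (concat (map (\<lambda>m. map (\<lambda>bc. brace R us (brace_blocks (brace R) bc vs ws))
                               (tuple_pairs m (length vs) (length ws)))
                     [1..<Suc (length vs + length ws)]))"

definition binf_algebra :: "('k, 'x) ring_scheme \<Rightarrow> ('k, 'a, 'y) binf_scheme \<Rightarrow> bool"
  where "binf_algebra K R \<longleftrightarrow> module K R \<and>
    (\<forall>us\<in>lists (carrier R). \<forall>vs\<in>lists (carrier R). brace R us vs \<in> carrier R) \<and>
    (\<forall>us\<in>lists (carrier R). \<forall>us'\<in>lists (carrier R). \<forall>vs\<in>lists (carrier R).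
       (\<forall>x\<in>carrier R. \<forall>y\<in>carrier R.
          brace R (us @ (x \<oplus>\<^bsub>R\<^esub> y) # us') vs
            = brace R (us @ x # us') vs \<oplus>\<^bsub>R\<^esub> brace R (us @ y # us') vs \<and>
          brace R vs (us @ (x \<oplus>\<^bsub>R\<^esub> y) # us')
            = brace R vs (us @ x # us') \<oplus>\<^bsub>R\<^esub> brace R vs (us @ y # us')) \<and>
       (\<forall>c\<in>carrier K. \<forall>x\<in>carrier R.
          brace R (us @ (c \<odot>\<^bsub>R\<^esub> x) # us') vs = c \<odot>\<^bsub>R\<^esub> brace R (us @ x # us') vs \<and>
          brace R vs (us @ (c \<odot>\<^bsub>R\<^esub> x) # us') = c \<odot>\<^bsub>R\<^esub> brace R vs (us @ x # us'))) \<and>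
    brace R [] [] = \<zero>\<^bsub>R\<^esub> \<and>
    (\<forall>u\<in>carrier R. brace R [u] [] = u \<and> brace R [] [u] = u) \<and>
    (\<forall>us\<in>lists (carrier R). 2 \<le> length us \<longrightarrow>
       brace R us [] = \<zero>\<^bsub>R\<^esub> \<and> brace R [] us = \<zero>\<^bsub>R\<^esub>) \<and>
    (\<forall>us\<in>lists (carrier R). \<forall>vs\<in>lists (carrier R). \<forall>ws\<in>lists (carrier R).
       us \<noteq> [] \<longrightarrow> vs \<noteq> [] \<longrightarrow> ws \<noteq> [] \<longrightarrow> binf_left R us vs ws = binf_right R us vs ws)"

definition binf_iso ::
  "('k, 'x) ring_scheme \<Rightarrow> ('k, 'a, 'y) binf_scheme \<Rightarrow> ('k, 'b, 'z) binf_scheme \<Rightarrow> ('a \<Rightarrow> 'b) \<Rightarrow> bool"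
  where "binf_iso K R S f \<longleftrightarrow>
    binf_algebra K R \<and> binf_algebra K S \<and>
    bij_betw f (carrier R) (carrier S) \<and>
    linear_map K R S f \<and>
    (\<forall>us\<in>lists (carrier R). \<forall>vs\<in>lists (carrier R).
       f (brace R us vs) = brace S (map f us) (map f vs))"


subsection \<open>The free $B_\infty$-algebra\<close>

text \<open>The terms on \<open>V\<close> with formal operations; this structure satisfies no axioms.\<close>

definition binf_terms ::
  "('k, 'x) ring_scheme \<Rightarrow> ('k, 'v, 'y) module_scheme \<Rightarrow> ('k, ('k, 'v, nat \<times> nat) lterm) binf"
  where "binf_terms K V =
    \<lparr>carrier = lterms K {((p, q), p + q) | p q. True} (carrier V),
     mult = undefined,
     one = undefined,
     zero = Zero,
     add = Plus,
     smult = Scale,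
     brace = (\<lambda>us vs. Op (length us, length vs) (us @ vs))\<rparr>"

definition free_binf_pres ::
  "('k, 'x) ring_scheme \<Rightarrow> ('k, 'v, 'y) module_scheme \<Rightarrow> ('k, 'v, nat \<times> nat) presentation"
  where "free_binf_pres K V =
    (let T = binf_terms K V; M = brace T
     in
      \<lparr>ops = {((p, q), p + q) | p q. True},
       gens = carrier V,
       rels =
         {(Gen (v \<oplus>\<^bsub>V\<^esub> w), Plus (Gen v) (Gen w)) | v w. v \<in> carrier V \<and> w \<in> carrier V} \<union>
         {(Gen (c \<odot>\<^bsub>V\<^esub> v), Scale c (Gen v)) | c v. c \<in> carrier K \<and> v \<in> carrier V} \<union>
         {(M [] [], Zero)} \<union>
         {(M [t] [], t) | t. t \<in> carrier T} \<union>
         {(M [] [t], t) | t. t \<in> carrier T} \<union>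
         {(M ts [], Zero) | ts. ts \<in> lists (carrier T) \<and> 2 \<le> length ts} \<union>
         {(M [] ts, Zero) | ts. ts \<in> lists (carrier T) \<and> 2 \<le> length ts} \<union>
         {(binf_left T us vs ws, binf_right T us vs ws) | us vs ws.
            us \<in> lists (carrier T) \<and> vs \<in> lists (carrier T) \<and> ws \<in> lists (carrier T) \<and>
            us \<noteq> [] \<and> vs \<noteq> [] \<and> ws \<noteq> []}\<rparr>)"

definition free_binf ::
  "('k, 'x) ring_scheme \<Rightarrow> ('k, 'v, 'y) module_scheme \<Rightarrow> ('k, ('k, 'v, nat \<times> nat) lterm set) binf"
  where "free_binf K V =
    (let P = free_binf_pres K V; Q = presented K P
     in
      \<lparr>carrier = carrier Q,
       mult = undefined,
       one = undefined,
       zero = zero Q,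
       add = add Q,
       smult = smult Q,
       brace = (\<lambda>us vs. presented_op K P (length us, length vs) (us @ vs))\<rparr>)"


subsection \<open>From 2-associative algebras to $B_\infty$-algebras\<close>

definition dots :: "('k, 'a, 'y) two_as_scheme \<Rightarrow> 'a list \<Rightarrow> 'a"
  where "dots A us = foldr (dot A) us \<one>\<^bsub>A\<^esub>"

text \<open>
  Pairs of tuples with a column $(i_s,j_s)=(0,0)$ contribute a factor $M_{00}=0$.  Leaving them
  out makes the recursion below well-founded and bounds the number of blocks by \<open>p + q\<close>.
\<close>

definition reduced_pairs :: "nat \<Rightarrow> nat \<Rightarrow> nat \<Rightarrow> (nat list \<times> nat list) list"
  where "reduced_pairs k p q = filter (\<lambda>(a, b). (0, 0) \<notin> set (zip a b)) (tuple_pairs k p q)"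

lemma length_tuples: "a \<in> set (tuples k n) \<Longrightarrow> length a = k \<and> sum_list a = n"
  by (auto simp: tuples_def set_n_lists)

lemma blocks_bound:
  assumes "length a = length b"
    and "(x, y) \<in> set (zip (blocks a us) (blocks b vs))" "(0, 0) \<notin> set (zip a b)"
  shows "length x + length y + length a \<le> Suc (sum_list a + sum_list b)"
  using assms
proof (induction a b arbitrary: us vs rule: list_induct2)
  case Nil
  then show ?case by simp
next
  case (Cons m a n b)
  have ge: "length a \<le> sum_list a + sum_list b"
    if "length a = length b" "(0, 0) \<notin> set (zip a b)" for a b :: "nat list"
    using that by (induction a b rule: list_induct2) auto
  consider "x = take m us" "y = take n vs"
    | "(x, y) \<in> set (zip (blocks a (drop m us)) (blocks b (drop n vs)))"
    using Cons.prems by auto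
  then show ?case
  proof cases
    case 1
    then have "length x \<le> m" "length y \<le> n" by simp_all
    with ge[of a b] Cons.hyps Cons.prems(2) show ?thesis by simp
  next
    case 2
    from Cons.IH[OF 2] Cons.prems(2) show ?thesis by auto
  qed
qed

lemma reduced_pairs_decrease:
  assumes "ab \<in> set (reduced_pairs k p q)" "2 \<le> k"
    and "(x, y) \<in> set (zip (blocks (fst ab) us) (blocks (snd ab) vs))"
  shows "length x + length y < p + q"
proof -
  from assms(1) have "length (fst ab) = k" "length (snd ab) = k" "sum_list (fst ab) = p"
      "sum_list (snd ab) = q" "(0, 0) \<notin> set (zip (fst ab) (snd ab))"
    by (auto simp: reduced_pairs_def tuple_pairs_def dest: length_tuples)
  with blocks_bound[OF _ assms(3)] assms(2) show ?thesis by simp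
qed

lemma brace_blocks_cong [fundef_cong]:
  assumes "ab = ab'" "us = us'" "vs = vs'"
    and "\<And>x y. (x, y) \<in> set (zip (blocks (fst ab') us') (blocks (snd ab') vs')) \<Longrightarrow> M x y = M' x y"
  shows "brace_blocks M ab us vs = brace_blocks M' ab' us' vs'"
  using assms by (auto simp: brace_blocks_def)

function two_as_brace :: "('k, 'a, 'y) two_as_scheme \<Rightarrow> 'a list \<Rightarrow> 'a list \<Rightarrow> 'a"
  where "two_as_brace A us vs =
    (if us = [] \<or> vs = [] then
       (if length us + length vs = 1 then hd (us @ vs) else \<zero>\<^bsub>A\<^esub>)
     else
       (dots A us \<otimes>\<^bsub>A\<^esub> dots A vs) \<ominus>\<^bsub>A\<^esub>
         lsum A (concat (map (\<lambda>k. map (\<lambda>ab. dots A (brace_blocks (two_as_brace A) ab us vs))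
                                    (reduced_pairs k (length us) (length vs)))
                          [2..<Suc (length us + length vs)])))"
  by pat_completeness auto
termination
  by (relation "measure (\<lambda>(A, us, vs). length us + length vs)")
     (auto dest: reduced_pairs_decrease)

declare two_as_brace.simps [simp del]

definition binf_of_two_as :: "('k, 'a, 'y) two_as_scheme \<Rightarrow> ('k, 'a) binf"
  where "binf_of_two_as A =
    \<lparr>carrier = carrier A, mult = mult A, one = one A, zero = zero A, add = add A, smult = smult A,
     brace = two_as_brace A\<rparr>"

definition Prim_binf ::
  "('k, 'x) ring_scheme \<Rightarrow> ('k, 'a, 'y) two_as_bialg_scheme \<Rightarrow> ('k, 'a) binf"
  where "Prim_binf K H = (binf_of_two_as H)\<lparr>carrier := Prim K H\<rparr>"


section \<open>The 2-associative bialgebra $T^{fc}(R)$\<close>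

text \<open>
  The generators are the words \<open>r\<^sub>1\<cdots>r\<^sub>n\<close> of all lengths; every relation involves words of one
  length only, so the presented space is the direct sum of the tensor powers of \<open>R\<close>.
\<close>

definition words_pres ::
  "('k, 'x) ring_scheme \<Rightarrow> ('k, 'a, 'y) module_scheme \<Rightarrow> ('k, 'a list, unit) presentation"
  where "words_pres K R =
    \<lparr>ops = {},
     gens = lists (carrier R),
     rels =
       {(Gen (us @ (x \<oplus>\<^bsub>R\<^esub> y) # vs), Plus (Gen (us @ x # vs)) (Gen (us @ y # vs))) | us x y vs.
          us \<in> lists (carrier R) \<and> x \<in> carrier R \<and> y \<in> carrier R \<and> vs \<in> lists (carrier R)} \<union>
       {(Gen (us @ (c \<odot>\<^bsub>R\<^esub> x) # vs), Scale c (Gen (us @ x # vs))) | us c x vs.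
          us \<in> lists (carrier R) \<and> c \<in> carrier K \<and> x \<in> carrier R \<and> vs \<in> lists (carrier R)}\<rparr>"

definition words ::
  "('k, 'x) ring_scheme \<Rightarrow> ('k, 'a, 'y) module_scheme \<Rightarrow> ('k, ('k, 'a list, unit) lterm set) module"
  where "words K R = presented K (words_pres K R)"

definition word ::
  "('k, 'x) ring_scheme \<Rightarrow> ('k, 'a, 'y) module_scheme \<Rightarrow> 'a list \<Rightarrow> ('k, 'a list, unit) lterm set"
  where "word K R us = cls K (words_pres K R) (Gen us)"

text \<open>
  A word of more than \<open>p + q\<close> blocks contains a factor $M_{00}=0$, so the sum over \<open>k\<close> may stop
  at \<open>p + q\<close>.  The summand \<open>k = 0\<close> is present only for \<open>p = q = 0\<close>, where it gives the unit
  relation \<open>1 * 1 = 1\<close>.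
\<close>

definition word_star ::
  "('k, 'x) ring_scheme \<Rightarrow> ('k, 'a, 'y) binf_scheme \<Rightarrow> 'a list \<Rightarrow> 'a list
    \<Rightarrow> ('k, 'a list, unit) lterm set"
  where "word_star K R us vs =
    lsum (words K R)
      (concat (map (\<lambda>k. map (\<lambda>ij. word K R (brace_blocks (brace R) ij us vs))
                         (tuple_pairs k (length us) (length vs)))
                [0..<Suc (length us + length vs)]))"

definition Tfc ::
  "('k, 'x) ring_scheme \<Rightarrow> ('k, 'a, 'y) binf_scheme \<Rightarrow> ('k, ('k, 'a list, unit) lterm set) two_as_bialg"
  where "Tfc K R =
    (let T = words K R
     in
      \<lparr>carrier = carrier T,
       mult = (\<lambda>X Y. lin_lift T (\<lambda>us. lin_lift T (\<lambda>vs. word_star K R us vs) Y) X),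
       one = word K R [],
       zero = zero T,
       add = add T,
       smult = smult T,
       dot = (\<lambda>X Y. lin_lift T (\<lambda>us. lin_lift T (\<lambda>vs. word K R (us @ vs)) Y) X),
       comult = lin_lift (tensor K T T)
         (\<lambda>us. lsum (tensor K T T)
            (map (\<lambda>i. ptens K T T (word K R (take i us)) (word K R (drop i us)))
              [0..<Suc (length us)]))\<rparr>)"

end

theory Submission
  imports Defs
begin

text \<open>
  The product \<open>*\<close> on words is determined by its letter components: if \<open>q\<close> projects a word to its
  component of length one, every \<open>t\<close> satisfies $t = \varepsilon(t) 1 + (q t_{(1)}) \cdot t_{(2)}$, and
  \<open>\<Delta>\<close> is multiplicative for \<open>*\<close> whenever the braces satisfy only the unit conditions.  Hence, by
  induction on the total length, \<open>(u * v) * w\<close> and \<open>u * (v * w)\<close> differ only in their letter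
  components, and these are the two sides of the $B_\infty$ relation.  This gives associativity of
  \<open>*\<close> on \<open>T\<^sup>f\<^sup>c(R)\<close> for a $B_\infty$-algebra \<open>R\<close>.  Conversely, the braces of a 2-associative algebra \<open>A\<close>
  make the evaluation of words in \<open>A\<close> multiplicative for \<open>*\<close>, so the letter components agree and \<open>A\<close>
  satisfies the $B_\infty$ relation.

  The inclusion of \<open>V\<close> into \<open>T\<^sup>f\<^sup>c(B\<^sub>\<infinity>(V))\<close> extends to \<open>\<phi>\<close> on the free 2-associative algebra, and the
  $B_\infty$ morphism from \<open>B\<^sub>\<infinity>(V)\<close> to the free 2-associative algebra extends to words.  The two
  composites are morphisms fixing \<open>V\<close>, hence identities.  The coproduct of the free 2-associative
  algebra is the one transported along \<open>\<phi>\<close>, since a compatible coproduct is determined by its values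
  on \<open>V\<close>; and the primitive elements of \<open>T\<^sup>f\<^sup>c(R)\<close> are the one-letter words.
\<close>

section \<open>Sums over lists, linear and multilinear maps\<close>

text \<open>The obstacle is a circularity: the B-infinity relation for the braces of
  \<open>A\<close> is to be read off from the associativity of the product of words over
  \<open>A\<close>, while that associativity is normally deduced from the relation. The way out is
  that, once shorter triples of words agree, the two bracketings have the form "letter plus
  \<open>z\<close>" with one and the same \<open>z\<close>. Any linear map that returns the letter
  of a one-letter word and does not distinguish the bracketings then forces the letters to agree.
  For \<open>A\<close> such a map is the evaluation of words, because \<open>*\<close> is
  associative in \<open>A\<close>. For a B-infinity algebra the relation itself equates the letters.
  Everything up to this comparison is therefore developed for braces subject only to multilinearity
  and the unit conditions.

  All spaces are given by generators and relations, without bases or gradings. Maps are constructed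
  from universal properties, equalities are checked on generators, and bijectivity is shown by
  exhibiting an inverse.\<close>

lemma lsum_simps [simp]:
  "lsum R [] = \<zero>\<^bsub>R\<^esub>"
  "lsum R (x # xs) = x \<oplus>\<^bsub>R\<^esub> lsum R xs"
  by (simp_all add: lsum_def)

context abelian_monoid
begin

lemma lsum_closed [simp, intro]: "set xs \<subseteq> carrier G \<Longrightarrow> lsum G xs \<in> carrier G"
  by (induction xs) auto

lemma lsum_map_closed [simp, intro]:
  "(\<And>x. x \<in> set xs \<Longrightarrow> f x \<in> carrier G) \<Longrightarrow> lsum G (map f xs) \<in> carrier G"
  by (rule lsum_closed) auto

lemma lsum_append:
  "set xs \<subseteq> carrier G \<Longrightarrow> set ys \<subseteq> carrier G \<Longrightarrow> lsum G (xs @ ys) = lsum G xs \<oplus> lsum G ys"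
  by (induction xs) (auto simp: a_assoc)

lemma lsum_concat:
  "(\<And>xs. xs \<in> set xss \<Longrightarrow> set xs \<subseteq> carrier G) \<Longrightarrow> lsum G (concat xss) = lsum G (map (lsum G) xss)"
  by (induction xss) (auto simp: lsum_append UN_subset_iff)

lemma lsum_add:
  "(\<And>x. x \<in> set xs \<Longrightarrow> f x \<in> carrier G) \<Longrightarrow> (\<And>x. x \<in> set xs \<Longrightarrow> g x \<in> carrier G) \<Longrightarrow>
   lsum G (map (\<lambda>x. f x \<oplus> g x) xs) = lsum G (map f xs) \<oplus> lsum G (map g xs)"
proof (induction xs)
  case (Cons x xs)
  have "lsum G (map f xs) \<in> carrier G" "lsum G (map g xs) \<in> carrier G"
    by (rule lsum_closed; use Cons.prems in auto)+
  with Cons show ?case by (simp add: add.m_ac)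
qed simp

lemma lsum_zero: "set xs \<subseteq> {\<zero>} \<Longrightarrow> lsum G xs = \<zero>"
  by (induction xs) auto

lemma lsum_filter:
  "(\<And>x. x \<in> set xs \<Longrightarrow> f x \<in> carrier G) \<Longrightarrow> (\<And>x. x \<in> set xs \<Longrightarrow> \<not> P x \<Longrightarrow> f x = \<zero>) \<Longrightarrow>
   lsum G (map f (filter P xs)) = lsum G (map f xs)"
proof (induction xs)
  case (Cons x xs)
  have "lsum G (map f xs) \<in> carrier G" by (rule lsum_closed) (use Cons.prems in auto)
  with Cons show ?case by simp
qed simp

lemma lsum_distinct:
  assumes "distinct xs" "distinct ys" "set xs = set ys" "\<And>x. x \<in> set xs \<Longrightarrow> f x \<in> carrier G"
  shows "lsum G (map f xs) = lsum G (map f ys)"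
  using assms
proof (induction xs arbitrary: ys)
  case (Cons x xs)
  from Cons.prems(3) have "x \<in> set ys" by auto
  then obtain as bs where ys: "ys = as @ x # bs" by (meson split_list)
  have c: "f ` set as \<subseteq> carrier G" "f ` set bs \<subseteq> carrier G" "f x \<in> carrier G"
    using Cons.prems(4) Cons.prems(3)[symmetric] by (auto simp: ys)
  have "lsum G (map f xs) = lsum G (map f (as @ bs))"
    using Cons.prems by (intro Cons.IH) (auto simp: ys insert_ident)
  then show ?case using c by (simp add: ys lsum_append add.m_lcomm)
qed simp

lemma lsum_swap:
  assumes "\<And>x y. x \<in> set xs \<Longrightarrow> y \<in> set ys \<Longrightarrow> f x y \<in> carrier G"
  shows "lsum G (map (\<lambda>x. lsum G (map (f x) ys)) xs) = lsum G (map (\<lambda>y. lsum G (map (\<lambda>x. f x y) xs)) ys)"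
  using assms
proof (induction xs)
  case Nil
  then show ?case by (simp, subst lsum_zero) auto
next
  case (Cons x xs)
  then have "lsum G (map (\<lambda>x. lsum G (map (f x) ys)) xs) = lsum G (map (\<lambda>y. lsum G (map (\<lambda>x. f x y) xs)) ys)"
    by simp
  then show ?case
    using Cons.prems by (simp, subst lsum_add) auto
qed

end

lemma linear_mapI:
  assumes "\<And>x. x \<in> carrier A \<Longrightarrow> f x \<in> carrier B"
    and "\<And>x y. x \<in> carrier A \<Longrightarrow> y \<in> carrier A \<Longrightarrow> f (x \<oplus>\<^bsub>A\<^esub> y) = f x \<oplus>\<^bsub>B\<^esub> f y"
    and "\<And>c x. c \<in> carrier K \<Longrightarrow> x \<in> carrier A \<Longrightarrow> f (c \<odot>\<^bsub>A\<^esub> x) = c \<odot>\<^bsub>B\<^esub> f x"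
  shows "linear_map K A B f"
  using assms by (auto simp: linear_map_def)

lemma
  assumes "linear_map K A B f"
  shows linear_map_closed: "x \<in> carrier A \<Longrightarrow> f x \<in> carrier B"
    and linear_map_add: "x \<in> carrier A \<Longrightarrow> y \<in> carrier A \<Longrightarrow> f (x \<oplus>\<^bsub>A\<^esub> y) = f x \<oplus>\<^bsub>B\<^esub> f y"
    and linear_map_smult: "c \<in> carrier K \<Longrightarrow> x \<in> carrier A \<Longrightarrow> f (c \<odot>\<^bsub>A\<^esub> x) = c \<odot>\<^bsub>B\<^esub> f x"
  using assms by (auto simp: linear_map_def)

lemma linear_map_cong:
  assumes "linear_map K A B f" "\<And>x. x \<in> carrier A \<Longrightarrow> f x = g x" "module K A"
  shows "linear_map K A B g"
proof -
  interpret A: module K A by fact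
  show ?thesis using assms(1,2) by (auto simp: linear_map_def Pi_iff)
qed

lemma linear_map_comp:
  "linear_map K A B f \<Longrightarrow> linear_map K B C g \<Longrightarrow> linear_map K A C (\<lambda>x. g (f x))"
  by (auto simp: linear_map_def Pi_iff)

lemma linear_map_id: "linear_map K A A (\<lambda>x. x)"
  by (auto simp: linear_map_def)

lemma linear_map_id': "linear_map K A A id"
  by (auto simp: linear_map_def)

lemma linear_map_const_zero: "module K B \<Longrightarrow> linear_map K A B (\<lambda>x. \<zero>\<^bsub>B\<^esub>)"
proof -
  assume "module K B"
  then interpret B: module K B .
  show ?thesis by (auto simp: linear_map_def)
qed

lemma linear_map_add_fun:
  assumes "linear_map K A B f" "linear_map K A B g" "module K B"
  shows "linear_map K A B (\<lambda>x. f x \<oplus>\<^bsub>B\<^esub> g x)"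
proof -
  interpret B: module K B by fact
  show ?thesis
    by (rule linear_mapI)
       (simp_all add: linear_map_closed[OF assms(1)] linear_map_closed[OF assms(2)]
          linear_map_add[OF assms(1)] linear_map_add[OF assms(2)] linear_map_smult[OF assms(1)]
          linear_map_smult[OF assms(2)] B.smult_r_distr B.M.add.m_ac)
qed

lemma linear_map_smult_fun:
  assumes "linear_map K A B f" "module K B" "c \<in> carrier K"
  shows "linear_map K A B (\<lambda>x. c \<odot>\<^bsub>B\<^esub> f x)"
proof -
  interpret B: module K B by fact
  show ?thesis
    by (rule linear_mapI)
       (simp_all add: assms(3) linear_map_closed[OF assms(1)] linear_map_add[OF assms(1)]
          linear_map_smult[OF assms(1)] B.smult_r_distr B.smult_assoc1[symmetric],
        simp add: B.R.m_comm assms(3))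
qed

lemma linear_map_zero:
  assumes "linear_map K A B f" "module K A" "module K B"
  shows "f \<zero>\<^bsub>A\<^esub> = \<zero>\<^bsub>B\<^esub>"
proof -
  interpret A: module K A by fact
  interpret B: module K B by fact
  have "f (\<zero>\<^bsub>K\<^esub> \<odot>\<^bsub>A\<^esub> \<zero>\<^bsub>A\<^esub>) = \<zero>\<^bsub>K\<^esub> \<odot>\<^bsub>B\<^esub> f \<zero>\<^bsub>A\<^esub>"
    using assms(1) by (intro linear_map_smult) auto
  then show ?thesis using linear_map_closed[OF assms(1)] by simp
qed

lemma linear_map_a_inv:
  assumes "linear_map K A B f" "module K A" "module K B" "x \<in> carrier A"
  shows "f (\<ominus>\<^bsub>A\<^esub> x) = \<ominus>\<^bsub>B\<^esub> f x"
proof -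
  interpret A: module K A by fact
  interpret B: module K B by fact
  have "f (\<ominus>\<^bsub>A\<^esub> x) \<oplus>\<^bsub>B\<^esub> f x = \<zero>\<^bsub>B\<^esub>"
    using assms linear_map_add[OF assms(1), of "\<ominus>\<^bsub>A\<^esub> x" x] linear_map_zero[OF assms(1-3)]
    by (simp add: A.M.l_neg)
  then show ?thesis using assms linear_map_closed[OF assms(1)] by (metis A.M.a_inv_closed B.M.minus_equality)
qed

lemma linear_map_minus:
  assumes "linear_map K A B f" "module K A" "module K B" "x \<in> carrier A" "y \<in> carrier A"
  shows "f (x \<ominus>\<^bsub>A\<^esub> y) = f x \<ominus>\<^bsub>B\<^esub> f y"
proof -
  interpret A: module K A by fact
  show ?thesis using assms linear_map_add[OF assms(1)] linear_map_a_inv[OF assms(1-3)]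
    by (simp add: a_minus_def)
qed

lemma linear_map_minus_fun:
  assumes "linear_map K A B f" "linear_map K A B g" "module K B"
  shows "linear_map K A B (\<lambda>x. f x \<ominus>\<^bsub>B\<^esub> g x)"
proof -
  interpret B: module K B by fact
  show ?thesis using assms(1,2)
    by (auto simp: linear_map_def Pi_iff B.smult_r_distr B.M.add.m_ac a_minus_def B.M.minus_add
          B.smult_r_minus)
qed

lemma linear_map_lsum:
  assumes "linear_map K A B f" "module K A" "module K B" "set xs \<subseteq> carrier A"
  shows "f (lsum A xs) = lsum B (map f xs)"
proof -
  interpret A: module K A by fact
  show ?thesis using assms(4)
    by (induction xs) (simp_all add: linear_map_zero[OF assms(1-3)] linear_map_add[OF assms(1)])
qed

lemma linear_map_lsum_fun:
  assumes "\<And>i. i \<in> set is \<Longrightarrow> linear_map K A B (f i)" "module K B"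
  shows "linear_map K A B (\<lambda>x. lsum B (map (\<lambda>i. f i x) is))"
  using assms(1)
  by (induction "is") (simp_all add: linear_map_const_zero linear_map_add_fun assms(2))

text \<open>The multiplication and unit of a module record are junk for \<open>module\<close>, so
  structures that differ only there, such as \<open>words\<close> and \<open>Tfc\<close>, or a
  presented module and the free algebra on it, share the module axioms.\<close>

lemma module_cong:
  assumes "module K A" "carrier B = carrier A" "add B = add A" "zero B = zero A" "smult B = smult A"
  shows "module K B"
proof -
  interpret A: module K A by fact
  have "abelian_group B"
    by (rule abelian_groupI) (auto simp: assms A.M.a_assoc A.M.add.m_ac intro: bexI[of _ "\<ominus>\<^bsub>A\<^esub> _"] simp: A.M.l_neg)
  then show ?thesis
    by (intro moduleI) (auto simp: assms A.R.cring_axioms A.smult_l_distr A.smult_r_distr A.smult_assoc1)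
qed

lemma a_inv_cong:
  "carrier B = carrier A \<Longrightarrow> add B = add A \<Longrightarrow> zero B = zero A \<Longrightarrow> \<ominus>\<^bsub>B\<^esub> x = \<ominus>\<^bsub>A\<^esub> x"
  by (simp add: a_inv_def m_inv_def)

lemma a_minus_cong:
  "carrier B = carrier A \<Longrightarrow> add B = add A \<Longrightarrow> zero B = zero A \<Longrightarrow> x \<ominus>\<^bsub>B\<^esub> y = x \<ominus>\<^bsub>A\<^esub> y"
  by (simp add: a_minus_def a_inv_cong[of B A])

lemma lsum_cong: "add B = add A \<Longrightarrow> zero B = zero A \<Longrightarrow> lsum B xs = lsum A xs"
  by (simp add: lsum_def)

lemma module_self: "cring K \<Longrightarrow> module K (self_module K)"
proof -
  assume "cring K"
  then interpret cring K .
  have "abelian_group (self_module K)"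
    by (rule abelian_groupI) (auto simp: self_module_def a_assoc add.m_ac l_neg intro: bexI[of _ "\<ominus>\<^bsub>K\<^esub> _"])
  then show ?thesis
    by (intro moduleI)
       (auto simp: self_module_def \<open>cring K\<close> l_distr r_distr m_assoc)
qed

section \<open>Bilinear and multilinear maps\<close>

definition bilinear ::
  "('k, 'x) ring_scheme \<Rightarrow> ('k, 'a, 'y) module_scheme \<Rightarrow> ('k, 'b, 'z) module_scheme
    \<Rightarrow> ('k, 'c, 'w) module_scheme \<Rightarrow> ('a \<Rightarrow> 'b \<Rightarrow> 'c) \<Rightarrow> bool"
  where "bilinear K A B C f \<longleftrightarrow>
    (\<forall>a\<in>carrier A. linear_map K B C (f a)) \<and> (\<forall>b\<in>carrier B. linear_map K A C (\<lambda>a. f a b))"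

lemma bilinearI:
  assumes "\<And>a. a \<in> carrier A \<Longrightarrow> linear_map K B C (f a)"
    and "\<And>b. b \<in> carrier B \<Longrightarrow> linear_map K A C (\<lambda>a. f a b)"
  shows "bilinear K A B C f"
  using assms by (simp add: bilinear_def)

lemma
  assumes "bilinear K A B C f"
  shows bilinear_left: "b \<in> carrier B \<Longrightarrow> linear_map K A C (\<lambda>a. f a b)"
    and bilinear_right: "a \<in> carrier A \<Longrightarrow> linear_map K B C (f a)"
    and bilinear_closed: "a \<in> carrier A \<Longrightarrow> b \<in> carrier B \<Longrightarrow> f a b \<in> carrier C"
  using assms by (auto simp: bilinear_def dest: linear_map_closed)

lemma bilinear_comp:
  assumes "bilinear K A B C f" "linear_map K C D g"
  shows "bilinear K A B D (\<lambda>a b. g (f a b))"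
  by (rule bilinearI)
     (rule linear_map_comp[OF bilinear_right[OF assms(1)] assms(2)] linear_map_comp[OF bilinear_left[OF assms(1)] assms(2)], assumption)+

lemma bilinear_comp_args:
  assumes "bilinear K A B C f" "linear_map K A' A g" "linear_map K B' B h"
  shows "bilinear K A' B' C (\<lambda>a b. f (g a) (h b))"
proof (rule bilinearI)
  show "linear_map K B' C (\<lambda>b. f (g a) (h b))" if "a \<in> carrier A'" for a
    using linear_map_comp[OF assms(3) bilinear_right[OF assms(1) linear_map_closed[OF assms(2) that]]] .
  show "linear_map K A' C (\<lambda>a. f (g a) (h b))" if "b \<in> carrier B'" for b
    using linear_map_comp[OF assms(2) bilinear_left[OF assms(1) linear_map_closed[OF assms(3) that]]] .
qed

text \<open>Words of all lengths are treated at once: \<open>h\<close> bundles one multilinear map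
  for each length, and its value on the empty word may be any element of \<open>W\<close>.\<close>

definition multilinear ::
  "('k, 'x) ring_scheme \<Rightarrow> ('k, 'a, 'y) module_scheme \<Rightarrow> ('k, 'b, 'z) module_scheme
    \<Rightarrow> ('a list \<Rightarrow> 'b) \<Rightarrow> bool"
  where "multilinear K R W h \<longleftrightarrow>
    (\<forall>us\<in>lists (carrier R). h us \<in> carrier W) \<and>
    (\<forall>us\<in>lists (carrier R). \<forall>vs\<in>lists (carrier R). linear_map K R W (\<lambda>x. h (us @ x # vs)))"

lemma multilinearI:
  assumes "\<And>us. us \<in> lists (carrier R) \<Longrightarrow> h us \<in> carrier W"
    and "\<And>us vs. us \<in> lists (carrier R) \<Longrightarrow> vs \<in> lists (carrier R) \<Longrightarrow>
      linear_map K R W (\<lambda>x. h (us @ x # vs))"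
  shows "multilinear K R W h"
  using assms by (simp add: multilinear_def)

lemma
  assumes "multilinear K R W h"
  shows multilinear_closed: "us \<in> lists (carrier R) \<Longrightarrow> h us \<in> carrier W"
    and multilinear_linear: "us \<in> lists (carrier R) \<Longrightarrow> vs \<in> lists (carrier R) \<Longrightarrow>
      linear_map K R W (\<lambda>x. h (us @ x # vs))"
  using assms by (simp_all add: multilinear_def)

lemma multilinear_zero:
  assumes "multilinear K R W h" "module K R" "module K W" "us \<in> lists (carrier R)" "\<zero>\<^bsub>R\<^esub> \<in> set us"
  shows "h us = \<zero>\<^bsub>W\<^esub>"
proof -
  obtain as bs where "us = as @ \<zero>\<^bsub>R\<^esub> # bs" using assms(5) by (meson split_list)
  then show ?thesis using linear_map_zero[OF multilinear_linear[OF assms(1)] assms(2,3), of as bs] assms(4)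
    by simp
qed

lemma multilinear_comp:
  "multilinear K R W h \<Longrightarrow> linear_map K W W' g \<Longrightarrow> multilinear K R W' (\<lambda>us. g (h us))"
  by (rule multilinearI)
     (blast intro: linear_map_closed multilinear_closed, rule linear_map_comp[OF multilinear_linear])

lemma multilinear_Cons:
  "multilinear K R W h \<Longrightarrow> x \<in> carrier R \<Longrightarrow> multilinear K R W (\<lambda>us. h (x # us))"
  by (rule multilinearI) (simp_all add: multilinear_closed multilinear_linear[of _ _ _ _ "x # _", simplified])

lemma multilinear_append:
  assumes "multilinear K R W h" "as \<in> lists (carrier R)" "bs \<in> lists (carrier R)"
  shows "multilinear K R W (\<lambda>us. h (as @ us @ bs))"
proof (rule multilinearI)
  fix us vs assume "us \<in> lists (carrier R)" "vs \<in> lists (carrier R)"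
  then show "linear_map K R W (\<lambda>x. h (as @ (us @ x # vs) @ bs))"
    using multilinear_linear[OF assms(1), of "as @ us" "vs @ bs"] assms by simp
qed (use assms in \<open>simp add: multilinear_closed\<close>)

section \<open>Presented modules and their universal property\<close>

primrec geval ::
  "('k, 'w, 'y) module_scheme \<Rightarrow> ('g \<Rightarrow> 'w) \<Rightarrow> ('o \<Rightarrow> 'w list \<Rightarrow> 'w) \<Rightarrow> ('k, 'g, 'o) lterm \<Rightarrow> 'w"
  where
    "geval W f I (Gen g) = f g"
  | "geval W f I Zero = \<zero>\<^bsub>W\<^esub>"
  | "geval W f I (Plus s t) = geval W f I s \<oplus>\<^bsub>W\<^esub> geval W f I t"
  | "geval W f I (Scale c t) = c \<odot>\<^bsub>W\<^esub> geval W f I t"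
  | "geval W f I (Op q ts) = I q (map (geval W f I) ts)"

text \<open>The data from which a linear map out of a presented structure can be defined: an
  interpretation of generators and operation symbols that is multilinear and validates the
  relations.\<close>

definition pmodel ::
  "('k, 'x) ring_scheme \<Rightarrow> ('k, 'g, 'o) presentation \<Rightarrow> ('k, 'w, 'y) module_scheme
    \<Rightarrow> ('g \<Rightarrow> 'w) \<Rightarrow> ('o \<Rightarrow> 'w list \<Rightarrow> 'w) \<Rightarrow> bool"
  where "pmodel K P W f I \<longleftrightarrow>
    module K W \<and> f \<in> gens P \<rightarrow> carrier W \<and>
    (\<forall>q ts. (q, length ts) \<in> ops P \<longrightarrow> ts \<in> lists (carrier W) \<longrightarrow> I q ts \<in> carrier W) \<and>
    (\<forall>q ss us. (q, Suc (length ss + length us)) \<in> ops P \<longrightarrow>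
       ss \<in> lists (carrier W) \<longrightarrow> us \<in> lists (carrier W) \<longrightarrow>
       linear_map K W W (\<lambda>x. I q (ss @ x # us))) \<and>
    (\<forall>(s, t)\<in>rels P. geval W f I s = geval W f I t)"

lemma pmodel_module: "pmodel K P W f I \<Longrightarrow> module K W"
  by (simp add: pmodel_def)

lemma geval_closed:
  assumes "module K W" "f \<in> gens P \<rightarrow> carrier W"
    and "\<And>q ts. (q, length ts) \<in> ops P \<Longrightarrow> ts \<in> lists (carrier W) \<Longrightarrow> I q ts \<in> carrier W"
    and "t \<in> pterms K P"
  shows "geval W f I t \<in> carrier W"
proof -
  interpret W: module K W by fact
  show ?thesis using assms(4)
  proof induction
    case (5 ts q)
    then have "map (geval W f I) ts \<in> lists (carrier W)" by auto
    then show ?case using assms(3) 5 by simp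
  qed (use assms(2) in auto)
qed

lemma pmodel_geval_closed:
  assumes "pmodel K P W f I" "t \<in> pterms K P"
  shows "geval W f I t \<in> carrier W"
  using assms by (intro geval_closed[where P = P]) (auto simp: pmodel_def)

locale pres =
  fixes K :: "('k, 'x) ring_scheme" and P :: "('k, 'g, 'o) presentation"
  assumes cring: "cring K"
    and rels: "rels P \<subseteq> pterms K P \<times> pterms K P"
begin

abbreviation Q where "Q \<equiv> presented K P"

lemma lcong_pterms:
  "(s, t) \<in> lcong K P \<Longrightarrow> s \<in> pterms K P \<and> t \<in> pterms K P"
proof (induction rule: lcong.induct)
  case (rel s t)
  then show ?case using rels by auto
next
  case (op_cong t t' ss us f)
  then show ?case by (auto intro!: lterms.intros)
qed (use cring in \<open>auto intro!: lterms.intros simp: cring.cring_simprules\<close>)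

lemma equiv_lcong: "equiv (pterms K P) (lcong K P)"
  by (rule equivI) (auto intro!: refl_onI symI transI intro: lcong.intros lcong_pterms dest: lcong_pterms)

lemma cls_eq_iff:
  "s \<in> pterms K P \<Longrightarrow> t \<in> pterms K P \<Longrightarrow> cls K P s = cls K P t \<longleftrightarrow> (s, t) \<in> lcong K P"
  unfolding cls_def by (rule eq_equiv_class_iff[OF equiv_lcong])

lemma cls_eqI: "(s, t) \<in> lcong K P \<Longrightarrow> cls K P s = cls K P t"
  using lcong_pterms cls_eq_iff by blast

lemma cls_carrier: "t \<in> pterms K P \<Longrightarrow> cls K P t \<in> carrier Q"
  by (auto simp: presented_def cls_def quotientI)

text \<open>The operations of a presented structure are computed on representatives chosen by
  \<open>SOME\<close>; this is why their values do not depend on the choice.\<close>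

lemma rep_lcong:
  assumes "t \<in> pterms K P"
  shows "(t, rep (cls K P t)) \<in> lcong K P"
proof -
  have "t \<in> cls K P t" using assms by (auto simp: cls_def intro: lcong.refl)
  then have "rep (cls K P t) \<in> cls K P t" unfolding rep_def by (rule someI)
  then show ?thesis by (simp add: cls_def)
qed

lemma rep_pterms: "X \<in> carrier Q \<Longrightarrow> rep X \<in> pterms K P"
  and cls_rep: "X \<in> carrier Q \<Longrightarrow> cls K P (rep X) = X"
proof -
  assume "X \<in> carrier Q"
  then obtain t where t: "t \<in> pterms K P" "X = cls K P t"
    by (auto simp: presented_def cls_def elim: quotientE)
  show "rep X \<in> pterms K P" using rep_lcong[OF t(1)] lcong_pterms t(2) by blast
  show "cls K P (rep X) = X" using cls_eqI[OF rep_lcong[OF t(1)]] t(2) by simp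
qed

lemma presented_zero: "\<zero>\<^bsub>Q\<^esub> = cls K P Zero"
  by (simp add: presented_def)

lemma presented_add:
  assumes "s \<in> pterms K P" "t \<in> pterms K P"
  shows "cls K P s \<oplus>\<^bsub>Q\<^esub> cls K P t = cls K P (Plus s t)"
  using lcong.plus_cong[OF rep_lcong[OF assms(1)] rep_lcong[OF assms(2)]]
  by (simp add: presented_def cls_eqI)

lemma presented_smult:
  assumes "c \<in> carrier K" "t \<in> pterms K P"
  shows "c \<odot>\<^bsub>Q\<^esub> cls K P t = cls K P (Scale c t)"
  using lcong.scale_cong[OF assms(1) rep_lcong[OF assms(2)]]
  by (simp add: presented_def cls_eqI)

text \<open>The rule \<open>op_cong\<close> replaces a single argument, so the arguments are
  replaced from left to right; the prefix \<open>as\<close> in the induction collects those already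
  replaced.\<close>

lemma op_cong_lists:
  assumes "list_all2 (\<lambda>s t. (s, t) \<in> lcong K P) ss ts" "(f, length ss) \<in> ops P"
  shows "(Op f ss, Op f ts) \<in> lcong K P"
proof -
  have "(Op f (as @ ss), Op f (as @ ts)) \<in> lcong K P"
    if "list_all2 (\<lambda>s t. (s, t) \<in> lcong K P) ss ts" "as \<in> lists (pterms K P)"
      "(f, length (as @ ss)) \<in> ops P" for as
    using that
  proof (induction arbitrary: as rule: list_all2_induct)
    case Nil
    then show ?case by (auto intro!: lcong.refl lterms.intros)
  next
    case (Cons s ss t ts)
    have *: "set ss \<subseteq> pterms K P" "s \<in> pterms K P" "t \<in> pterms K P"
      using Cons.hyps lcong_pterms by (auto simp: list_all2_conv_all_nth set_conv_nth)
    have "(Op f (as @ s # ss), Op f (as @ t # ss)) \<in> lcong K P"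
      using Cons * by (intro lcong.op_cong) auto
    also have "(Op f (as @ t # ss), Op f (as @ t # ts)) \<in> lcong K P"
      using Cons.IH[of "as @ [t]"] Cons.prems * by simp
    finally (lcong.trans) show ?case .
  qed
  from this[OF assms(1), of "[]"] assms(2) show ?thesis by simp
qed

lemma presented_op_cls:
  assumes "ts \<in> lists (pterms K P)" "(f, length ts) \<in> ops P"
  shows "presented_op K P f (map (cls K P) ts) = cls K P (Op f ts)"
proof -
  have "(Op f ts, Op f (map rep (map (cls K P) ts))) \<in> lcong K P"
    using assms by (intro op_cong_lists) (auto simp: list_all2_conv_all_nth in_lists_conv_set rep_lcong)
  then show ?thesis by (simp add: presented_op_def cls_eqI)
qed

lemma carrier_cases:
  assumes "X \<in> carrier Q"
  obtains t where "t \<in> pterms K P" "X = cls K P t"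
  using assms rep_pterms cls_rep by metis

lemma carrier_lists_cases:
  assumes "Xs \<in> lists (carrier Q)"
  obtains ts where "ts \<in> lists (pterms K P)" "Xs = map (cls K P) ts"
proof
  show "map rep Xs \<in> lists (pterms K P)" "Xs = map (cls K P) (map rep Xs)"
    using assms by (auto simp: rep_pterms cls_rep in_lists_conv_set map_idI)
qed

lemma presented_op_closed:
  assumes "Xs \<in> lists (carrier Q)" "(f, length Xs) \<in> ops P"
  shows "presented_op K P f Xs \<in> carrier Q"
proof -
  obtain ts where "ts \<in> lists (pterms K P)" "Xs = map (cls K P) ts"
    using assms(1) by (rule carrier_lists_cases)
  then show ?thesis using assms(2) by (auto simp: presented_op_cls intro!: cls_carrier lterms.intros)
qed

lemma module_presented: "module K Q"
proof -
  interpret K: cring K by (rule cring)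
  note ints = lterms.intros lcong.intros
  have "abelian_group Q"
  proof (rule abelian_groupI)
    fix X assume "X \<in> carrier Q"
    then obtain t where t: "t \<in> pterms K P" "X = cls K P t" by (rule carrier_cases)
    \<comment> \<open>Terms have no negation symbol, so the inverse of the class of \<open>t\<close>
      is the class of \<open>t\<close> scaled by minus one.\<close>
    have "(Plus (Scale (\<ominus>\<^bsub>K\<^esub> \<one>\<^bsub>K\<^esub>) t) t, Plus (Scale (\<ominus>\<^bsub>K\<^esub> \<one>\<^bsub>K\<^esub>) t) (Scale \<one>\<^bsub>K\<^esub> t)) \<in> lcong K P"
      using t by (auto intro!: lcong.plus_cong lcong.refl lcong.sym[OF lcong.scale_one] lterms.intros)
    also have "(Plus (Scale (\<ominus>\<^bsub>K\<^esub> \<one>\<^bsub>K\<^esub>) t) (Scale \<one>\<^bsub>K\<^esub> t), Scale (\<ominus>\<^bsub>K\<^esub> \<one>\<^bsub>K\<^esub> \<oplus>\<^bsub>K\<^esub> \<one>\<^bsub>K\<^esub>) t) \<in> lcong K P"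
      using t by (auto intro!: lcong.sym[OF lcong.scale_add])
    also (lcong.trans) have "(Scale (\<ominus>\<^bsub>K\<^esub> \<one>\<^bsub>K\<^esub> \<oplus>\<^bsub>K\<^esub> \<one>\<^bsub>K\<^esub>) t, Zero) \<in> lcong K P"
      using t by (simp add: K.l_neg lcong.scale_zero)
    finally (lcong.trans)
    show "\<exists>Y\<in>carrier Q. Y \<oplus>\<^bsub>Q\<^esub> X = \<zero>\<^bsub>Q\<^esub>"
      using t by (intro bexI[of _ "cls K P (Scale (\<ominus>\<^bsub>K\<^esub> \<one>\<^bsub>K\<^esub>) t)"])
        (auto simp: presented_add presented_zero lterms.intros intro!: cls_carrier cls_eqI lterms.intros)
    have "(Plus Zero t, Plus t Zero) \<in> lcong K P" "(Plus t Zero, t) \<in> lcong K P"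
      using t by (auto intro: ints)
    then show "\<zero>\<^bsub>Q\<^esub> \<oplus>\<^bsub>Q\<^esub> X = X"
      using t by (auto simp: presented_add presented_zero lterms.intros intro!: cls_eqI intro: lcong.trans)
  next
    fix X Y Z assume "X \<in> carrier Q" "Y \<in> carrier Q" "Z \<in> carrier Q"
    then obtain r s t where "r \<in> pterms K P" "X = cls K P r" "s \<in> pterms K P" "Y = cls K P s"
      "t \<in> pterms K P" "Z = cls K P t" using carrier_cases by metis
    then show "X \<oplus>\<^bsub>Q\<^esub> Y \<oplus>\<^bsub>Q\<^esub> Z = X \<oplus>\<^bsub>Q\<^esub> (Y \<oplus>\<^bsub>Q\<^esub> Z)"
      using cls_eqI[OF lcong.plus_assoc[of r K P s t]] by (simp add: presented_add lterms.intros)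
  next
    fix X Y assume "X \<in> carrier Q" "Y \<in> carrier Q"
    then obtain r s where "r \<in> pterms K P" "X = cls K P r" "s \<in> pterms K P" "Y = cls K P s"
      using carrier_cases by metis
    then show "X \<oplus>\<^bsub>Q\<^esub> Y \<in> carrier Q" "X \<oplus>\<^bsub>Q\<^esub> Y = Y \<oplus>\<^bsub>Q\<^esub> X"
      using cls_eqI[OF lcong.plus_comm[of r K P s]] by (simp_all add: presented_add lterms.intros cls_carrier)
  qed (simp add: presented_zero cls_carrier lterms.intros)
  then show ?thesis
  proof (rule moduleI[OF cring])
    fix c X Y assume "c \<in> carrier K" "X \<in> carrier Q" "Y \<in> carrier Q"
    moreover from this obtain r s where "r \<in> pterms K P" "X = cls K P r" "s \<in> pterms K P" "Y = cls K P s"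
      using carrier_cases by metis
    ultimately show "c \<odot>\<^bsub>Q\<^esub> (X \<oplus>\<^bsub>Q\<^esub> Y) = c \<odot>\<^bsub>Q\<^esub> X \<oplus>\<^bsub>Q\<^esub> c \<odot>\<^bsub>Q\<^esub> Y"
      using cls_eqI[OF lcong.scale_plus[of c K r P s]]
      by (simp add: presented_add presented_smult lterms.intros)
  next
    fix c d X assume "c \<in> carrier K" "d \<in> carrier K" "X \<in> carrier Q"
    moreover from this obtain r where "r \<in> pterms K P" "X = cls K P r"
      using carrier_cases by metis
    ultimately show "(c \<oplus>\<^bsub>K\<^esub> d) \<odot>\<^bsub>Q\<^esub> X = c \<odot>\<^bsub>Q\<^esub> X \<oplus>\<^bsub>Q\<^esub> d \<odot>\<^bsub>Q\<^esub> X"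
      "c \<otimes>\<^bsub>K\<^esub> d \<odot>\<^bsub>Q\<^esub> X = c \<odot>\<^bsub>Q\<^esub> (d \<odot>\<^bsub>Q\<^esub> X)"
      using cls_eqI[OF lcong.scale_add[of c K d r P]] cls_eqI[OF lcong.scale_mult[of c K d r P]]
      by (simp_all add: presented_add presented_smult lterms.intros)
  next
    fix c X assume "c \<in> carrier K" "X \<in> carrier Q"
    moreover from this obtain r where "r \<in> pterms K P" "X = cls K P r"
      using carrier_cases by metis
    ultimately show "c \<odot>\<^bsub>Q\<^esub> X \<in> carrier Q"
      by (simp add: presented_smult cls_carrier lterms.intros)
  next
    fix X assume "X \<in> carrier Q"
    then obtain r where "r \<in> pterms K P" "X = cls K P r"
      using carrier_cases by metis
    then show "\<one>\<^bsub>K\<^esub> \<odot>\<^bsub>Q\<^esub> X = X"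
      using cls_eqI[OF lcong.scale_one[of r K P]] by (simp add: presented_smult)
  qed
qed

lemma presented_op_linear:
  assumes "Xs \<in> lists (carrier Q)" "Ys \<in> lists (carrier Q)" "(f, Suc (length Xs + length Ys)) \<in> ops P"
  shows "linear_map K Q Q (\<lambda>X. presented_op K P f (Xs @ X # Ys))"
proof -
  obtain xs ys where xs: "xs \<in> lists (pterms K P)" "Xs = map (cls K P) xs"
    and ys: "ys \<in> lists (pterms K P)" "Ys = map (cls K P) ys"
    using assms carrier_lists_cases by metis
  have *: "presented_op K P f (Xs @ cls K P t # Ys) = cls K P (Op f (xs @ t # ys))"
    "Op f (xs @ t # ys) \<in> pterms K P"
    if "t \<in> pterms K P" for t
    using presented_op_cls[of "xs @ t # ys" f] that assms(3) xs ys by (auto intro!: lterms.intros)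
  have l: "(f, Suc (length xs + length ys)) \<in> ops P" using assms(3) xs(2) ys(2) by simp
  show ?thesis
  proof (rule linear_mapI)
    fix X Y assume "X \<in> carrier Q" "Y \<in> carrier Q"
    then obtain r s where "r \<in> pterms K P" "X = cls K P r" "s \<in> pterms K P" "Y = cls K P s"
      using carrier_cases by metis
    then show "presented_op K P f (Xs @ (X \<oplus>\<^bsub>Q\<^esub> Y) # Ys) =
      presented_op K P f (Xs @ X # Ys) \<oplus>\<^bsub>Q\<^esub> presented_op K P f (Xs @ Y # Ys)"
      using xs(1) ys(1) l cls_eqI[OF lcong.op_plus[of xs K P r s ys f]]
      by (simp add: presented_add lterms.intros *)
  next
    fix c X assume "c \<in> carrier K" "X \<in> carrier Q"
    then obtain r where "r \<in> pterms K P" "X = cls K P r" by (metis carrier_cases)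
    then show "presented_op K P f (Xs @ (c \<odot>\<^bsub>Q\<^esub> X) # Ys) = c \<odot>\<^bsub>Q\<^esub> presented_op K P f (Xs @ X # Ys)"
      using xs(1) ys(1) l \<open>c \<in> carrier K\<close>
      cls_eqI[OF lcong.op_scale[of xs K P c r ys f]]
      by (simp add: presented_smult lterms.intros *)
  next
    fix X assume "X \<in> carrier Q"
    then show "presented_op K P f (Xs @ X # Ys) \<in> carrier Q"
      using assms by (auto intro!: presented_op_closed)
  qed
qed

text \<open>Soundness, by induction on the congruence: the module axioms hold in \<open>W\<close>,
  the relations hold by \<open>pmodel\<close>, and the multilinearity rules are instances of
  linearity in one open slot of an operation.\<close>

lemma geval_lcong:
  assumes "pmodel K P W f I" "(s, t) \<in> lcong K P"
  shows "geval W f I s = geval W f I t"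
proof -
  interpret W: module K W using assms(1) by (rule pmodel_module)
  note c = pmodel_geval_closed[OF assms(1)]
  have l: "map (geval W f I) ts \<in> lists (carrier W)" if "ts \<in> lists (pterms K P)" for ts
    using that c by auto
  have lin: "linear_map K W W (\<lambda>x. I q (map (geval W f I) ss @ x # map (geval W f I) us))"
    if "(q, length (ss @ t # us)) \<in> ops P" "ss \<in> lists (pterms K P)" "us \<in> lists (pterms K P)"
    for q ss us and t :: "('k, 'g, 'o) lterm"
    using assms(1) that l[of ss] l[of us] unfolding pmodel_def
    by (metis add_Suc_right length_Cons length_append length_map)
  show ?thesis using assms(2)
  proof induction
    case (rel s t)
    then show ?case using assms(1) by (auto simp: pmodel_def)
  next
    case (op_plus ss t t' us q)
    then show ?case using linear_map_add[OF lin c c] by simp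
  next
    case (op_scale ss c t us q)
    then show ?case using linear_map_smult[OF lin _ pmodel_geval_closed[OF assms(1)]] by simp
  next
    case (plus_comm s t)
    then show ?case using c by (simp add: W.M.a_comm)
  qed (auto simp: c W.M.a_assoc W.smult_l_distr W.smult_r_distr W.smult_assoc1)
qed

text \<open>The induced map on classes, independent of the representative by
  \<open>geval_lcong\<close>. Together with \<open>presented_induct\<close>, which yields
  uniqueness, it is the universal property of a presentation.\<close>

definition plift where "plift W f I X = geval W f I (rep X)"

lemma plift_cls:
  "pmodel K P W f I \<Longrightarrow> t \<in> pterms K P \<Longrightarrow> plift W f I (cls K P t) = geval W f I t"
  unfolding plift_def using geval_lcong rep_lcong by metis

lemma plift_linear:
  assumes "pmodel K P W f I"
  shows "linear_map K Q W (plift W f I)"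
proof (rule linear_mapI)
  fix X Y assume "X \<in> carrier Q" "Y \<in> carrier Q"
  then obtain r s where "r \<in> pterms K P" "X = cls K P r" "s \<in> pterms K P" "Y = cls K P s"
    using carrier_cases by metis
  then show "plift W f I (X \<oplus>\<^bsub>Q\<^esub> Y) = plift W f I X \<oplus>\<^bsub>W\<^esub> plift W f I Y"
    by (simp add: presented_add plift_cls[OF assms] lterms.intros)
next
  fix c X assume "c \<in> carrier K" "X \<in> carrier Q"
  then obtain r where "r \<in> pterms K P" "X = cls K P r" by (metis carrier_cases)
  with \<open>c \<in> carrier K\<close> show "plift W f I (c \<odot>\<^bsub>Q\<^esub> X) = c \<odot>\<^bsub>W\<^esub> plift W f I X"
    by (simp add: presented_smult plift_cls[OF assms] lterms.intros)
next
  fix X assume "X \<in> carrier Q"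
  then obtain r where "r \<in> pterms K P" "X = cls K P r" by (metis carrier_cases)
  then show "plift W f I X \<in> carrier W"
    by (simp add: plift_cls[OF assms] pmodel_geval_closed[OF assms])
qed

lemma plift_op:
  assumes "pmodel K P W f I" "Xs \<in> lists (carrier Q)" "(q, length Xs) \<in> ops P"
  shows "plift W f I (presented_op K P q Xs) = I q (map (plift W f I) Xs)"
proof -
  obtain ts where ts: "ts \<in> lists (pterms K P)" "Xs = map (cls K P) ts"
    using assms(2) by (rule carrier_lists_cases)
  have "Op q ts \<in> pterms K P" using ts assms(3) by (auto intro!: lterms.intros)
  then show ?thesis
    using ts assms(3) by (auto simp: presented_op_cls plift_cls[OF assms(1)] o_def
      intro!: arg_cong[where f = "I q"] map_cong)
qed

lemma presented_induct [consumes 1, case_names Gen Zero Plus Scale Op]: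
  assumes "X \<in> carrier Q"
    and "\<And>g. g \<in> gens P \<Longrightarrow> R (cls K P (Gen g))"
    and "R \<zero>\<^bsub>Q\<^esub>"
    and "\<And>X Y. X \<in> carrier Q \<Longrightarrow> Y \<in> carrier Q \<Longrightarrow> R X \<Longrightarrow> R Y \<Longrightarrow> R (X \<oplus>\<^bsub>Q\<^esub> Y)"
    and "\<And>c X. c \<in> carrier K \<Longrightarrow> X \<in> carrier Q \<Longrightarrow> R X \<Longrightarrow> R (c \<odot>\<^bsub>Q\<^esub> X)"
    and "\<And>q Xs. Xs \<in> lists (carrier Q) \<Longrightarrow> (q, length Xs) \<in> ops P \<Longrightarrow> (\<And>X. X \<in> set Xs \<Longrightarrow> R X) \<Longrightarrow>
      R (presented_op K P q Xs)"
  shows "R X"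
proof -
  obtain t where t: "t \<in> pterms K P" "X = cls K P t" using assms(1) by (rule carrier_cases)
  have "R (cls K P t)" using t(1)
  proof induction
    case (5 ts q)
    then have ts: "ts \<in> lists (pterms K P)" "\<And>t. t \<in> set ts \<Longrightarrow> R (cls K P t)" by auto
    have "R (presented_op K P q (map (cls K P) ts))"
      using 5 ts by (intro assms(6)) (auto intro!: cls_carrier)
    then show ?case using 5 ts by (simp add: presented_op_cls)
  qed (use assms in \<open>auto simp: presented_zero presented_add[symmetric] presented_smult[symmetric] cls_carrier\<close>)
  then show ?thesis using t by simp
qed

end

lemma leval_geval: "leval W f t = geval W f (\<lambda>_ _. undefined) t"
  by (induction t) auto

locale lin_pres = pres K P for K :: "('k, 'x) ring_scheme" and P :: "('k, 'g, unit) presentation" +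
  assumes no_ops: "ops P = {}"
begin

lemma lin_lift_plift: "lin_lift W f = plift W f (\<lambda>_ _. undefined)"
  by (auto simp: lin_lift_def plift_def leval_geval)

lemma lin_model:
  assumes "module K W" "f \<in> gens P \<rightarrow> carrier W" "\<And>s t. (s, t) \<in> rels P \<Longrightarrow> leval W f s = leval W f t"
  shows "pmodel K P W f (\<lambda>_ _. undefined)"
  using assms no_ops by (auto simp: pmodel_def leval_geval)

lemma lin_lift_linear:
  assumes "module K W" "f \<in> gens P \<rightarrow> carrier W" "\<And>s t. (s, t) \<in> rels P \<Longrightarrow> leval W f s = leval W f t"
  shows "linear_map K Q W (lin_lift W f)"
  unfolding lin_lift_plift by (rule plift_linear[OF lin_model[OF assms]])

lemma lin_lift_gen:
  assumes "module K W" "f \<in> gens P \<rightarrow> carrier W" "\<And>s t. (s, t) \<in> rels P \<Longrightarrow> leval W f s = leval W f t"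
    and "g \<in> gens P"
  shows "lin_lift W f (cls K P (Gen g)) = f g"
  unfolding lin_lift_plift using assms(4) by (simp add: plift_cls[OF lin_model[OF assms(1-3)]] lterms.intros)

lemma linear_map_ext:
  assumes "linear_map K Q W f" "linear_map K Q W g" "module K W" "X \<in> carrier Q"
    and "\<And>x. x \<in> gens P \<Longrightarrow> f (cls K P (Gen x)) = g (cls K P (Gen x))"
  shows "f X = g X"
  using assms(4)
proof (induction rule: presented_induct)
  case Zero
  show ?case using linear_map_zero[OF assms(1) module_presented assms(3)]
      linear_map_zero[OF assms(2) module_presented assms(3)] by simp
qed (use assms no_ops in \<open>auto simp: linear_map_add[OF assms(1)] linear_map_add[OF assms(2)]
   linear_map_smult[OF assms(1)] linear_map_smult[OF assms(2)]\<close>)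

text \<open>Linearity in a parameter passes from the generators to the lift, by induction on the
  fixed representative of \<open>X\<close>. Iterated lifts, such as a product lifted first in one
  argument and then in the other, obtain their second linearity from here.\<close>

lemma lin_lift_param:
  assumes "\<And>g. g \<in> gens P \<Longrightarrow> linear_map K B W (\<lambda>y. F y g)" "module K W" "X \<in> carrier Q"
  shows "linear_map K B W (\<lambda>y. lin_lift W (F y) X)"
proof -
  have "linear_map K B W (\<lambda>y. leval W (F y) t)" if "t \<in> pterms K P" for t
    using that
  proof induction
    case (5 ts q)
    then show ?case using no_ops by auto
  qed (use assms in \<open>auto intro: linear_map_const_zero linear_map_add_fun linear_map_smult_fun\<close>)
  then show ?thesis using rep_pterms[OF assms(3)] by (simp add: lin_lift_def)
qed

end

section \<open>Tensor products and words\<close>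

text \<open>A lift uses its target only through addition, zero and scalars; hence lifts into
  \<open>Tfc\<close> are lifts into \<open>words\<close>, and lifts into \<open>dot_alg A\<close>
  are lifts into \<open>A\<close>.\<close>

lemma lin_lift_struct_cong:
  assumes "add W' = add W" "zero W' = zero W" "smult W' = smult W"
  shows "lin_lift W' f = lin_lift W f"
proof -
  have "leval W' f t = leval W f t" for t
    using assms by (induction t) auto
  then show ?thesis by (simp add: lin_lift_def fun_eq_iff)
qed

lemma (in lin_pres) lin_lift_cong:
  assumes "X \<in> carrier Q" "\<And>g. g \<in> gens P \<Longrightarrow> f g = f' g"
  shows "lin_lift W f X = lin_lift W f' X"
proof -
  have "leval W f t = leval W f' t" if "t \<in> pterms K P" for t
    using that by induction (use assms(2) no_ops in auto)
  then show ?thesis using rep_pterms[OF assms(1)] by (simp add: lin_lift_def)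
qed

lemma
  assumes "multilinear K R W h" "us \<in> lists (carrier R)" "vs \<in> lists (carrier R)" "x \<in> carrier R"
  shows multilinear_add: "y \<in> carrier R \<Longrightarrow>
      h (us @ (x \<oplus>\<^bsub>R\<^esub> y) # vs) = h (us @ x # vs) \<oplus>\<^bsub>W\<^esub> h (us @ y # vs)"
    and multilinear_smult: "c \<in> carrier K \<Longrightarrow> h (us @ (c \<odot>\<^bsub>R\<^esub> x) # vs) = c \<odot>\<^bsub>W\<^esub> h (us @ x # vs)"
  using linear_map_add[OF multilinear_linear[OF assms(1-3)] assms(4)]
    linear_map_smult[OF multilinear_linear[OF assms(1-3)] _ assms(4)] by simp_all

lemma module_cring: "module K A \<Longrightarrow> cring K"
  by (simp add: module_def)

lemma lin_pres_tensor:
  assumes "module K A" "module K B"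
  shows "lin_pres K (tensor_pres K A B)"
proof -
  interpret A: module K A by fact
  interpret B: module K B by fact
  show ?thesis
    by unfold_locales (auto simp: tensor_pres_def intro!: lterms.intros)
qed

lemma module_tensor: "module K A \<Longrightarrow> module K B \<Longrightarrow> module K (tensor K A B)"
  unfolding tensor_def by (rule pres.module_presented[OF lin_pres.axioms(1)[OF lin_pres_tensor]])

lemma ptens_bilinear:
  assumes "module K A" "module K B"
  shows "bilinear K A B (tensor K A B) (ptens K A B)"
proof -
  interpret A: module K A by fact
  interpret B: module K B by fact
  interpret P: lin_pres K "tensor_pres K A B" using assms by (rule lin_pres_tensor)
  have g: "Gen (a, b) \<in> pterms K (tensor_pres K A B)" if "a \<in> carrier A" "b \<in> carrier B" for a b
    using that by (auto simp: tensor_pres_def intro!: lterms.intros)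
  show ?thesis
  proof (rule bilinearI)
    fix a assume a: "a \<in> carrier A"
    show "linear_map K B (tensor K A B) (ptens K A B a)"
      unfolding tensor_def ptens_def
      by (rule linear_mapI)
         (use a in \<open>auto simp: P.presented_add P.presented_smult g P.cls_carrier intro!: P.cls_eqI lcong.rel,
           auto simp: tensor_pres_def\<close>)
  next
    fix b assume b: "b \<in> carrier B"
    show "linear_map K A (tensor K A B) (\<lambda>a. ptens K A B a b)"
      unfolding tensor_def ptens_def
      by (rule linear_mapI)
         (use b in \<open>auto simp: P.presented_add P.presented_smult g P.cls_carrier intro!: P.cls_eqI lcong.rel,
           auto simp: tensor_pres_def\<close>)
  qed
qed

lemma ptens_closed:
  "module K A \<Longrightarrow> module K B \<Longrightarrow> a \<in> carrier A \<Longrightarrow> b \<in> carrier B \<Longrightarrow>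
   ptens K A B a b \<in> carrier (tensor K A B)"
  using bilinear_closed[OF ptens_bilinear] .

lemma
  assumes f: "bilinear K A B W f" and m: "module K A" "module K B" "module K W"
  shows tensor_lift_linear: "linear_map K (tensor K A B) W (lin_lift W (\<lambda>(a, b). f a b))"
    and tensor_lift_ptens: "a \<in> carrier A \<Longrightarrow> b \<in> carrier B \<Longrightarrow>
      lin_lift W (\<lambda>(a, b). f a b) (ptens K A B a b) = f a b"
proof -
  interpret P: lin_pres K "tensor_pres K A B" using m(1,2) by (rule lin_pres_tensor)
  have *: "(\<lambda>(a, b). f a b) \<in> gens (tensor_pres K A B) \<rightarrow> carrier W"
    using bilinear_closed[OF f] by (auto simp: tensor_pres_def)
  have **: "leval W (\<lambda>(a, b). f a b) s = leval W (\<lambda>(a, b). f a b) t"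
    if "(s, t) \<in> rels (tensor_pres K A B)" for s t
    using that
    by (auto simp: tensor_pres_def linear_map_add[OF bilinear_left[OF f]]
      linear_map_add[OF bilinear_right[OF f]] linear_map_smult[OF bilinear_left[OF f]]
      linear_map_smult[OF bilinear_right[OF f]])
  show "linear_map K (tensor K A B) W (lin_lift W (\<lambda>(a, b). f a b))"
    unfolding tensor_def by (rule P.lin_lift_linear[OF m(3) * **])
  show "lin_lift W (\<lambda>(a, b). f a b) (ptens K A B a b) = f a b"
    if "a \<in> carrier A" "b \<in> carrier B"
    unfolding ptens_def using P.lin_lift_gen[OF m(3) * **, of "(a, b)"] that
    by (simp add: tensor_pres_def)
qed

lemma tensor_ext:
  assumes "linear_map K (tensor K A B) W f" "linear_map K (tensor K A B) W g"
    and m: "module K A" "module K B" "module K W" and "X \<in> carrier (tensor K A B)"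
    and "\<And>a b. a \<in> carrier A \<Longrightarrow> b \<in> carrier B \<Longrightarrow> f (ptens K A B a b) = g (ptens K A B a b)"
  shows "f X = g X"
proof -
  interpret P: lin_pres K "tensor_pres K A B" using m(1,2) by (rule lin_pres_tensor)
  show ?thesis
  proof (rule P.linear_map_ext[OF assms(1,2)[unfolded tensor_def] m(3) assms(6)[unfolded tensor_def]])
    fix x assume "x \<in> gens (tensor_pres K A B)"
    then show "f (cls K (tensor_pres K A B) (Gen x)) = g (cls K (tensor_pres K A B) (Gen x))"
      using assms(7)[of "fst x" "snd x"] by (auto simp: tensor_pres_def ptens_def)
  qed
qed

lemma tensor_lift_param:
  assumes "\<And>a b. a \<in> carrier A \<Longrightarrow> b \<in> carrier B \<Longrightarrow> linear_map K C W (\<lambda>y. F y a b)"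
    and m: "module K A" "module K B" "module K W" and "X \<in> carrier (tensor K A B)"
  shows "linear_map K C W (\<lambda>y. lin_lift W (\<lambda>(a, b). F y a b) X)"
proof -
  interpret P: lin_pres K "tensor_pres K A B" using m(1,2) by (rule lin_pres_tensor)
  show ?thesis
    using assms by (intro P.lin_lift_param) (auto simp: tensor_def tensor_pres_def)
qed

lemma
  assumes m: "module K A" "module K B" "module K C" "module K D"
    and f: "linear_map K A C f" and g: "linear_map K B D g"
  shows map_tensor_linear: "linear_map K (tensor K A B) (tensor K C D) (map_tensor K C D f g)"
    and map_tensor_ptens: "a \<in> carrier A \<Longrightarrow> b \<in> carrier B \<Longrightarrow>
      map_tensor K C D f g (ptens K A B a b) = ptens K C D (f a) (g b)"
  unfolding map_tensor_def
  by (rule tensor_lift_linear tensor_lift_ptens,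
    rule bilinear_comp_args[OF ptens_bilinear[OF m(3,4)] f g],
    (rule m module_tensor | assumption)+)+

lemma map_tensor_closed:
  assumes "module K A" "module K B" "module K C" "module K D"
    "linear_map K A C f" "linear_map K B D g" "X \<in> carrier (tensor K A B)"
  shows "map_tensor K C D f g X \<in> carrier (tensor K C D)"
  using linear_map_closed[OF map_tensor_linear[OF assms(1-6)] assms(7)] .

lemma map_tensor_comp:
  assumes m: "module K A" "module K B" "module K C" "module K D" "module K E" "module K F"
    and l: "linear_map K A C f" "linear_map K B D g" "linear_map K C E f'" "linear_map K D F g'"
    and X: "X \<in> carrier (tensor K A B)"
  shows "map_tensor K E F f' g' (map_tensor K C D f g X) =
    map_tensor K E F (\<lambda>x. f' (f x)) (\<lambda>x. g' (g x)) X"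
proof (rule tensor_ext[OF _ _ m(1,2) module_tensor[OF m(5,6)] X])
  show "linear_map K (tensor K A B) (tensor K E F) (\<lambda>X. map_tensor K E F f' g' (map_tensor K C D f g X))"
    using linear_map_comp[OF map_tensor_linear[OF m(1-4) l(1,2)] map_tensor_linear[OF m(3-6) l(3,4)]] .
  have c: "linear_map K A E (\<lambda>x. f' (f x))" "linear_map K B F (\<lambda>x. g' (g x))"
    using l by (blast intro: linear_map_comp)+
  show "linear_map K (tensor K A B) (tensor K E F) (map_tensor K E F (\<lambda>x. f' (f x)) (\<lambda>x. g' (g x)))"
    by (rule map_tensor_linear[OF m(1,2,5,6) c])
  fix a b assume "a \<in> carrier A" "b \<in> carrier B"
  then show "map_tensor K E F f' g' (map_tensor K C D f g (ptens K A B a b)) =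
    map_tensor K E F (\<lambda>x. f' (f x)) (\<lambda>x. g' (g x)) (ptens K A B a b)"
    using linear_map_closed[OF l(1)] linear_map_closed[OF l(2)]
    by (simp add: map_tensor_ptens[OF m(1-4) l(1,2)] map_tensor_ptens[OF m(3-6) l(3,4)]
      map_tensor_ptens[OF m(1,2,5,6) c])
qed

lemma map_tensor_cong:
  assumes m: "module K A" "module K B" and X: "X \<in> carrier (tensor K A B)"
    and "\<And>a. a \<in> carrier A \<Longrightarrow> f a = f' a" "\<And>b. b \<in> carrier B \<Longrightarrow> g b = g' b"
  shows "map_tensor K C D f g X = map_tensor K C D f' g' X"
proof -
  interpret P: lin_pres K "tensor_pres K A B" using m by (rule lin_pres_tensor)
  show ?thesis unfolding map_tensor_def
    using assms by (intro P.lin_lift_cong) (auto simp: tensor_def tensor_pres_def)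
qed

lemma map_tensor_id:
  assumes m: "module K A" "module K B" and X: "X \<in> carrier (tensor K A B)"
    and "\<And>a. a \<in> carrier A \<Longrightarrow> f a = a" "\<And>b. b \<in> carrier B \<Longrightarrow> g b = b"
  shows "map_tensor K A B f g X = X"
proof -
  have "map_tensor K A B f g X = map_tensor K A B (\<lambda>x. x) (\<lambda>x. x) X"
    by (rule map_tensor_cong[OF m X assms(4,5)])
  also have "\<dots> = X"
    by (rule tensor_ext[OF map_tensor_linear[OF m m linear_map_id linear_map_id] linear_map_id m
          module_tensor[OF m] X])
       (rule map_tensor_ptens[OF m m linear_map_id linear_map_id])
  finally show ?thesis .
qed

lemma
  assumes m: "module K A"
  shows tensor_assoc_linear:
      "linear_map K (tensor K (tensor K A A) A) (tensor K A (tensor K A A)) (tensor_assoc K A)"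
    and tensor_assoc_ptens: "a \<in> carrier A \<Longrightarrow> b \<in> carrier A \<Longrightarrow> c \<in> carrier A \<Longrightarrow>
      tensor_assoc K A (ptens K (tensor K A A) A (ptens K A A a b) c) =
      ptens K A (tensor K A A) a (ptens K A A b c)"
proof -
  let ?W = "tensor K A (tensor K A A)"
  have mt: "module K (tensor K A A)" "module K ?W" using m by (simp_all add: module_tensor)
  note p = ptens_bilinear[OF m m] ptens_bilinear[OF m mt(1)]
  have b: "bilinear K A A ?W (\<lambda>a b. ptens K A (tensor K A A) a (ptens K A A b c))"
    if "c \<in> carrier A" for c
    using bilinear_comp_args[OF p(2) linear_map_id bilinear_left[OF p(1) that]] .
  let ?F = "\<lambda>t c. lin_lift ?W (\<lambda>(a, b). ptens K A (tensor K A A) a (ptens K A A b c)) t"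
  \<comment> \<open>The outer lift requires the inner one to be bilinear: in the tensor this is the
    universal property, in the remaining factor it is \<open>tensor_lift_param\<close>.\<close>
  have bF: "bilinear K (tensor K A A) A ?W ?F"
  proof (rule bilinearI)
    show "linear_map K (tensor K A A) ?W (\<lambda>t. ?F t c)" if "c \<in> carrier A" for c
      by (rule tensor_lift_linear[OF b[OF that] m m mt(2)])
    show "linear_map K A ?W (?F t)" if "t \<in> carrier (tensor K A A)" for t
      using that by (intro tensor_lift_param[OF _ m m mt(2)]
        linear_map_comp[OF bilinear_right[OF p(1)] bilinear_right[OF p(2)]])
  qed
  show "linear_map K (tensor K (tensor K A A) A) ?W (tensor_assoc K A)"
    unfolding tensor_assoc_def by (rule tensor_lift_linear[OF bF mt(1) m mt(2)])
  show "tensor_assoc K A (ptens K (tensor K A A) A (ptens K A A a b) c) =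
      ptens K A (tensor K A A) a (ptens K A A b c)"
    if "a \<in> carrier A" "b \<in> carrier A" "c \<in> carrier A"
    unfolding tensor_assoc_def using that
    by (simp add: tensor_lift_ptens[OF bF mt(1) m mt(2)] tensor_lift_ptens[OF b m m mt(2)] ptens_closed m)
qed

text \<open>Stated for the multiplication of the record, so that \<open>dot_alg\<close> makes it
  available for the second product and both compatibilities with the coproduct are treated
  alike.\<close>

lemma
  assumes m: "module K A" and mu: "bilinear K A A A (mult A)"
  shows tensor_mult_bilinear:
      "bilinear K (tensor K A A) (tensor K A A) (tensor K A A) (tensor_mult K A)"
    and tensor_mult_ptens: "a \<in> carrier A \<Longrightarrow> b \<in> carrier A \<Longrightarrow> a' \<in> carrier A \<Longrightarrow> b' \<in> carrier A \<Longrightarrow>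
      tensor_mult K A (ptens K A A a b) (ptens K A A a' b') = ptens K A A (a \<otimes>\<^bsub>A\<^esub> a') (b \<otimes>\<^bsub>A\<^esub> b')"
proof -
  let ?W = "tensor K A A"
  have mt: "module K ?W" using m by (simp add: module_tensor)
  note p = ptens_bilinear[OF m m]
  have b: "bilinear K A A ?W (\<lambda>a' b'. ptens K A A (a \<otimes>\<^bsub>A\<^esub> a') (b \<otimes>\<^bsub>A\<^esub> b'))"
    if "a \<in> carrier A" "b \<in> carrier A" for a b
    using bilinear_comp_args[OF p bilinear_right[OF mu that(1)] bilinear_right[OF mu that(2)]] .
  have b': "bilinear K A A ?W (\<lambda>a b. ptens K A A (a \<otimes>\<^bsub>A\<^esub> a') (b \<otimes>\<^bsub>A\<^esub> b'))"
    if "a' \<in> carrier A" "b' \<in> carrier A" for a' b'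
    using bilinear_comp_args[OF p bilinear_left[OF mu that(1)] bilinear_left[OF mu that(2)]] .
  let ?F = "\<lambda>t a b. lin_lift ?W (\<lambda>(a', b'). ptens K A A (a \<otimes>\<^bsub>A\<^esub> a') (b \<otimes>\<^bsub>A\<^esub> b')) t"
  have bF: "bilinear K A A ?W (?F t)" if "t \<in> carrier ?W" for t
  proof (rule bilinearI)
    show "linear_map K A ?W (\<lambda>b. ?F t a b)" if "a \<in> carrier A" for a
      using \<open>t \<in> _\<close> that by (intro tensor_lift_param[OF _ m m mt] bilinear_right[OF b'])
    show "linear_map K A ?W (\<lambda>a. ?F t a b)" if "b \<in> carrier A" for b
      using \<open>t \<in> _\<close> that by (intro tensor_lift_param[OF _ m m mt] bilinear_left[OF b'])
  qed
  show "bilinear K ?W ?W ?W (tensor_mult K A)"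
  proof (rule bilinearI)
    show "linear_map K ?W ?W (tensor_mult K A s)" if "s \<in> carrier ?W" for s
      unfolding tensor_mult_def
      using that tensor_lift_linear[OF b m m mt] by (intro tensor_lift_param[OF _ m m mt]) auto
    show "linear_map K ?W ?W (\<lambda>s. tensor_mult K A s t)" if "t \<in> carrier ?W" for t
      unfolding tensor_mult_def by (rule tensor_lift_linear[OF bF[OF that] m m mt])
  qed
  show "tensor_mult K A (ptens K A A a b) (ptens K A A a' b') = ptens K A A (a \<otimes>\<^bsub>A\<^esub> a') (b \<otimes>\<^bsub>A\<^esub> b')"
    if "a \<in> carrier A" "b \<in> carrier A" "a' \<in> carrier A" "b' \<in> carrier A"
    unfolding tensor_mult_def using that
    by (simp add: tensor_lift_ptens[OF bF m m mt] tensor_lift_ptens[OF b m m mt] ptens_closed m)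
qed

section \<open>The module of words and its universal property\<close>

lemma lin_pres_words:
  assumes "module K R"
  shows "lin_pres K (words_pres K R)"
proof -
  interpret R: module K R by fact
  show ?thesis
    by unfold_locales (auto simp: words_pres_def intro!: lterms.intros)
qed

lemma module_words: "module K R \<Longrightarrow> module K (words K R)"
  unfolding words_def by (rule pres.module_presented[OF lin_pres.axioms(1)[OF lin_pres_words]])

lemma word_multilinear:
  assumes "module K R"
  shows "multilinear K R (words K R) (word K R)"
proof -
  interpret R: module K R by fact
  interpret P: lin_pres K "words_pres K R" using assms by (rule lin_pres_words)
  have g: "Gen us \<in> pterms K (words_pres K R)" if "us \<in> lists (carrier R)" for us
    using that by (auto simp: words_pres_def intro!: lterms.intros)
  show ?thesis
  proof (rule multilinearI)
    fix us vs assume "us \<in> lists (carrier R)" "vs \<in> lists (carrier R)"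
    then show "linear_map K R (words K R) (\<lambda>x. word K R (us @ x # vs))"
      unfolding words_def word_def
      by (intro linear_mapI)
         (auto simp: P.presented_add P.presented_smult g P.cls_carrier intro!: P.cls_eqI lcong.rel,
           fastforce simp: words_pres_def, fastforce simp: words_pres_def)
  qed (auto simp: words_def word_def g P.cls_carrier)
qed

lemma word_closed: "module K R \<Longrightarrow> us \<in> lists (carrier R) \<Longrightarrow> word K R us \<in> carrier (words K R)"
  using multilinear_closed[OF word_multilinear] .

lemma
  assumes h: "multilinear K R W h" and m: "module K R" "module K W"
  shows words_lift_linear: "linear_map K (words K R) W (lin_lift W h)"
    and words_lift_word: "us \<in> lists (carrier R) \<Longrightarrow> lin_lift W h (word K R us) = h us"
proof -
  interpret P: lin_pres K "words_pres K R" using m(1) by (rule lin_pres_words)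
  have *: "h \<in> gens (words_pres K R) \<rightarrow> carrier W"
    using multilinear_closed[OF h] by (auto simp: words_pres_def)
  have **: "leval W h s = leval W h t" if "(s, t) \<in> rels (words_pres K R)" for s t
    using that
    by (auto simp: words_pres_def multilinear_add[OF h] multilinear_smult[OF h] in_lists_conv_set)
  show "linear_map K (words K R) W (lin_lift W h)"
    unfolding words_def by (rule P.lin_lift_linear[OF m(2) * **])
  show "lin_lift W h (word K R us) = h us" if "us \<in> lists (carrier R)"
    unfolding word_def using P.lin_lift_gen[OF m(2) * **, of us] that
    by (simp add: words_pres_def)
qed

lemma words_ext:
  assumes "linear_map K (words K R) W f" "linear_map K (words K R) W g"
    and m: "module K R" "module K W" and "X \<in> carrier (words K R)"
    and "\<And>us. us \<in> lists (carrier R) \<Longrightarrow> f (word K R us) = g (word K R us)"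
  shows "f X = g X"
proof -
  interpret P: lin_pres K "words_pres K R" using m(1) by (rule lin_pres_words)
  show ?thesis
  proof (rule P.linear_map_ext[OF assms(1,2)[unfolded words_def] m(2) assms(5)[unfolded words_def]])
    fix x assume "x \<in> gens (words_pres K R)"
    then show "f (cls K (words_pres K R) (Gen x)) = g (cls K (words_pres K R) (Gen x))"
      using assms(6)[of x] by (simp add: words_pres_def word_def)
  qed
qed

lemma words_lift_param:
  assumes "\<And>us. us \<in> lists (carrier R) \<Longrightarrow> linear_map K C W (\<lambda>y. F y us)"
    and m: "module K R" "module K W" and "X \<in> carrier (words K R)"
  shows "linear_map K C W (\<lambda>y. lin_lift W (F y) X)"
proof -
  interpret P: lin_pres K "words_pres K R" using m(1) by (rule lin_pres_words)
  show ?thesis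
    using assms by (intro P.lin_lift_param) (auto simp: words_def words_pres_def)
qed

text \<open>The pattern by which concatenation and the product \<open>*\<close> of words are
  defined: a lift in the second argument followed by one in the first. That the inner lift is
  multilinear in the letters of the first word comes from \<open>words_lift_param\<close>.\<close>

lemma
  assumes F1: "\<And>vs. vs \<in> lists (carrier R) \<Longrightarrow> multilinear K R W (\<lambda>us. F us vs)"
    and F2: "\<And>us. us \<in> lists (carrier R) \<Longrightarrow> multilinear K R W (F us)"
    and m: "module K R" "module K W"
  shows words_bilift_bilinear: "bilinear K (words K R) (words K R) W
      (\<lambda>X Y. lin_lift W (\<lambda>us. lin_lift W (\<lambda>vs. F us vs) Y) X)"
    and words_bilift_word: "us \<in> lists (carrier R) \<Longrightarrow> vs \<in> lists (carrier R) \<Longrightarrow>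
      lin_lift W (\<lambda>us. lin_lift W (\<lambda>vs. F us vs) (word K R vs)) (word K R us) = F us vs"
proof -
  let ?T = "words K R"
  have ml: "multilinear K R W (\<lambda>us. lin_lift W (F us) Y)" if "Y \<in> carrier ?T" for Y
  proof (rule multilinearI)
    fix us vs assume "us \<in> lists (carrier R)" "vs \<in> lists (carrier R)"
    then show "linear_map K R W (\<lambda>x. lin_lift W (F (us @ x # vs)) Y)"
      using multilinear_linear[OF F1] by (intro words_lift_param[OF _ m that])
  next
    fix us assume "us \<in> lists (carrier R)"
    then show "lin_lift W (F us) Y \<in> carrier W"
      using linear_map_closed[OF words_lift_linear[OF F2 m] that] by simp
  qed
  show "bilinear K ?T ?T W (\<lambda>X Y. lin_lift W (\<lambda>us. lin_lift W (\<lambda>vs. F us vs) Y) X)"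
  proof (rule bilinearI)
    show "linear_map K ?T W (\<lambda>Y. lin_lift W (\<lambda>us. lin_lift W (\<lambda>vs. F us vs) Y) X)"
      if "X \<in> carrier ?T" for X
      by (rule words_lift_param[OF _ m that]) (rule words_lift_linear[OF F2 m])
    show "linear_map K ?T W (\<lambda>X. lin_lift W (\<lambda>us. lin_lift W (\<lambda>vs. F us vs) Y) X)"
      if "Y \<in> carrier ?T" for Y
      by (rule words_lift_linear[OF ml[OF that] m])
  qed
  show "lin_lift W (\<lambda>us. lin_lift W (\<lambda>vs. F us vs) (word K R vs)) (word K R us) = F us vs"
    if "us \<in> lists (carrier R)" "vs \<in> lists (carrier R)"
    using that by (simp add: words_lift_word[OF ml m] words_lift_word[OF F2 m] word_closed m)
qed

section \<open>Sums over deconcatenations and over block decompositions\<close>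

text \<open>Sums over the cuts of a word. The coproduct of a word and the removal of a first block
  from two words both have this shape, so identities between them reduce to rearranging iterated
  sums over cuts.\<close>

definition split_sum :: "('a, 'y) ring_scheme \<Rightarrow> 'b list \<Rightarrow> ('b list \<Rightarrow> 'b list \<Rightarrow> 'a) \<Rightarrow> 'a"
  where "split_sum W us f = lsum W (map (\<lambda>i. f (take i us) (drop i us)) [0..<Suc (length us)])"

lemma split_sum_Cons: "split_sum W (x # us) f = f [] (x # us) \<oplus>\<^bsub>W\<^esub> split_sum W us (\<lambda>a b. f (x # a) b)"
proof -
  have "[0..<Suc (length (x # us))] = 0 # map Suc [0..<Suc (length us)]"
    by (metis length_Cons map_Suc_upt upt_conv_Cons zero_less_Suc)
  then show ?thesis by (simp only: split_sum_def list.map lsum_simps map_map o_def) simp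
qed

lemma split_sum_cong:
  assumes "\<And>a b. a @ b = us \<Longrightarrow> f a b = g a b"
  shows "split_sum W us f = split_sum W us g"
  unfolding split_sum_def by (intro arg_cong[where f = "lsum W"] map_cong refl assms) simp_all

context abelian_monoid
begin

lemma split_sum_Nil: "f [] [] \<in> carrier G \<Longrightarrow> split_sum G [] f = f [] []"
  by (simp add: split_sum_def)

lemma split_sum_closed:
  "(\<And>a b. a @ b = us \<Longrightarrow> f a b \<in> carrier G) \<Longrightarrow> split_sum G us f \<in> carrier G"
  unfolding split_sum_def by (rule lsum_map_closed) simp

lemma split_sum_add:
  assumes "\<And>a b. a @ b = us \<Longrightarrow> f a b \<in> carrier G" "\<And>a b. a @ b = us \<Longrightarrow> g a b \<in> carrier G"
  shows "split_sum G us (\<lambda>a b. f a b \<oplus> g a b) = split_sum G us f \<oplus> split_sum G us g"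
  unfolding split_sum_def by (rule lsum_add) (simp_all add: assms)

lemma split_sum_zero:
  assumes "\<And>a b. a @ b = us \<Longrightarrow> f a b = \<zero>"
  shows "split_sum G us f = \<zero>"
  unfolding split_sum_def by (rule lsum_zero) (auto simp: assms)

lemma split_sum_first:
  assumes "\<And>a b. a @ b = us \<Longrightarrow> a \<noteq> [] \<Longrightarrow> f a b = \<zero>" "f [] us \<in> carrier G"
  shows "split_sum G us f = f [] us"
proof (cases us)
  case (Cons x vs)
  have "split_sum G vs (\<lambda>a b. f (x # a) b) = \<zero>"
    by (rule split_sum_zero) (use assms(1) Cons in auto)
  then show ?thesis using assms(2) by (simp add: Cons split_sum_Cons)
qed (use assms in \<open>simp add: split_sum_Nil\<close>)

lemma split_sum_last:
  assumes "\<And>a b. a @ b = us \<Longrightarrow> b \<noteq> [] \<Longrightarrow> f a b = \<zero>" "f us [] \<in> carrier G"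
  shows "split_sum G us f = f us []"
  using assms
proof (induction us arbitrary: f)
  case (Cons x us)
  have "split_sum G us (\<lambda>a b. f (x # a) b) = f (x # us) []"
    by (rule Cons.IH) (use Cons.prems in auto)
  then show ?case using Cons.prems by (simp add: split_sum_Cons)
qed (simp add: split_sum_Nil)

lemma split_sum_lsum:
  assumes "\<And>a b i. a @ b = us \<Longrightarrow> i \<in> set is \<Longrightarrow> f i a b \<in> carrier G"
  shows "lsum G (map (\<lambda>i. split_sum G us (f i)) is) = split_sum G us (\<lambda>a b. lsum G (map (\<lambda>i. f i a b) is))"
  unfolding split_sum_def by (rule lsum_swap) (simp add: assms)

lemma split_sum_swap:
  assumes "\<And>a b c d. a @ b = us \<Longrightarrow> c @ d = vs \<Longrightarrow> f a b c d \<in> carrier G"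
  shows "split_sum G us (\<lambda>a b. split_sum G vs (f a b)) =
    split_sum G vs (\<lambda>c d. split_sum G us (\<lambda>a b. f a b c d))"
  unfolding split_sum_def by (rule lsum_swap) (simp add: assms)

text \<open>Both sides run over the factorizations of \<open>us\<close> into three words; this is
  the coassociativity of deconcatenation.\<close>

lemma split_sum_assoc:
  assumes "\<And>a b c. a @ b @ c = us \<Longrightarrow> f a b c \<in> carrier G"
  shows "split_sum G us (\<lambda>a bc. split_sum G bc (f a)) =
    split_sum G us (\<lambda>ab c. split_sum G ab (\<lambda>a b. f a b c))"
  using assms
proof (induction us arbitrary: f)
  case Nil
  then show ?case by (simp add: split_sum_Nil)
next
  case (Cons x us)
  have c: "f [] [] (x # us) \<in> carrier G"
    "\<And>a b. a @ b = us \<Longrightarrow> f [] (x # a) b \<in> carrier G"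
    "\<And>a b c. a @ b @ c = us \<Longrightarrow> f (x # a) b c \<in> carrier G"
    using Cons.prems by auto
  have s: "split_sum G us (\<lambda>a b. split_sum G a (\<lambda>a c. f (x # a) c b)) \<in> carrier G"
    "split_sum G us (\<lambda>a. f [] (x # a)) \<in> carrier G"
    by (intro split_sum_closed c, auto)+
  have "split_sum G (x # us) (\<lambda>a bc. split_sum G bc (f a)) =
    split_sum G (x # us) (f []) \<oplus> split_sum G us (\<lambda>a bc. split_sum G bc (f (x # a)))"
    by (simp add: split_sum_Cons)
  also have "split_sum G us (\<lambda>a bc. split_sum G bc (f (x # a))) =
      split_sum G us (\<lambda>ab c. split_sum G ab (\<lambda>a b. f (x # a) b c))"
    by (rule Cons.IH) (rule c(3))
  also have "split_sum G (x # us) (f []) \<oplus> \<dots> = f [] [] (x # us) \<oplus>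
      split_sum G us (\<lambda>ab c. f [] (x # ab) c \<oplus> split_sum G ab (\<lambda>a b. f (x # a) b c))"
    using c s by (subst split_sum_add)
      (auto simp: split_sum_Cons a_assoc intro!: split_sum_closed)
  also have "\<dots> = split_sum G (x # us) (\<lambda>ab c. split_sum G ab (\<lambda>a b. f a b c))"
    using c by (simp add: split_sum_Cons split_sum_Nil)
  finally show ?case .
qed

end

lemma linear_map_split_sum:
  assumes "linear_map K A B g" "module K A" "module K B"
    and "\<And>a b. a @ b = us \<Longrightarrow> f a b \<in> carrier A"
  shows "g (split_sum A us f) = split_sum B us (\<lambda>a b. g (f a b))"
proof -
  have "set (map (\<lambda>i. f (take i us) (drop i us)) [0..<Suc (length us)]) \<subseteq> carrier A"
    using assms(4) by auto
  from linear_map_lsum[OF assms(1-3) this] show ?thesis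
    by (simp add: split_sum_def o_def del: upt_Suc)
qed

lemma linear_map_split_sum_fun:
  assumes "\<And>a b. a @ b = us \<Longrightarrow> linear_map K A B (\<lambda>x. f x a b)" "module K B"
  shows "linear_map K A B (\<lambda>x. split_sum B us (f x))"
  unfolding split_sum_def by (rule linear_map_lsum_fun) (simp_all add: assms)

text \<open>A letter at a fixed position lies in the left part for some cuts and in the right part
  for the others. Induction on the prefix in front of it peels off the cuts one at a time.\<close>

lemma multilinear_split_sum:
  assumes "\<And>a. a \<in> lists (carrier R) \<Longrightarrow> multilinear K R W (f a)"
    and "\<And>b. b \<in> lists (carrier R) \<Longrightarrow> multilinear K R W (\<lambda>a. f a b)" and W: "module K W"
  shows "multilinear K R W (\<lambda>us. split_sum W us f)"
proof (rule multilinearI)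
  interpret W: module K W by fact
  fix us assume "us \<in> lists (carrier R)"
  then show "split_sum W us f \<in> carrier W"
    by (intro W.M.split_sum_closed multilinear_closed[OF assms(1)]) auto
next
  fix us vs assume "us \<in> lists (carrier R)" "vs \<in> lists (carrier R)"
  then show "linear_map K R W (\<lambda>x. split_sum W (us @ x # vs) f)"
    using assms(1,2)
  proof (induction us arbitrary: f)
    case Nil
    have "linear_map K R W (\<lambda>x. split_sum W vs (\<lambda>a b. f (x # a) b))"
      using Nil(1) multilinear_linear[OF Nil(3), of _ "[]", simplified]
      by (intro linear_map_split_sum_fun W) (auto simp: in_lists_conv_set)
    moreover have "linear_map K R W (\<lambda>x. f [] (x # vs))"
      using Nil(1) multilinear_linear[OF Nil(2), of "[]" "[]" vs] by simp
    ultimately show ?case by (simp add: split_sum_Cons linear_map_add_fun W)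
  next
    case (Cons u us)
    have "linear_map K R W (\<lambda>x. split_sum W (us @ x # vs) (\<lambda>a b. f (u # a) b))"
      using Cons.prems Cons.hyps
      by (intro Cons.IH) (simp_all add: multilinear_Cons[where h = "\<lambda>a. f a _"])
    moreover have "linear_map K R W (\<lambda>x. f [] (u # us @ x # vs))"
      using multilinear_linear[OF Cons.prems(2), of "[]" "u # us" vs] Cons.prems Cons.hyps by simp
    ultimately show ?case by (simp add: split_sum_Cons linear_map_add_fun W)
  qed
qed

section \<open>Tuples, columns and blocks\<close>

lemma in_set_tuples: "a \<in> set (tuples k n) \<longleftrightarrow> length a = k \<and> sum_list a = n"
  using member_le_sum_list[of _ a] by (fastforce simp: tuples_def set_n_lists less_Suc_eq_le)

lemma in_set_tuple_pairs:
  "(a, b) \<in> set (tuple_pairs k p q) \<longleftrightarrow>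
   length a = k \<and> length b = k \<and> sum_list a = p \<and> sum_list b = q"
  by (auto simp: tuple_pairs_def in_set_tuples)

lemma distinct_tuple_pairs: "distinct (tuple_pairs k p q)"
  by (auto simp: tuple_pairs_def tuples_def intro!: distinct_product distinct_n_lists distinct_filter)

lemma tuple_pairs_0: "tuple_pairs 0 p q = (if p = 0 \<and> q = 0 then [([], [])] else [])"
  by (simp add: tuple_pairs_def tuples_def)

lemma tuple_pairs_1: "tuple_pairs (Suc 0) p q = [([p], [q])]"
proof -
  have "set (tuple_pairs (Suc 0) p q) = {([p], [q])}"
    by (auto simp: in_set_tuple_pairs length_Suc_conv)
  with distinct_tuple_pairs[of "Suc 0" p q] show ?thesis
    by (cases "tuple_pairs (Suc 0) p q" rule: remdups_adj.cases) auto
qed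

lemma distinct_concat_map:
  assumes "distinct is" "\<And>i. i \<in> set is \<Longrightarrow> distinct (f i)"
    and "\<And>i j. i \<in> set is \<Longrightarrow> j \<in> set is \<Longrightarrow> i \<noteq> j \<Longrightarrow> set (f i) \<inter> set (f j) = {}"
  shows "distinct (concat (map f is))"
  using assms by (induction "is") fastforce+

text \<open>The pairs of \<open>tuple_pairs (Suc k) p q\<close> sorted by their first column
  \<open>(i, j)\<close>, so that the first block can be factored out of a sum.\<close>

definition tuple_pairs_split :: "nat \<Rightarrow> nat \<Rightarrow> nat \<Rightarrow> (nat list \<times> nat list) list"
  where "tuple_pairs_split k p q =
    concat (map (\<lambda>i. concat (map (\<lambda>j. map (\<lambda>(a, b). (i # a, j # b)) (tuple_pairs k (p - i) (q - j)))
      [0..<Suc q])) [0..<Suc p])"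

lemma set_tuple_pairs_split: "set (tuple_pairs_split k p q) = set (tuple_pairs (Suc k) p q)"
proof -
  have "set (tuple_pairs_split k p q) =
    (\<Union>i\<le>p. \<Union>j\<le>q. (\<lambda>(a, b). (i # a, j # b)) ` set (tuple_pairs k (p - i) (q - j)))"
    by (simp add: tuple_pairs_split_def atLeast0LessThan lessThan_Suc_atMost del: upt_Suc)
  also have "\<dots> = set (tuple_pairs (Suc k) p q)"
  proof (intro equalityI subsetI)
    fix ab :: "nat list \<times> nat list"
    assume "ab \<in> set (tuple_pairs (Suc k) p q)"
    moreover obtain \<alpha> \<beta> where "ab = (\<alpha>, \<beta>)" by fastforce
    moreover from calculation obtain i a j b where "\<alpha> = i # a" "\<beta> = j # b"
      by (cases \<alpha>; cases \<beta>) (auto simp: in_set_tuple_pairs)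
    ultimately have ab: "ab = (i # a, j # b)" and ij: "i \<le> p" "j \<le> q"
      and "(a, b) \<in> set (tuple_pairs k (p - i) (q - j))"
      by (auto simp: in_set_tuple_pairs)
    then have "ab \<in> (\<lambda>(a, b). (i # a, j # b)) ` set (tuple_pairs k (p - i) (q - j))"
      by force
    with ij show "ab \<in> (\<Union>i\<le>p. \<Union>j\<le>q. (\<lambda>(a, b). (i # a, j # b)) ` set (tuple_pairs k (p - i) (q - j)))"
      by blast
  qed (auto simp: in_set_tuple_pairs)
  finally show ?thesis .
qed

lemma distinct_tuple_pairs_split: "distinct (tuple_pairs_split k p q)"
  unfolding tuple_pairs_split_def
  by (intro distinct_concat_map) (auto simp: distinct_map inj_on_def distinct_tuple_pairs simp del: upt_Suc)

lemma brace_blocks_Cons: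
  "brace_blocks M (i # a, j # b) us vs =
   M (take i us) (take j vs) # brace_blocks M (a, b) (drop i us) (drop j vs)"
  by (simp add: brace_blocks_def)

lemma brace_blocks_Nil: "brace_blocks M ([], []) us vs = []"
  by (simp add: brace_blocks_def)

lemma brace_blocks_closed:
  assumes "\<And>us vs. us \<in> lists C \<Longrightarrow> vs \<in> lists C \<Longrightarrow> M us vs \<in> C'"
    and "length a = length b" "us \<in> lists C" "vs \<in> lists C"
  shows "brace_blocks M (a, b) us vs \<in> lists C'"
  using assms(2-4)
proof (induction a b arbitrary: us vs rule: list_induct2)
  case (Cons i a j b)
  have "take i us \<in> lists C" "take j vs \<in> lists C" "drop i us \<in> lists C" "drop j vs \<in> lists C"
    using Cons.prems by (auto simp: in_lists_conv_set dest: in_set_takeD in_set_dropD)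
  then show ?case by (simp add: brace_blocks_Cons assms(1) Cons.IH)
qed (simp add: brace_blocks_Nil)

lemma brace_blocks_zero_column:
  assumes "length a = length b" "(0, 0) \<in> set (zip a b)"
  shows "M [] [] \<in> set (brace_blocks M (a, b) us vs)"
  using assms
  by (induction a b arbitrary: us vs rule: list_induct2) (auto simp: brace_blocks_Cons)

text \<open>Every column other than \<open>(0, 0)\<close> has sum at least one. Hence there are no
  more columns than the total, and each column leaves at least one for every other column, which
  makes all blocks strictly shorter as soon as there are two of them.\<close>

lemma reduced_column_bound:
  assumes "length a = length b" "(0, 0) \<notin> set (zip a b)"
  shows "length a \<le> sum_list a + sum_list b"
    and "(i, j) \<in> set (zip a b) \<Longrightarrow> i + j + length a \<le> Suc (sum_list a + sum_list b)"
proof -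
  have l: "length a \<le> sum_list a + sum_list b"
    if "length a = length b" "(0, 0) \<notin> set (zip a b)" for a b :: "nat list"
    using that by (induction a b rule: list_induct2) auto
  show "length a \<le> sum_list a + sum_list b" using assms by (rule l)
  show "i + j + length a \<le> Suc (sum_list a + sum_list b)" if "(i, j) \<in> set (zip a b)"
    using assms that
  proof (induction a b rule: list_induct2)
    case (Cons m a n b)
    then show ?case using l[of a b] by (cases "(i, j) = (m, n)") auto
  qed simp
qed

lemma zip_map_swap: "zip ys xs = map (\<lambda>(x, y). (y, x)) (zip xs ys)"
  by (induction xs arbitrary: ys) (auto simp: zip_Cons split: list.splits)

text \<open>Exchanges the roles of the two words; linearity in the second word is thereby reduced to
  \<open>brace_blocks_linear\<close>, which is stated for the first.\<close>

lemma brace_blocks_flip: "brace_blocks M (a, b) us vs = brace_blocks (\<lambda>x y. M y x) (b, a) vs us"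
  by (simp add: brace_blocks_def zip_map_swap[of "blocks a us"] o_def case_prod_unfold)

text \<open>The varying letter lies in exactly one block, the brace is linear there, and
  \<open>h\<close> is linear in that block. The bound \<open>N\<close> asks for linearity of the
  brace only on words of smaller total length, which suits an induction in which the brace itself is
  still being studied.\<close>

lemma brace_blocks_linear:
  assumes "length \<alpha> = length \<beta>"
    and "multilinear K R W h" and "sum_list \<alpha> = Suc (length a + length b)"
    and "a \<in> lists (carrier R)" "b \<in> lists (carrier R)" "vs \<in> lists (carrier R)"
    and "\<And>i j. (i, j) \<in> set (zip \<alpha> \<beta>) \<Longrightarrow> i + j < N"
    and M: "\<And>us vs. us \<in> lists (carrier R) \<Longrightarrow> vs \<in> lists (carrier R) \<Longrightarrow> M us vs \<in> carrier R"
    and lin: "\<And>a b vs. a \<in> lists (carrier R) \<Longrightarrow> b \<in> lists (carrier R) \<Longrightarrow> vs \<in> lists (carrier R) \<Longrightarrow>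
      Suc (length a + length b) + length vs < N \<Longrightarrow> linear_map K R R (\<lambda>x. M (a @ x # b) vs)"
  shows "linear_map K R W (\<lambda>x. h (brace_blocks M (\<alpha>, \<beta>) (a @ x # b) vs))"
  using assms(1-7)
proof (induction \<alpha> \<beta> arbitrary: a b vs h rule: list_induct2)
  case (Cons i \<alpha> j \<beta>)
  have td: "take n xs \<in> lists (carrier R)" "drop n xs \<in> lists (carrier R)"
    if "xs \<in> lists (carrier R)" for n xs
    using that by (auto simp: in_lists_conv_set dest: in_set_takeD in_set_dropD)
  show ?case
  \<comment> \<open>The varying letter lies beyond the first block exactly if that block takes at
    most \<open>length a\<close> letters.\<close>
  proof (cases "i \<le> length a")
    case True
    have "linear_map K R W (\<lambda>x. h (M (take i a) (take j vs) #
      brace_blocks M (\<alpha>, \<beta>) (drop i a @ x # b) (drop j vs)))"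
      using Cons.prems True by (intro Cons.IH multilinear_Cons M td) auto
    then show ?thesis using True by (simp add: brace_blocks_Cons)
  next
    case False
    \<comment> \<open>The number of letters that the first block takes after the varying
      one.\<close>
    define i' where "i' = i - Suc (length a)"
    have i: "i = Suc (length a + i')" using False by (simp add: i'_def)
    have "i + j < N" using Cons.prems(6) by auto
    have "i' \<le> length b" using Cons.prems(2) by (simp add: i)
    have "linear_map K R R (\<lambda>x. M (a @ x # take i' b) (take j vs))"
      using Cons.prems \<open>i + j < N\<close> by (intro lin td) (auto simp: i)
    moreover have "linear_map K R W (\<lambda>y. h ([] @ y # brace_blocks M (\<alpha>, \<beta>) (drop i' b) (drop j vs)))"
      using Cons.prems Cons.hyps M
      by (intro multilinear_linear[OF Cons.prems(1)] brace_blocks_closed[where C = "carrier R"] td) auto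
    ultimately have "linear_map K R W (\<lambda>x. h ([] @ M (a @ x # take i' b) (take j vs) #
        brace_blocks M (\<alpha>, \<beta>) (drop i' b) (drop j vs)))"
      by (rule linear_map_comp)
    then show ?thesis by (simp add: brace_blocks_Cons i)
  qed
qed simp

text \<open>
  The classical rules for \<^const>\<open>lists\<close> would unfold membership to a bounded quantifier, which the
  closure lemmas below do not match.
\<close>

declare in_listsD [rule del] in_listsI [rule del]

text \<open>Coassociativity for two words simultaneously: the sums over cuts of \<open>vs\<close>
  are moved inside, \<open>split_sum_assoc\<close> is applied to each word, and the sums are moved
  back.\<close>

lemma (in abelian_monoid) split_sum_assoc2:
  assumes "\<And>a b c d e f. a @ b @ c = us \<Longrightarrow> d @ e @ f = vs \<Longrightarrow> H a b c d e f \<in> carrier G"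
  shows "split_sum G us (\<lambda>a bc. split_sum G vs (\<lambda>d ef. split_sum G bc (\<lambda>b c. split_sum G ef (\<lambda>e f. H a b c d e f)))) =
    split_sum G us (\<lambda>ab c. split_sum G vs (\<lambda>de f. split_sum G ab (\<lambda>a b. split_sum G de (\<lambda>d e. H a b c d e f))))"
proof -
  have "split_sum G us (\<lambda>a bc. split_sum G vs (\<lambda>d ef. split_sum G bc (\<lambda>b c. split_sum G ef (\<lambda>e f. H a b c d e f)))) =
    split_sum G us (\<lambda>a bc. split_sum G bc (\<lambda>b c. split_sum G vs (\<lambda>d ef. split_sum G ef (\<lambda>e f. H a b c d e f))))"
    by (intro split_sum_cong split_sum_swap split_sum_closed assms) auto
  also have "\<dots> = split_sum G us (\<lambda>a bc. split_sum G bc (\<lambda>b c. split_sum G vs (\<lambda>de f. split_sum G de (\<lambda>d e. H a b c d e f))))"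
    by (intro split_sum_cong split_sum_assoc assms) auto
  also have "\<dots> = split_sum G us (\<lambda>ab c. split_sum G ab (\<lambda>a b. split_sum G vs (\<lambda>de f. split_sum G de (\<lambda>d e. H a b c d e f))))"
    by (intro split_sum_assoc split_sum_closed assms) auto
  also have "\<dots> = split_sum G us (\<lambda>ab c. split_sum G vs (\<lambda>de f. split_sum G ab (\<lambda>a b. split_sum G de (\<lambda>d e. H a b c d e f))))"
    by (intro split_sum_cong split_sum_swap split_sum_closed assms) auto
  finally show ?thesis .
qed

text \<open>A cut of \<open>us @ vs\<close> lies in \<open>us\<close> or in \<open>vs\<close>; the
  cut at the seam occurs in both sums on the right, which the extra summand on the left compensates.
  This is the source of the subtracted term in the infinitesimal relation.\<close>

lemma (in abelian_monoid) split_sum_append: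
  assumes "\<And>a b. a @ b = us @ vs \<Longrightarrow> f a b \<in> carrier G"
  shows "split_sum G (us @ vs) f \<oplus> f us vs =
    split_sum G us (\<lambda>a b. f a (b @ vs)) \<oplus> split_sum G vs (\<lambda>a b. f (us @ a) b)"
  using assms
proof (induction us arbitrary: f)
  case Nil
  then show ?case by (simp add: split_sum_Nil a_comm split_sum_closed)
next
  case (Cons u us)
  have c: "f [] (u # us @ vs) \<in> carrier G" "split_sum G (us @ vs) (\<lambda>a. f (u # a)) \<in> carrier G"
    "f (u # us) vs \<in> carrier G" "split_sum G us (\<lambda>a b. f (u # a) (b @ vs)) \<in> carrier G"
    "split_sum G vs (\<lambda>a. f (u # us @ a)) \<in> carrier G"
    using Cons.prems by (auto intro!: split_sum_closed)
  have "split_sum G (us @ vs) (\<lambda>a. f (u # a)) \<oplus> f (u # us) vs =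
    split_sum G us (\<lambda>a b. f (u # a) (b @ vs)) \<oplus> split_sum G vs (\<lambda>a. f (u # us @ a))"
    by (rule Cons.IH) (use Cons.prems in auto)
  then show ?case using c by (simp add: split_sum_Cons a_assoc)
qed

section \<open>The quasi-shuffle product of words\<close>

text \<open>Multilinearity and unit conditions, without the B-infinity relation. The separation is
  made because the braces of a 2-associative algebra are known to satisfy only these conditions when
  the product of words over them is first used.\<close>

locale pre_binf =
  fixes K :: "('k, 'x) ring_scheme" and R :: "('k, 'a, 'y) binf_scheme"
  assumes mR: "module K R"
    and brace_multilinear1: "vs \<in> lists (carrier R) \<Longrightarrow> multilinear K R R (\<lambda>us. brace R us vs)"
    and brace_multilinear2: "us \<in> lists (carrier R) \<Longrightarrow> multilinear K R R (brace R us)"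
    and brace_00: "brace R [] [] = \<zero>\<^bsub>R\<^esub>"
    and brace_10: "u \<in> carrier R \<Longrightarrow> brace R [u] [] = u"
    and brace_01: "u \<in> carrier R \<Longrightarrow> brace R [] [u] = u"
    and brace_n0: "us \<in> lists (carrier R) \<Longrightarrow> 2 \<le> length us \<Longrightarrow> brace R us [] = \<zero>\<^bsub>R\<^esub>"
    and brace_0n: "us \<in> lists (carrier R) \<Longrightarrow> 2 \<le> length us \<Longrightarrow> brace R [] us = \<zero>\<^bsub>R\<^esub>"
begin

abbreviation "M \<equiv> brace R"
abbreviation "C \<equiv> carrier R"
abbreviation "L \<equiv> lists (carrier R)"
abbreviation "T \<equiv> words K R"
abbreviation "TT \<equiv> tensor K T T"
abbreviation "w \<equiv> word K R"
abbreviation tp where "tp \<equiv> ptens K T T"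
abbreviation star where "star \<equiv> word_star K R"
abbreviation "S \<equiv> split_sum"

lemma mT: "module K T" by (rule module_words[OF mR])
lemma mTT: "module K TT" by (rule module_tensor[OF mT mT])

end

sublocale pre_binf \<subseteq> Rm: module K R by (rule mR)
sublocale pre_binf \<subseteq> Tm: module K "words K R" by (rule mT)
sublocale pre_binf \<subseteq> TTm: module K "tensor K (words K R) (words K R)" by (rule mTT)

section \<open>The product of words and its recursion on the first block\<close>

context pre_binf
begin

lemma brace_closed: "us \<in> L \<Longrightarrow> vs \<in> L \<Longrightarrow> M us vs \<in> C"
  using multilinear_closed[OF brace_multilinear2] .

lemma w_closed: "us \<in> L \<Longrightarrow> w us \<in> carrier T"
  using word_closed[OF mR] .

lemma tp_closed: "x \<in> carrier T \<Longrightarrow> y \<in> carrier T \<Longrightarrow> tp x y \<in> carrier TT"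
  by (rule ptens_closed[OF mT mT])

lemmas tp_bilinear = ptens_bilinear[OF mT mT]
lemmas w_multilinear = word_multilinear[OF mR]

definition prep where "prep r = lin_lift T (\<lambda>us. w (r # us))"

lemma prep_linear: "r \<in> C \<Longrightarrow> linear_map K T T (prep r)"
  unfolding prep_def by (rule words_lift_linear[OF multilinear_Cons[OF w_multilinear] mR mT])

lemma prep_word: "r \<in> C \<Longrightarrow> us \<in> L \<Longrightarrow> prep r (w us) = w (r # us)"
  unfolding prep_def by (rule words_lift_word[OF multilinear_Cons[OF w_multilinear] mR mT])

lemma prep_linear_left: "t \<in> carrier T \<Longrightarrow> linear_map K R T (\<lambda>r. prep r t)"
  unfolding prep_def
  by (rule words_lift_param[OF _ mR mT]) (use multilinear_linear[OF w_multilinear, of "[]"] in auto)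

lemma prep_bilinear: "bilinear K R T T prep"
  by (rule bilinearI) (simp_all add: prep_linear prep_linear_left)

lemma prep_closed: "r \<in> C \<Longrightarrow> t \<in> carrier T \<Longrightarrow> prep r t \<in> carrier T"
  using linear_map_closed[OF prep_linear] .

lemma prep_zero_left: "t \<in> carrier T \<Longrightarrow> prep \<zero>\<^bsub>R\<^esub> t = \<zero>\<^bsub>T\<^esub>"
  using linear_map_zero[OF prep_linear_left mR mT] .

text \<open>The part of the product with exactly \<open>k\<close> blocks, composed with
  \<open>h\<close>. The function \<open>h\<close> is kept general so that removing a first block
  \<open>x\<close> amounts to replacing \<open>h\<close> by its restriction to words that start with
  \<open>x\<close>.\<close>

definition bsum where
  "bsum W h k us vs = lsum W (map (\<lambda>ij. h (brace_blocks M ij us vs)) (tuple_pairs k (length us) (length vs)))"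

lemma blocks_closed:
  "us \<in> L \<Longrightarrow> vs \<in> L \<Longrightarrow> ij \<in> set (tuple_pairs k (length us) (length vs)) \<Longrightarrow>
   brace_blocks M ij us vs \<in> L"
  using brace_closed
  by (cases ij) (auto simp: in_set_tuple_pairs intro!: brace_blocks_closed[where C = C])

lemma bsum_closed:
  assumes "multilinear K R W h" "module K W" "us \<in> L" "vs \<in> L"
  shows "bsum W h k us vs \<in> carrier W"
proof -
  interpret W: module K W by fact
  show ?thesis unfolding bsum_def
    by (rule W.M.lsum_map_closed) (use assms blocks_closed in \<open>blast intro: multilinear_closed\<close>)
qed

lemma bsum_0:
  assumes "multilinear K R W h" "module K W" "us \<in> L" "vs \<in> L"
  shows "bsum W h 0 us vs = (if us = [] \<and> vs = [] then h [] else \<zero>\<^bsub>W\<^esub>)"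
proof -
  interpret W: module K W by fact
  show ?thesis using multilinear_closed[OF assms(1), of "[]"]
    by (simp add: bsum_def tuple_pairs_0 brace_blocks_Nil)
qed

text \<open>More columns than letters force a column \<open>(0, 0)\<close>, whose factor is
  \<open>M [] [] = \<zero>\<close>.\<close>

lemma bsum_large:
  assumes "multilinear K R W h" "module K W" "us \<in> L" "vs \<in> L" "length us + length vs < k"
  shows "bsum W h k us vs = \<zero>\<^bsub>W\<^esub>"
proof -
  interpret W: module K W by fact
  have "h (brace_blocks M ij us vs) = \<zero>\<^bsub>W\<^esub>" if "ij \<in> set (tuple_pairs k (length us) (length vs))" for ij
  proof (rule multilinear_zero[OF assms(1) mR assms(2) blocks_closed[OF assms(3,4) that]])
    obtain a b where ij: "ij = (a, b)" by fastforce
    have "(0, 0) \<in> set (zip a b)"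
      using reduced_column_bound(1)[of a b] assms(5) that by (auto simp: ij in_set_tuple_pairs)
    then show "\<zero>\<^bsub>R\<^esub> \<in> set (brace_blocks M ij us vs)"
      using brace_blocks_zero_column[of a b M us vs] that by (simp add: ij brace_00 in_set_tuple_pairs)
  qed
  then show ?thesis unfolding bsum_def by (intro W.M.lsum_zero) auto
qed

text \<open>Sorting the pairs of tuples by their first column \<open>(i, j)\<close> turns the sum
  into one over the first blocks, that is, over a cut of each word; what remains is a sum with one
  block fewer over the right parts.\<close>

lemma bsum_Suc:
  assumes "multilinear K R W h" "module K W" "us \<in> L" "vs \<in> L"
  shows "bsum W h (Suc k) us vs =
    S W us (\<lambda>a u'. S W vs (\<lambda>b v'. bsum W (\<lambda>xs. h (M a b # xs)) k u' v'))"
proof -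
  interpret W: module K W by fact
  let ?p = "length us" and ?q = "length vs"
  let ?f = "\<lambda>ij. h (brace_blocks M ij us vs)"
  have c: "?f ij \<in> carrier W" if "ij \<in> set (tuple_pairs (Suc k) ?p ?q)" for ij
    using multilinear_closed[OF assms(1) blocks_closed[OF assms(3,4) that]] .
  have s: "(i # a, j # b) \<in> set (tuple_pairs (Suc k) ?p ?q)"
    if "i \<le> ?p" "j \<le> ?q" "(a, b) \<in> set (tuple_pairs k (?p - i) (?q - j))" for i j a b
    using that by (auto simp: in_set_tuple_pairs)
  have "bsum W h (Suc k) us vs = lsum W (map ?f (tuple_pairs_split k ?p ?q))"
    unfolding bsum_def
    by (rule W.M.lsum_distinct) (simp_all add: c distinct_tuple_pairs distinct_tuple_pairs_split set_tuple_pairs_split)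
  also have "\<dots> = lsum W (map (\<lambda>i. lsum W (map (\<lambda>j. lsum W (map (\<lambda>(a, b). ?f (i # a, j # b))
      (tuple_pairs k (?p - i) (?q - j)))) [0..<Suc ?q])) [0..<Suc ?p])"
    unfolding tuple_pairs_split_def map_concat map_map o_def
    apply (subst W.M.lsum_concat)
    subgoal using c s by (auto simp: less_Suc_eq_le simp del: upt_Suc)
    apply (simp only: map_map o_def)
    apply (rule arg_cong[where f = "lsum W"], rule map_cong[OF HOL.refl])
    apply (subst W.M.lsum_concat)
    subgoal using c s by (auto simp: less_Suc_eq_le simp del: upt_Suc)
    apply (simp add: o_def case_prod_unfold del: upt_Suc)
    done
  also have "\<dots> = S W us (\<lambda>a u'. S W vs (\<lambda>b v'. bsum W (\<lambda>xs. h (M a b # xs)) k u' v'))"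
    unfolding split_sum_def bsum_def
    by (intro arg_cong[where f = "lsum W"] map_cong refl) (auto simp: brace_blocks_Cons)
  finally show ?thesis .
qed

lemma star_bsum:
  assumes "us \<in> L" "vs \<in> L"
  shows "star us vs = lsum T (map (\<lambda>k. bsum T w k us vs) [0..<Suc (length us + length vs)])"
proof -
  show ?thesis unfolding word_star_def bsum_def
    by (subst Tm.M.lsum_concat)
       (use w_closed blocks_closed[OF assms] in \<open>auto simp: o_def simp del: upt_Suc\<close>)
qed

lemma star_closed: "us \<in> L \<Longrightarrow> vs \<in> L \<Longrightarrow> star us vs \<in> carrier T"
  unfolding star_bsum by (intro Tm.M.lsum_map_closed bsum_closed[OF w_multilinear mT])

text \<open>Surplus block numbers contribute nothing. In the recursion the remaining words have
  various lengths, and a common upper bound allows the sums over \<open>k\<close> and over the cuts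
  to be exchanged.\<close>

lemma star_bsum_ge:
  assumes "us \<in> L" "vs \<in> L" "length us + length vs \<le> n"
  shows "star us vs = lsum T (map (\<lambda>k. bsum T w k us vs) [0..<Suc n])"
  using assms(3)
proof (induction n rule: dec_induct)
  case base
  show ?case by (rule star_bsum[OF assms(1,2)])
next
  case (step n)
  have "lsum T (map (\<lambda>k. bsum T w k us vs) [0..<Suc (Suc n)]) =
      lsum T (map (\<lambda>k. bsum T w k us vs) [0..<Suc n] @ [bsum T w (Suc n) us vs])"
    by simp
  also have "\<dots> = lsum T (map (\<lambda>k. bsum T w k us vs) [0..<Suc n])"
    using step bsum_closed[OF w_multilinear mT assms(1,2)]
    by (subst Tm.M.lsum_append) (auto simp: bsum_large[OF w_multilinear mT assms(1,2)] simp del: upt_Suc)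
  finally show ?case using step by simp
qed

text \<open>
  The first block is split off.  The summand in which both blocks are empty may stay because
  $M_{00} = 0$.
\<close>

lemma star_rec:
  assumes "us \<in> L" "vs \<in> L"
  shows "star us vs = (if us = [] \<and> vs = [] then w [] else \<zero>\<^bsub>T\<^esub>) \<oplus>\<^bsub>T\<^esub>
    S T us (\<lambda>a u'. S T vs (\<lambda>b v'. prep (M a b) (star u' v')))"
proof -
  define n where "n = length us + length vs"
  have split: "a \<in> L \<and> b \<in> L" if "a @ b = us \<or> a @ b = vs" for a b
    using assms that by auto
  have bc: "bsum T (\<lambda>xs. w (M a b # xs)) k u' v' \<in> carrier T"
    if "a \<in> L" "b \<in> L" "u' \<in> L" "v' \<in> L" for a b u' v' k
    using that by (intro bsum_closed[OF multilinear_Cons[OF w_multilinear] mT]) (simp_all add: brace_closed)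
  have "star us vs = lsum T (map (\<lambda>k. bsum T w k us vs) [0..<Suc (Suc n)])"
    by (rule star_bsum_ge[OF assms]) (simp add: n_def)
  also have "[0..<Suc (Suc n)] = 0 # map Suc [0..<Suc n]"
    by (metis map_Suc_upt upt_conv_Cons zero_less_Suc)
  also have "lsum T (map (\<lambda>k. bsum T w k us vs) (0 # map Suc [0..<Suc n])) =
     bsum T w 0 us vs \<oplus>\<^bsub>T\<^esub> lsum T (map (\<lambda>k. bsum T w (Suc k) us vs) [0..<Suc n])"
    by (simp only: list.map lsum_simps map_map o_def)
  also have "lsum T (map (\<lambda>k. bsum T w (Suc k) us vs) [0..<Suc n]) =
    lsum T (map (\<lambda>k. S T us (\<lambda>a u'. S T vs (\<lambda>b v'. bsum T (\<lambda>xs. w (M a b # xs)) k u' v'))) [0..<Suc n])"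
    by (simp only: bsum_Suc[OF w_multilinear mT assms])
  also have "\<dots> = S T us (\<lambda>a u'. lsum T (map (\<lambda>k. S T vs (\<lambda>b v'. bsum T (\<lambda>xs. w (M a b # xs)) k u' v')) [0..<Suc n]))"
    by (intro Tm.M.split_sum_lsum Tm.M.split_sum_closed bc) (use assms in auto)
  also have "\<dots> = S T us (\<lambda>a u'. S T vs (\<lambda>b v'. lsum T (map (\<lambda>k. bsum T (\<lambda>xs. w (M a b # xs)) k u' v') [0..<Suc n])))"
    by (intro split_sum_cong Tm.M.split_sum_lsum bc) (use assms in auto)
  also have "\<dots> = S T us (\<lambda>a u'. S T vs (\<lambda>b v'. prep (M a b) (star u' v')))"
  proof (intro split_sum_cong)
    fix a u' b v' assume ab: "a @ u' = us" "b @ v' = vs"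
    have c: "a \<in> L" "u' \<in> L" "b \<in> L" "v' \<in> L" using split ab by blast+
    have "prep (M a b) (star u' v') = prep (M a b) (lsum T (map (\<lambda>k. bsum T w k u' v') [0..<Suc n]))"
      using ab by (subst star_bsum_ge[OF c(2,4), of n]) (auto simp: n_def)
    also have "\<dots> = lsum T (map (\<lambda>k. prep (M a b) (bsum T w k u' v')) [0..<Suc n])"
      using linear_map_lsum[OF prep_linear[OF brace_closed[OF c(1,3)]] mT mT, of "map (\<lambda>k. bsum T w k u' v') [0..<Suc n]"]
        bsum_closed[OF w_multilinear mT c(2,4)]
      by (auto simp: o_def simp del: upt_Suc)
    also have "(\<lambda>k. prep (M a b) (bsum T w k u' v')) = (\<lambda>k. bsum T (\<lambda>xs. w (M a b # xs)) k u' v')"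
    proof
      fix k
      have "prep (M a b) (lsum T (map (\<lambda>ij. w (brace_blocks M ij u' v')) (tuple_pairs k (length u') (length v')))) =
        lsum T (map (prep (M a b)) (map (\<lambda>ij. w (brace_blocks M ij u' v')) (tuple_pairs k (length u') (length v'))))"
        using w_closed blocks_closed[OF c(2,4)]
        by (intro linear_map_lsum[OF prep_linear[OF brace_closed[OF c(1,3)]] mT mT]) auto
      then show "prep (M a b) (bsum T w k u' v') = bsum T (\<lambda>xs. w (M a b # xs)) k u' v'"
        using blocks_closed[OF c(2,4)] c
        by (auto simp: bsum_def prep_word brace_closed intro!: arg_cong[where f = "lsum T"])
    qed
    finally show "lsum T (map (\<lambda>k. bsum T (\<lambda>xs. w (M a b # xs)) k u' v') [0..<Suc n]) = prep (M a b) (star u' v')"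
      by simp
  qed
  also have "bsum T w 0 us vs = (if us = [] \<and> vs = [] then w [] else \<zero>\<^bsub>T\<^esub>)"
    by (rule bsum_0[OF w_multilinear mT assms])
  finally show ?thesis .
qed

lemma star_term_closed:
  "a \<in> L \<Longrightarrow> u' \<in> L \<Longrightarrow> b \<in> L \<Longrightarrow> v' \<in> L \<Longrightarrow> prep (M a b) (star u' v') \<in> carrier T"
  by (intro prep_closed brace_closed star_closed)

text \<open>The index set of the sum depends only on the lengths of the two words, so linearity may
  be checked for each pair of tuples separately.\<close>

lemma star_multilinear1:
  assumes "vs \<in> L"
  shows "multilinear K R T (\<lambda>us. star us vs)"
proof (rule multilinearI)
  fix a b assume ab: "a \<in> L" "b \<in> L"
  have "linear_map K R T (\<lambda>x. lsum T (map (\<lambda>k. lsum T (map (\<lambda>ij. w (brace_blocks M ij (a @ x # b) vs))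
      (tuple_pairs k (Suc (length a + length b)) (length vs)))) [0..<Suc (Suc (length a + length b) + length vs)]))"
  proof (intro linear_map_lsum_fun mT)
    fix ij k assume ij: "ij \<in> set (tuple_pairs k (Suc (length a + length b)) (length vs))"
    obtain \<alpha> \<beta> where \<alpha>\<beta>: "ij = (\<alpha>, \<beta>)" by fastforce
    have "i + j < Suc (Suc (length a + length b) + length vs)" if "(i, j) \<in> set (zip \<alpha> \<beta>)" for i j
      using ij member_le_sum_list[OF set_zip_leftD[OF that]] member_le_sum_list[OF set_zip_rightD[OF that]]
      by (auto simp: \<alpha>\<beta> in_set_tuple_pairs)
    then show "linear_map K R T (\<lambda>x. w (brace_blocks M ij (a @ x # b) vs))"
      using ij ab assms unfolding \<alpha>\<beta>
      by (intro brace_blocks_linear[OF _ w_multilinear] multilinear_linear[OF brace_multilinear1])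
        (auto simp: in_set_tuple_pairs brace_closed)
  qed
  then show "linear_map K R T (\<lambda>x. star (a @ x # b) vs)"
    by (rule linear_map_cong[OF _ _ mR]) (use ab assms in \<open>simp add: star_bsum bsum_def del: upt_Suc\<close>)
qed (simp add: star_closed assms)

lemma star_multilinear2:
  assumes "us \<in> L"
  shows "multilinear K R T (star us)"
proof (rule multilinearI)
  fix a b assume ab: "a \<in> L" "b \<in> L"
  have "linear_map K R T (\<lambda>x. lsum T (map (\<lambda>k. lsum T (map (\<lambda>ij. w (brace_blocks M ij us (a @ x # b)))
      (tuple_pairs k (length us) (Suc (length a + length b))))) [0..<Suc (length us + Suc (length a + length b))]))"
  proof (intro linear_map_lsum_fun mT)
    fix ij k assume ij: "ij \<in> set (tuple_pairs k (length us) (Suc (length a + length b)))"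
    obtain \<alpha> \<beta> where \<alpha>\<beta>: "ij = (\<alpha>, \<beta>)" by fastforce
    have "i + j < Suc (Suc (length a + length b) + length us)" if "(i, j) \<in> set (zip \<beta> \<alpha>)" for i j
      using ij member_le_sum_list[OF set_zip_leftD[OF that]] member_le_sum_list[OF set_zip_rightD[OF that]]
      by (auto simp: \<alpha>\<beta> in_set_tuple_pairs)
    then show "linear_map K R T (\<lambda>x. w (brace_blocks M ij us (a @ x # b)))"
      using ij ab assms unfolding \<alpha>\<beta> brace_blocks_flip[of M \<alpha>]
      by (intro brace_blocks_linear[OF _ w_multilinear] multilinear_linear[OF brace_multilinear2])
        (auto simp: in_set_tuple_pairs brace_closed)
  qed
  then show "linear_map K R T (\<lambda>x. star us (a @ x # b))"
    by (rule linear_map_cong[OF _ _ mR]) (use ab assms in \<open>simp add: star_bsum bsum_def del: upt_Suc\<close>)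
qed (simp add: star_closed assms)

lemma brace_Nil_long: "us \<in> L \<Longrightarrow> a \<noteq> [] \<Longrightarrow> us = u # a \<Longrightarrow> M us [] = \<zero>\<^bsub>R\<^esub> \<and> M [] us = \<zero>\<^bsub>R\<^esub>"
  using brace_n0[of us] brace_0n[of us] by (cases a) auto

text \<open>Against the empty word a brace vanishes unless its other argument is a single letter, so
  only the decomposition of \<open>vs\<close> into letters survives.\<close>

lemma star_Nil_left: "vs \<in> L \<Longrightarrow> star [] vs = w vs"
proof (induction vs rule: list.induct)
  case Nil
  show ?case
    by (subst star_rec)
      (simp_all add: Tm.M.split_sum_Nil prep_closed star_closed brace_00 prep_zero_left w_closed)
next
  case (Cons v vs)
  then have c: "v \<in> C" "vs \<in> L" by auto
  have t: "prep (M [] a) (star [] b) \<in> carrier T" if "a \<in> L" "b \<in> L" for a b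
    using that by (simp add: star_term_closed)
  have "S T (v # vs) (\<lambda>b v'. prep (M [] b) (star [] v')) \<in> carrier T"
    by (intro Tm.M.split_sum_closed t) (use c in \<open>auto simp: Cons_eq_append_conv append_eq_Cons_conv\<close>)
  then have "star [] (v # vs) = S T (v # vs) (\<lambda>b v'. prep (M [] b) (star [] v'))"
    using c by (subst star_rec) (simp_all add: Tm.M.split_sum_Nil)
  also have "\<dots> = S T vs (\<lambda>b v'. prep (M [] (v # b)) (star [] v'))"
    using c by (simp add: split_sum_Cons brace_00 prep_zero_left star_closed)
      (intro Tm.M.l_zero Tm.M.split_sum_closed t, auto)
  also have "\<dots> = prep (M [] [v]) (star [] vs)"
  proof (rule Tm.M.split_sum_first)
    fix a b assume "a @ b = vs" "a \<noteq> []"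
    then show "prep (M [] (v # a)) (star [] b) = \<zero>\<^bsub>T\<^esub>"
      using c brace_Nil_long[of "v # a" a v] by (auto simp: prep_zero_left star_closed)
  qed (use c t in auto)
  finally show ?case using c Cons.IH by (simp add: brace_01 prep_word)
qed

lemma star_Nil_right: "us \<in> L \<Longrightarrow> star us [] = w us"
proof (induction us rule: list.induct)
  case Nil
  show ?case using star_Nil_left by simp
next
  case (Cons v vs)
  then have c: "v \<in> C" "vs \<in> L" by auto
  have t: "prep (M a []) (star b []) \<in> carrier T" if "a \<in> L" "b \<in> L" for a b
    using that by (simp add: star_term_closed)
  have "S T (v # vs) (\<lambda>b v'. S T [] (\<lambda>c d. prep (M b c) (star v' d))) =
    S T (v # vs) (\<lambda>b v'. prep (M b []) (star v' []))"
    using c by (intro split_sum_cong Tm.M.split_sum_Nil t) (auto simp: Cons_eq_append_conv append_eq_Cons_conv)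
  moreover have "S T (v # vs) (\<lambda>b v'. prep (M b []) (star v' [])) \<in> carrier T"
    by (intro Tm.M.split_sum_closed t) (use c in \<open>auto simp: Cons_eq_append_conv append_eq_Cons_conv\<close>)
  ultimately have "star (v # vs) [] = S T (v # vs) (\<lambda>b v'. prep (M b []) (star v' []))"
    using c by (subst star_rec) simp_all
  also have "\<dots> = S T vs (\<lambda>b v'. prep (M (v # b) []) (star v' []))"
    using c by (simp add: split_sum_Cons brace_00 prep_zero_left star_closed)
      (intro Tm.M.l_zero Tm.M.split_sum_closed t, auto)
  also have "\<dots> = prep (M [v] []) (star vs [])"
  proof (rule Tm.M.split_sum_first)
    fix a b assume "a @ b = vs" "a \<noteq> []"
    then show "prep (M (v # a) []) (star b []) = \<zero>\<^bsub>T\<^esub>"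
      using c brace_Nil_long[of "v # a" a v] by (auto simp: prep_zero_left star_closed)
  qed (use c t in auto)
  finally show ?case using c Cons.IH by (simp add: brace_10 prep_word)
qed

end

section \<open>Coproduct, counit and letter projection on words\<close>

context pre_binf
begin

definition mul where "mul X Y = lin_lift T (\<lambda>us. lin_lift T (\<lambda>vs. star us vs) Y) X"

lemma mul_bilinear: "bilinear K T T T mul"
  unfolding mul_def using words_bilift_bilinear[OF star_multilinear1 star_multilinear2 mR mT] .

lemma mul_word: "us \<in> L \<Longrightarrow> vs \<in> L \<Longrightarrow> mul (w us) (w vs) = star us vs"
  unfolding mul_def using words_bilift_word[OF star_multilinear1 star_multilinear2 mR mT] .

lemma mul_closed: "X \<in> carrier T \<Longrightarrow> Y \<in> carrier T \<Longrightarrow> mul X Y \<in> carrier T"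
  by (rule bilinear_closed[OF mul_bilinear])

definition conc where "conc X Y = lin_lift T (\<lambda>us. lin_lift T (\<lambda>vs. w (us @ vs)) Y) X"

lemma append_multilinear:
  shows "vs \<in> L \<Longrightarrow> multilinear K R T (\<lambda>us. w (us @ vs))"
    and "us \<in> L \<Longrightarrow> multilinear K R T (\<lambda>vs. w (us @ vs))"
  using multilinear_append[OF w_multilinear, of "[]"] multilinear_append[OF w_multilinear, of _ "[]"]
  by simp_all

lemma conc_bilinear: "bilinear K T T T conc"
  unfolding conc_def using words_bilift_bilinear[OF append_multilinear mR mT] .

lemma conc_word: "us \<in> L \<Longrightarrow> vs \<in> L \<Longrightarrow> conc (w us) (w vs) = w (us @ vs)"
  unfolding conc_def using words_bilift_word[OF append_multilinear mR mT] .

definition Delta where "Delta = lin_lift TT (\<lambda>us. S TT us (\<lambda>a b. tp (w a) (w b)))"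

lemma Delta_multilinear: "multilinear K R TT (\<lambda>us. S TT us (\<lambda>a b. tp (w a) (w b)))"
  by (intro multilinear_split_sum mTT multilinear_comp[OF w_multilinear]
    bilinear_right[OF tp_bilinear] bilinear_left[OF tp_bilinear] w_closed)

lemma Delta_linear: "linear_map K T TT Delta"
  unfolding Delta_def by (rule words_lift_linear[OF Delta_multilinear mR mTT])

lemma Delta_word: "us \<in> L \<Longrightarrow> Delta (w us) = S TT us (\<lambda>a b. tp (w a) (w b))"
  unfolding Delta_def by (rule words_lift_word[OF Delta_multilinear mR mTT])

definition eps where "eps = lin_lift (self_module K) (\<lambda>us. if us = [] then \<one>\<^bsub>K\<^esub> else \<zero>\<^bsub>K\<^esub>)"

lemma mK: "module K (self_module K)"
  by (rule module_self[OF module_cring[OF mR]])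

lemma self_simps: "carrier (self_module K) = carrier K" "zero (self_module K) = zero K"
  "add (self_module K) = add K" "smult (self_module K) = mult K"
  by (simp_all add: self_module_def)

lemma eps_multilinear: "multilinear K R (self_module K) (\<lambda>us. if us = [] then \<one>\<^bsub>K\<^esub> else \<zero>\<^bsub>K\<^esub>)"
  using linear_map_const_zero[OF mK] by (intro multilinearI) (simp_all add: self_simps)

lemma eps_linear: "linear_map K T (self_module K) eps"
  unfolding eps_def by (rule words_lift_linear[OF eps_multilinear mR mK])

lemma eps_word: "us \<in> L \<Longrightarrow> eps (w us) = (if us = [] then \<one>\<^bsub>K\<^esub> else \<zero>\<^bsub>K\<^esub>)"
  unfolding eps_def using words_lift_word[OF eps_multilinear mR mK] by simp

lemma eps_closed: "t \<in> carrier T \<Longrightarrow> eps t \<in> carrier K"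
  using linear_map_closed[OF eps_linear] by (simp add: self_simps)

text \<open>The projection of the words onto \<open>R\<close>, their component of length one. On the
  product of two words it returns the brace (\<open>letter_star\<close>).\<close>

definition letter where "letter = lin_lift R (\<lambda>us. case us of [r] \<Rightarrow> r | _ \<Rightarrow> \<zero>\<^bsub>R\<^esub>)"

lemma letter_multilinear: "multilinear K R R (\<lambda>us. case us of [r] \<Rightarrow> r | _ \<Rightarrow> \<zero>\<^bsub>R\<^esub>)"
proof (rule multilinearI)
  fix us vs
  show "linear_map K R R (\<lambda>x. case us @ x # vs of [r] \<Rightarrow> r | _ \<Rightarrow> \<zero>\<^bsub>R\<^esub>)"
  proof (cases "us = [] \<and> vs = []")
    case True
    then show ?thesis by (simp add: linear_map_id)
  next
    case False
    then have "(\<lambda>x. case us @ x # vs of [r] \<Rightarrow> r | _ \<Rightarrow> \<zero>\<^bsub>R\<^esub>) = (\<lambda>x. \<zero>\<^bsub>R\<^esub>)"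
      by (cases us; cases vs) (auto simp: fun_eq_iff split: list.splits)
    then show ?thesis using linear_map_const_zero[OF mR] by simp
  qed
qed (auto split: list.splits)

lemma letter_linear: "linear_map K T R letter"
  unfolding letter_def by (rule words_lift_linear[OF letter_multilinear mR mR])

lemma letter_word: "us \<in> L \<Longrightarrow> letter (w us) = (case us of [r] \<Rightarrow> r | _ \<Rightarrow> \<zero>\<^bsub>R\<^esub>)"
  unfolding letter_def by (rule words_lift_word[OF letter_multilinear mR mR])

lemma letter_closed: "t \<in> carrier T \<Longrightarrow> letter t \<in> C"
  using linear_map_closed[OF letter_linear] .

definition cmul where "cmul = lin_lift T (\<lambda>(a, b). prep (letter a) b)"

lemma cmul_bilinear: "bilinear K T T T (\<lambda>a b. prep (letter a) b)"
  using bilinear_comp_args[OF prep_bilinear letter_linear linear_map_id] .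

lemma cmul_linear: "linear_map K TT T cmul"
  unfolding cmul_def by (rule tensor_lift_linear[OF cmul_bilinear mT mT mT])

lemma cmul_tp: "a \<in> carrier T \<Longrightarrow> b \<in> carrier T \<Longrightarrow> cmul (tp a b) = prep (letter a) b"
  unfolding cmul_def by (rule tensor_lift_ptens[OF cmul_bilinear mT mT mT])

text \<open>
  An element is recovered from its counit and the letter components of the left factors of its
  coproduct.
\<close>

lemma decomposition:
  assumes "t \<in> carrier T"
  shows "t = eps t \<odot>\<^bsub>T\<^esub> w [] \<oplus>\<^bsub>T\<^esub> cmul (Delta t)"
proof (rule words_ext[OF linear_map_id _ mR mT assms])
  have "linear_map K (self_module K) T (\<lambda>c. c \<odot>\<^bsub>T\<^esub> w [])"
    by (rule linear_mapI)
       (simp_all add: self_simps w_closed Tm.smult_l_distr Tm.smult_assoc1)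
  then show "linear_map K T T (\<lambda>t. eps t \<odot>\<^bsub>T\<^esub> w [] \<oplus>\<^bsub>T\<^esub> cmul (Delta t))"
    by (intro linear_map_add_fun mT linear_map_comp[OF eps_linear] linear_map_comp[OF Delta_linear cmul_linear])
  fix us assume us: "us \<in> L"
  have c: "tp (w a) (w b) \<in> carrier TT" if "a \<in> L" "b \<in> L" for a b
    using that by (simp add: tp_closed w_closed)
  have "cmul (Delta (w us)) = S T us (\<lambda>a b. cmul (tp (w a) (w b)))"
    unfolding Delta_word[OF us]
    by (rule linear_map_split_sum[OF cmul_linear mTT mT]) (use us c in auto)
  also have "\<dots> = S T us (\<lambda>a b. prep (letter (w a)) (w b))"
    by (intro split_sum_cong cmul_tp w_closed) (use us in auto)
  also have "\<dots> = (if us = [] then \<zero>\<^bsub>T\<^esub> else w us)"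
  proof (cases us)
    case Nil
    then show ?thesis
      by (simp add: Tm.M.split_sum_Nil letter_word prep_zero_left w_closed)
  next
    case (Cons x vs)
    then have x: "x \<in> C" "vs \<in> L" using us by auto
    have "S T vs (\<lambda>a b. prep (letter (w (x # a))) (w b)) = prep (letter (w [x])) (w vs)"
      by (rule Tm.M.split_sum_first)
         (use x in \<open>auto simp: letter_word prep_zero_left w_closed prep_closed split: list.splits\<close>)
    moreover have "prep (letter (w [])) (w (x # vs)) = \<zero>\<^bsub>T\<^esub>"
      using x by (simp add: letter_word prep_zero_left w_closed)
    ultimately show ?thesis
      using x by (simp add: Cons split_sum_Cons letter_word w_closed prep_word)
  qed
  finally show "w us = eps (w us) \<odot>\<^bsub>T\<^esub> w [] \<oplus>\<^bsub>T\<^esub> cmul (Delta (w us))"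
    using us by (simp add: eps_word w_closed)
qed

text \<open>Linearity in the letter shows that prepending the zero letter induces the zero map on
  tensors, which is what empty first blocks require in \<open>Delta_star\<close>.\<close>

lemma prep_map_tensor_param:
  assumes "X \<in> carrier TT"
  shows "linear_map K R TT (\<lambda>r. map_tensor K T T (prep r) id X)"
  unfolding map_tensor_def
  by (rule tensor_lift_param[OF _ mT mT mTT assms])
    (simp add: linear_map_comp[OF prep_linear_left bilinear_left[OF tp_bilinear]])

text \<open>A cut of a word that starts with \<open>r\<close> lies either before \<open>r\<close>,
  which leaves the empty word on the left, or after it, where it is a cut of the rest.\<close>

lemma Delta_prep:
  assumes r: "r \<in> C" and t: "t \<in> carrier T"
  shows "Delta (prep r t) = tp (w []) (prep r t) \<oplus>\<^bsub>TT\<^esub> map_tensor K T T (prep r) id (Delta t)"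
proof (rule words_ext[OF _ _ mR mTT t])
  note mt = map_tensor_linear[OF mT mT mT mT prep_linear[OF r] linear_map_id']
  show "linear_map K T TT (\<lambda>t. Delta (prep r t))"
    by (rule linear_map_comp[OF prep_linear[OF r] Delta_linear])
  show "linear_map K T TT (\<lambda>t. tp (w []) (prep r t) \<oplus>\<^bsub>TT\<^esub> map_tensor K T T (prep r) id (Delta t))"
    by (intro linear_map_add_fun mTT linear_map_comp[OF prep_linear[OF r] bilinear_right[OF tp_bilinear]]
      linear_map_comp[OF Delta_linear mt]) (simp add: w_closed)
  fix us assume us: "us \<in> L"
  have "map_tensor K T T (prep r) id (Delta (w us)) =
    S TT us (\<lambda>a b. map_tensor K T T (prep r) id (tp (w a) (w b)))"
    unfolding Delta_word[OF us]
    by (rule linear_map_split_sum[OF mt mTT mTT]) (use us in \<open>auto intro!: tp_closed w_closed\<close>)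
  also have "\<dots> = S TT us (\<lambda>a b. tp (w (r # a)) (w b))"
  proof (intro split_sum_cong)
    fix a b assume "a @ b = us"
    then show "map_tensor K T T (prep r) id (tp (w a) (w b)) = tp (w (r # a)) (w b)"
      using us r map_tensor_ptens[OF mT mT mT mT prep_linear[OF r] linear_map_id', of "w a" "w b"]
      by (auto simp: w_closed prep_word)
  qed
  finally show "Delta (prep r (w us)) =
      tp (w []) (prep r (w us)) \<oplus>\<^bsub>TT\<^esub> map_tensor K T T (prep r) id (Delta (w us))"
    using us r by (simp add: prep_word Delta_word split_sum_Cons)
qed

lemma map_tensor_prep_tp:
  "r \<in> C \<Longrightarrow> a \<in> carrier T \<Longrightarrow> b \<in> carrier T \<Longrightarrow>
   map_tensor K T T (prep r) id (tp a b) = tp (prep r a) b"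
  using map_tensor_ptens[OF mT mT mT mT prep_linear linear_map_id'] by simp

text \<open>By induction on the total length along \<open>star_rec\<close>.
  \<open>Delta_prep\<close> separates, in each summand, the cut before the first block from the cuts
  after it. The former add up, with the unit term, to \<open>w []\<close> tensored with the product.
  The latter become, by induction, a sum over factorizations of both words into three parts, which
  \<open>split_sum_assoc2\<close> regroups so that \<open>star_rec\<close> can be read backwards in
  the left tensor factor.\<close>

lemma Delta_star:
  "us \<in> L \<Longrightarrow> vs \<in> L \<Longrightarrow>
   Delta (star us vs) = S TT us (\<lambda>a u'. S TT vs (\<lambda>b v'. tp (star a b) (star u' v')))"
proof (induction "length us + length vs" arbitrary: us vs rule: less_induct)
  case less
  define d where "d us vs = (if us = [] \<and> vs = [] then w [] else \<zero>\<^bsub>T\<^esub>)" for us vs :: "'a list"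
  define G where "G a u' b v' = prep (M a b) (star u' v')" for a u' b v'
  define H where "H a b b' a1 c c' = tp (prep (M a a1) (star b c)) (star b' c')" for a b b' a1 c c'
  have dc: "d a b \<in> carrier T" for a b by (simp add: d_def w_closed)
  have Gc: "G a u' b v' \<in> carrier T" if "a \<in> L" "u' \<in> L" "b \<in> L" "v' \<in> L" for a u' b v'
    using that by (simp add: G_def star_term_closed)
  have Hc: "H a b b' a1 c c' \<in> carrier TT"
    if "a \<in> L" "b \<in> L" "b' \<in> L" "a1 \<in> L" "c \<in> L" "c' \<in> L" for a b b' a1 c c'
    using that by (simp add: H_def star_term_closed star_closed tp_closed)
  have rec: "star us vs = d us vs \<oplus>\<^bsub>T\<^esub> S T us (\<lambda>a u'. S T vs (\<lambda>b v'. G a u' b v'))"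
    if "us \<in> L" "vs \<in> L" for us vs
    unfolding d_def G_def by (rule star_rec[OF that])
  have one: "w [] \<in> carrier T" by (simp add: w_closed)
  have tp0: "tp x \<zero>\<^bsub>T\<^esub> = \<zero>\<^bsub>TT\<^esub>" "tp \<zero>\<^bsub>T\<^esub> x = \<zero>\<^bsub>TT\<^esub>" if "x \<in> carrier T" for x
    using linear_map_zero[OF bilinear_right[OF tp_bilinear that] mT mTT]
      linear_map_zero[OF bilinear_left[OF tp_bilinear that] mT mTT] by simp_all
  have Dd: "Delta (d us vs) = tp (w []) (d us vs)"
    using linear_map_zero[OF Delta_linear mT mTT] one
    by (simp add: d_def Delta_word TTm.M.split_sum_Nil tp_closed tp0)
  have DG: "map_tensor K T T (prep (M a b)) id (Delta (star u' v')) =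
      S TT u' (\<lambda>c u''. S TT v' (\<lambda>e v''. H a c u'' b e v''))"
    if ab: "a @ u' = us" "b @ v' = vs" for a u' b v'
  proof -
    have c: "a \<in> L" "u' \<in> L" "b \<in> L" "v' \<in> L" using ab less.prems by auto
    note mt = map_tensor_linear[OF mT mT mT mT prep_linear[OF brace_closed[OF c(1,3)]] linear_map_id']
    show ?thesis
    proof (cases "a = [] \<and> b = []")
      case True
      have "map_tensor K T T (prep (M a b)) id (Delta (star u' v')) = \<zero>\<^bsub>TT\<^esub>"
        using True linear_map_zero[OF prep_map_tensor_param mR mTT]
          linear_map_closed[OF Delta_linear star_closed[OF c(2,4)]] by (simp add: brace_00)
      moreover have "S TT u' (\<lambda>c u''. S TT v' (\<lambda>e v''. H a c u'' b e v'')) = \<zero>\<^bsub>TT\<^esub>"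
        using True c
        by (intro TTm.M.split_sum_zero) (auto simp: H_def brace_00 prep_zero_left star_closed tp0)
      ultimately show ?thesis by simp
    next
      case False
      then have "length u' + length v' < length us + length vs" using ab by auto
      then have "Delta (star u' v') = S TT u' (\<lambda>a u'. S TT v' (\<lambda>b v'. tp (star a b) (star u' v')))"
        by (rule less.hyps[OF _ c(2,4)])
      then have "map_tensor K T T (prep (M a b)) id (Delta (star u' v')) =
        map_tensor K T T (prep (M a b)) id (S TT u' (\<lambda>a u'. S TT v' (\<lambda>b v'. tp (star a b) (star u' v'))))"
        by simp
      also have "\<dots> =
        S TT u' (\<lambda>c u''. map_tensor K T T (prep (M a b)) id (S TT v' (\<lambda>e v''. tp (star c e) (star u'' v''))))"
        by (rule linear_map_split_sum[OF mt mTT mTT])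
          (intro TTm.M.split_sum_closed tp_closed star_closed, use c in auto)
      also have "\<dots> = S TT u' (\<lambda>c u''. S TT v' (\<lambda>e v''.
          map_tensor K T T (prep (M a b)) id (tp (star c e) (star u'' v''))))"
        by (intro split_sum_cong linear_map_split_sum[OF mt mTT mTT] tp_closed star_closed)
          (use c in auto)
      also have "\<dots> = S TT u' (\<lambda>c u''. S TT v' (\<lambda>e v''. H a c u'' b e v''))"
        unfolding H_def
        by (intro split_sum_cong map_tensor_prep_tp brace_closed star_closed) (use c in auto)
      finally show ?thesis .
    qed
  qed
  let ?SG = "S T us (\<lambda>a u'. S T vs (\<lambda>b v'. G a u' b v'))"
  let ?SH = "\<lambda>a u' b v'. S TT u' (\<lambda>c u''. S TT v' (\<lambda>e v''. H a c u'' b e v''))"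
  have SGc: "?SG \<in> carrier T"
    by (intro Tm.M.split_sum_closed Gc) (use less.prems in auto)
  have "Delta ?SG = S TT us (\<lambda>a u'. Delta (S T vs (\<lambda>b v'. G a u' b v')))"
    by (rule linear_map_split_sum[OF Delta_linear mT mTT])
      (intro Tm.M.split_sum_closed Gc, use less.prems in auto)
  also have "\<dots> = S TT us (\<lambda>a u'. S TT vs (\<lambda>b v'. Delta (G a u' b v')))"
    by (intro split_sum_cong linear_map_split_sum[OF Delta_linear mT mTT] Gc) (use less.prems in auto)
  also have "\<dots> = S TT us (\<lambda>a u'. S TT vs (\<lambda>b v'. tp (w []) (G a u' b v') \<oplus>\<^bsub>TT\<^esub> ?SH a u' b v'))"
  proof (intro split_sum_cong)
    fix a u' b v' assume ab: "a @ u' = us" "b @ v' = vs"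
    then have c: "a \<in> L" "u' \<in> L" "b \<in> L" "v' \<in> L" using less.prems by auto
    show "Delta (G a u' b v') = tp (w []) (G a u' b v') \<oplus>\<^bsub>TT\<^esub> ?SH a u' b v'"
      unfolding DG[OF ab, symmetric] G_def
      by (rule Delta_prep[OF brace_closed[OF c(1,3)] star_closed[OF c(2,4)]])
  qed
  also have "\<dots> = S TT us (\<lambda>a u'. S TT vs (\<lambda>b v'. tp (w []) (G a u' b v')) \<oplus>\<^bsub>TT\<^esub>
      S TT vs (\<lambda>b v'. ?SH a u' b v'))"
    by (intro split_sum_cong TTm.M.split_sum_add TTm.M.split_sum_closed tp_closed one Gc Hc)
      (use less.prems in auto)
  also have "\<dots> = S TT us (\<lambda>a u'. S TT vs (\<lambda>b v'. tp (w []) (G a u' b v'))) \<oplus>\<^bsub>TT\<^esub>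
      S TT us (\<lambda>a u'. S TT vs (\<lambda>b v'. ?SH a u' b v'))"
    by (intro split_sum_cong TTm.M.split_sum_add TTm.M.split_sum_closed tp_closed one Gc Hc)
      (use less.prems in auto)
  also have "S TT us (\<lambda>a u'. S TT vs (\<lambda>b v'. tp (w []) (G a u' b v'))) =
      S TT us (\<lambda>a u'. tp (w []) (S T vs (\<lambda>b v'. G a u' b v')))"
    by (intro split_sum_cong linear_map_split_sum[OF bilinear_right[OF tp_bilinear one] mT mTT, symmetric] Gc)
      (use less.prems in auto)
  also have "\<dots> = tp (w []) ?SG"
    by (intro linear_map_split_sum[OF bilinear_right[OF tp_bilinear one] mT mTT, symmetric]
      Tm.M.split_sum_closed Gc) (use less.prems in auto)
  \<comment> \<open>Cutting off \<open>a\<close> and then \<open>c\<close> is the same as cutting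
    off their concatenation and cutting that again; likewise in the second word.\<close>
  also have "S TT us (\<lambda>a u'. S TT vs (\<lambda>b v'. ?SH a u' b v')) =
    S TT us (\<lambda>ac u''. S TT vs (\<lambda>be v''. S TT ac (\<lambda>a c. S TT be (\<lambda>b e. H a c u'' b e v''))))"
    by (intro TTm.M.split_sum_assoc2 Hc) (use less.prems in auto)
  finally have D: "Delta ?SG = tp (w []) ?SG \<oplus>\<^bsub>TT\<^esub>
    S TT us (\<lambda>ac u''. S TT vs (\<lambda>be v''. S TT ac (\<lambda>a c. S TT be (\<lambda>b e. H a c u'' b e v''))))"
    (is "_ = _ \<oplus>\<^bsub>TT\<^esub> ?SSH") .
  have SSHc: "?SSH \<in> carrier TT"
    by (intro TTm.M.split_sum_closed Hc) (use less.prems in auto)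
  have "Delta (star us vs) = Delta (d us vs) \<oplus>\<^bsub>TT\<^esub> Delta ?SG"
    unfolding rec[OF less.prems] by (rule linear_map_add[OF Delta_linear dc SGc])
  also have "\<dots> = tp (w []) (d us vs) \<oplus>\<^bsub>TT\<^esub> tp (w []) ?SG \<oplus>\<^bsub>TT\<^esub> ?SSH"
    using dc SGc SSHc one by (simp add: D Dd TTm.M.a_assoc tp_closed)
  also have "tp (w []) (d us vs) \<oplus>\<^bsub>TT\<^esub> tp (w []) ?SG = tp (w []) (star us vs)"
    unfolding rec[OF less.prems]
    by (rule linear_map_add[OF bilinear_right[OF tp_bilinear one] dc SGc, symmetric])
  \<comment> \<open>\<open>d a b\<close> vanishes unless both words are empty. The single term can
    therefore be spread over all cuts, where it supplies the unit term of \<open>star_rec\<close>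
    for each left factor.\<close>
  also have "\<dots> = S TT us (\<lambda>a u'. S TT vs (\<lambda>b v'. tp (d a b) (star u' v')))"
  proof -
    have "S TT vs (\<lambda>b v'. tp (d [] b) (star us v')) = tp (d [] []) (star us vs)"
      by (rule TTm.M.split_sum_first)
        (use less.prems in \<open>auto simp: d_def tp0 star_closed intro!: tp_closed dc one\<close>)
    moreover have "S TT us (\<lambda>a u'. S TT vs (\<lambda>b v'. tp (d a b) (star u' v'))) =
        S TT vs (\<lambda>b v'. tp (d [] b) (star us v'))"
      by (rule TTm.M.split_sum_first)
        (use less.prems in \<open>auto simp: d_def tp0 star_closed intro!: TTm.M.split_sum_zero TTm.M.split_sum_closed tp_closed dc one\<close>)
    ultimately show ?thesis by (simp add: d_def)
  qed
  also have "\<dots> \<oplus>\<^bsub>TT\<^esub> ?SSH = S TT us (\<lambda>a u'. S TT vs (\<lambda>b v'. tp (d a b) (star u' v')) \<oplus>\<^bsub>TT\<^esub>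
      S TT vs (\<lambda>be v''. S TT a (\<lambda>a c. S TT be (\<lambda>b e. H a c u' b e v''))))"
    by (intro TTm.M.split_sum_add[symmetric] TTm.M.split_sum_closed tp_closed Hc dc star_closed)
      (use less.prems in auto)
  also have "\<dots> = S TT us (\<lambda>a u'. S TT vs (\<lambda>b v'. tp (d a b) (star u' v') \<oplus>\<^bsub>TT\<^esub>
      S TT a (\<lambda>a c. S TT b (\<lambda>b e. H a c u' b e v'))))"
    by (intro split_sum_cong TTm.M.split_sum_add[symmetric] TTm.M.split_sum_closed tp_closed Hc dc star_closed)
      (use less.prems in auto)
  also have "\<dots> = S TT us (\<lambda>a u'. S TT vs (\<lambda>b v'. tp (star a b) (star u' v')))"
  proof (intro split_sum_cong)
    fix a u' b v' assume ab: "a @ u' = us" "b @ v' = vs"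
    then have c: "a \<in> L" "u' \<in> L" "b \<in> L" "v' \<in> L" using less.prems by auto
    let ?SG' = "S T a (\<lambda>a1 c. S T b (\<lambda>b1 e. G a1 c b1 e))"
    note lin = bilinear_left[OF tp_bilinear star_closed[OF c(2,4)]]
    have "tp (star a b) (star u' v') = tp (d a b) (star u' v') \<oplus>\<^bsub>TT\<^esub> tp ?SG' (star u' v')"
      unfolding rec[OF c(1,3)]
      by (rule linear_map_add[OF lin dc]) (intro Tm.M.split_sum_closed Gc, use c in auto)
    also have "tp ?SG' (star u' v') = S TT a (\<lambda>a1 c. tp (S T b (\<lambda>b1 e. G a1 c b1 e)) (star u' v'))"
      by (rule linear_map_split_sum[OF lin mT mTT]) (intro Tm.M.split_sum_closed Gc, use c in auto)
    also have "\<dots> = S TT a (\<lambda>a1 c. S TT b (\<lambda>b1 e. H a1 c u' b1 e v'))"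
      unfolding H_def G_def
      by (intro split_sum_cong linear_map_split_sum[OF lin mT mTT] star_term_closed) (use c in auto)
    finally show "tp (d a b) (star u' v') \<oplus>\<^bsub>TT\<^esub> S TT a (\<lambda>a c. S TT b (\<lambda>b e. H a c u' b e v')) =
      tp (star a b) (star u' v')" by simp
  qed
  finally show ?case .
qed

end

text \<open>The presentation of a tensor product mentions only carriers, additions and scalars. A
  record with other products or an added coproduct thus has literally the same tensor
  products.\<close>

lemma tensor_struct_cong:
  assumes "carrier A' = carrier A" "add A' = add A" "smult A' = smult A"
  shows "tensor K A' B = tensor K A B" "tensor K B A' = tensor K B A"
    and "ptens K A' B = ptens K A B" "ptens K B A' = ptens K B A"
  using assms by (simp_all add: tensor_def ptens_def tensor_pres_def fun_eq_iff)

lemma assoc_algebraI: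
  assumes "module K A" and b: "bilinear K A A A (mult A)" and "\<one>\<^bsub>A\<^esub> \<in> carrier A"
    and "\<And>x y z. x \<in> carrier A \<Longrightarrow> y \<in> carrier A \<Longrightarrow> z \<in> carrier A \<Longrightarrow>
      x \<otimes>\<^bsub>A\<^esub> y \<otimes>\<^bsub>A\<^esub> z = x \<otimes>\<^bsub>A\<^esub> (y \<otimes>\<^bsub>A\<^esub> z)"
    and "\<And>x. x \<in> carrier A \<Longrightarrow> \<one>\<^bsub>A\<^esub> \<otimes>\<^bsub>A\<^esub> x = x" "\<And>x. x \<in> carrier A \<Longrightarrow> x \<otimes>\<^bsub>A\<^esub> \<one>\<^bsub>A\<^esub> = x"
  shows "assoc_algebra K A"
proof -
  interpret A: module K A by fact
  have "monoid A"
    by (rule monoidI) (use assms bilinear_closed[OF b] in auto)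
  then have "ring A"
    using linear_map_add[OF bilinear_left[OF b]] linear_map_add[OF bilinear_right[OF b]]
    by (intro ringI A.M.abelian_group_axioms) (simp_all)
  then show ?thesis
    using assms(1) linear_map_smult[OF bilinear_left[OF b]] linear_map_smult[OF bilinear_right[OF b]]
    by (simp add: assoc_algebra_def)
qed

lemma
  assumes "assoc_algebra K A"
  shows assoc_algebra_module: "module K A" and assoc_algebra_ring: "ring A"
    and assoc_algebra_bilinear: "bilinear K A A A (mult A)"
proof -
  show m: "module K A" and r: "ring A" using assms by (simp_all add: assoc_algebra_def)
  interpret A: ring A by (rule r)
  show "bilinear K A A A (mult A)"
    using assms by (intro bilinearI linear_mapI) (simp_all add: assoc_algebra_def A.l_distr A.r_distr)
qed

section \<open>Letter components of products and the comparison of the two bracketings\<close>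

context pre_binf
begin

lemma one_closed: "w [] \<in> carrier T"
  by (simp add: w_closed)

lemma eps_prep: 
  assumes r: "r \<in> C" and t: "t \<in> carrier T"
  shows "eps (prep r t) = \<zero>\<^bsub>K\<^esub>"
proof -
  have "eps (prep r t) = \<zero>\<^bsub>self_module K\<^esub>"
    by (rule words_ext[OF linear_map_comp[OF prep_linear[OF r] eps_linear] linear_map_const_zero[OF mK] mR mK t])
      (simp add: prep_word r eps_word self_simps)
  then show ?thesis by (simp add: self_simps)
qed

lemma letter_prep:
  assumes r: "r \<in> C" and t: "t \<in> carrier T"
  shows "letter (prep r t) = eps t \<odot>\<^bsub>R\<^esub> r"
proof (rule words_ext[OF linear_map_comp[OF prep_linear[OF r] letter_linear] _ mR mR t])
  have "linear_map K (self_module K) R (\<lambda>c. c \<odot>\<^bsub>R\<^esub> r)"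
    by (rule linear_mapI) (simp_all add: self_simps r Rm.smult_l_distr Rm.smult_assoc1)
  then show "linear_map K T R (\<lambda>t. eps t \<odot>\<^bsub>R\<^esub> r)" by (rule linear_map_comp[OF eps_linear])
qed (auto simp: prep_word r letter_word eps_word split: list.splits)

lemma star_sum_closed:
  assumes "us \<in> L" "vs \<in> L"
  shows "S T us (\<lambda>a u'. S T vs (\<lambda>b v'. prep (M a b) (star u' v'))) \<in> carrier T"
  by (intro Tm.M.split_sum_closed star_term_closed) (use assms in auto)

lemma linear_map_star:
  assumes "linear_map K T W f" "module K W" "us \<in> L" "vs \<in> L"
  shows "f (star us vs) = f (if us = [] \<and> vs = [] then w [] else \<zero>\<^bsub>T\<^esub>) \<oplus>\<^bsub>W\<^esub>
    S W us (\<lambda>a u'. S W vs (\<lambda>b v'. f (prep (M a b) (star u' v'))))"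
proof -
  have "f (star us vs) = f (if us = [] \<and> vs = [] then w [] else \<zero>\<^bsub>T\<^esub>) \<oplus>\<^bsub>W\<^esub>
      f (S T us (\<lambda>a u'. S T vs (\<lambda>b v'. prep (M a b) (star u' v'))))"
    unfolding star_rec[OF assms(3,4)]
    by (rule linear_map_add[OF assms(1) _ star_sum_closed[OF assms(3,4)]]) (simp add: one_closed)
  also have "f (S T us (\<lambda>a u'. S T vs (\<lambda>b v'. prep (M a b) (star u' v')))) =
      S W us (\<lambda>a u'. f (S T vs (\<lambda>b v'. prep (M a b) (star u' v'))))"
    by (rule linear_map_split_sum[OF assms(1) mT assms(2)])
      (intro Tm.M.split_sum_closed star_term_closed, use assms in auto)
  also have "\<dots> = S W us (\<lambda>a u'. S W vs (\<lambda>b v'. f (prep (M a b) (star u' v'))))"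
    by (intro split_sum_cong linear_map_split_sum[OF assms(1) mT assms(2)] star_term_closed)
      (use assms in auto)
  finally show ?thesis .
qed

lemma eps_star:
  assumes "us \<in> L" "vs \<in> L"
  shows "eps (star us vs) = (if us = [] \<and> vs = [] then \<one>\<^bsub>K\<^esub> else \<zero>\<^bsub>K\<^esub>)"
proof -
  interpret KK: module K "self_module K" by (rule mK)
  have "S (self_module K) us (\<lambda>a u'. S (self_module K) vs (\<lambda>b v'. eps (prep (M a b) (star u' v')))) = \<zero>\<^bsub>self_module K\<^esub>"
    by (intro KK.M.split_sum_zero)
      (use assms in \<open>auto simp: eps_prep brace_closed star_closed self_simps\<close>)
  then have "eps (star us vs) = eps (if us = [] \<and> vs = [] then w [] else \<zero>\<^bsub>T\<^esub>)"
    using linear_map_star[OF eps_linear mK assms] linear_map_closed[OF eps_linear] one_closed by simp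
  then show ?thesis using linear_map_zero[OF eps_linear mT mK] by (simp add: eps_word self_simps)
qed

text \<open>A one-letter word has a single block, which must use up both words: in
  \<open>star_rec\<close> every summand that leaves something behind has a right factor of counit
  zero. The braces are thus recovered from the product.\<close>

lemma letter_star:
  assumes "us \<in> L" "vs \<in> L"
  shows "letter (star us vs) = M us vs"
proof -
  have t: "letter (prep (M a b) (star u' v')) = (if u' = [] \<and> v' = [] then M a b else \<zero>\<^bsub>R\<^esub>)"
    if "a \<in> L" "b \<in> L" "u' \<in> L" "v' \<in> L" for a b u' v'
    using that by (simp add: letter_prep brace_closed star_closed eps_star)
  have 1: "S R vs (\<lambda>b v'. letter (prep (M us b) (star [] v'))) = letter (prep (M us vs) (star [] []))"
    by (rule Rm.M.split_sum_last) (use assms in \<open>auto simp: t brace_closed\<close>)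
  have "S R us (\<lambda>a u'. S R vs (\<lambda>b v'. letter (prep (M a b) (star u' v')))) = S R vs (\<lambda>b v'. letter (prep (M us b) (star [] v')))"
  proof (rule Rm.M.split_sum_last)
    show "S R vs (\<lambda>b v'. letter (prep (M us b) (star [] v'))) \<in> C"
      unfolding 1 using assms by (simp add: t brace_closed)
    show "S R vs (\<lambda>ba v'. letter (prep (M a ba) (star b v'))) = \<zero>\<^bsub>R\<^esub>" if "a @ b = us" "b \<noteq> []" for a b
      by (rule Rm.M.split_sum_zero) (use that assms in \<open>auto simp: t\<close>)
  qed
  also have "\<dots> = M us vs" unfolding 1 using assms by (simp add: t)
  finally show ?thesis
    using linear_map_star[OF letter_linear mR assms] linear_map_zero[OF letter_linear mT mR] assms
    by (simp add: letter_word brace_closed)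
qed

lemma mul_one_left: "X \<in> carrier T \<Longrightarrow> mul (w []) X = X"
  by (rule words_ext[OF bilinear_right[OF mul_bilinear one_closed] linear_map_id mR mT])
    (simp_all add: mul_word star_Nil_left)

lemma mul_one_right: "X \<in> carrier T \<Longrightarrow> mul X (w []) = X"
  by (rule words_ext[OF bilinear_left[OF mul_bilinear one_closed] linear_map_id mR mT])
    (simp_all add: mul_word star_Nil_right)

lemma bilinear_words_ext:
  assumes "bilinear K T T W f" "bilinear K T T W g" "module K W" "X \<in> carrier T" "Y \<in> carrier T"
    and "\<And>us vs. us \<in> L \<Longrightarrow> vs \<in> L \<Longrightarrow> f (w us) (w vs) = g (w us) (w vs)"
  shows "f X Y = g X Y"
proof (rule words_ext[OF bilinear_left[OF assms(1,5)] bilinear_left[OF assms(2,5)] mR assms(3,4)])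
  fix us assume us: "us \<in> L"
  show "f (w us) Y = g (w us) Y"
    by (rule words_ext[OF bilinear_right[OF assms(1)] bilinear_right[OF assms(2)] mR assms(3,5)])
      (simp_all add: us w_closed assms(6))
qed

lemma eps_mul:
  assumes "X \<in> carrier T" "Y \<in> carrier T"
  shows "eps (mul X Y) = eps X \<otimes>\<^bsub>K\<^esub> eps Y"
proof -
  have "bilinear K (self_module K) (self_module K) (self_module K) (mult K)"
    by (intro bilinearI linear_mapI)
      (simp_all add: self_simps Rm.R.l_distr Rm.R.r_distr Rm.R.m_ac)
  then show ?thesis
    by (rule bilinear_words_ext[OF bilinear_comp[OF mul_bilinear eps_linear] bilinear_comp_args mK assms])
      (simp_all add: eps_linear mul_word eps_star eps_word)
qed

abbreviation "H \<equiv> Tfc K R"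

lemma Tfc_simps:
  "carrier H = carrier T" "mult H = mul" "one H = w []" "zero H = zero T" "add H = add T"
  "smult H = smult T" "dot H = conc" "comult H = Delta"
  by (simp_all add: Tfc_def Let_def mul_def conc_def Delta_def split_sum_def fun_eq_iff)

lemma Tfc_struct:
  "tensor K H B = tensor K T B" "tensor K B H = tensor K B T"
  "ptens K H B = ptens K T B" "ptens K B H = ptens K B T"
  by (rule tensor_struct_cong; simp add: Tfc_simps)+

lemma mH: "module K H"
  by (rule module_cong[OF mT]) (simp_all add: Tfc_simps)

lemma linear_map_Tfc: "linear_map K H = linear_map K T" "linear_map K B H = linear_map K B T"
  by (auto simp: linear_map_def Tfc_simps fun_eq_iff)

abbreviation tmul where "tmul \<equiv> tensor_mult K H"

lemma bilinear_Tfc: "bilinear K H H H f = bilinear K T T T f"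
  by (simp add: bilinear_def linear_map_Tfc Tfc_simps)

lemma tmul_bilinear: "bilinear K TT TT TT tmul"
  using tensor_mult_bilinear[OF mH] mul_bilinear by (simp add: bilinear_Tfc Tfc_simps Tfc_struct)

lemma tmul_tp: "a \<in> carrier T \<Longrightarrow> b \<in> carrier T \<Longrightarrow> a' \<in> carrier T \<Longrightarrow> b' \<in> carrier T \<Longrightarrow>
    tmul (tp a b) (tp a' b') = tp (mul a a') (mul b b')"
  using tensor_mult_ptens[OF mH, of a b a' b'] mul_bilinear by (simp add: bilinear_Tfc Tfc_simps Tfc_struct)

lemma tmul_split_sum:
  assumes f: "\<And>a b. a @ b = us \<Longrightarrow> f a b \<in> carrier TT" and g: "\<And>a b. a @ b = vs \<Longrightarrow> g a b \<in> carrier TT"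
  shows "tmul (S TT us f) (S TT vs g) = S TT us (\<lambda>a a'. S TT vs (\<lambda>b b'. tmul (f a a') (g b b')))"
proof -
  have gc: "S TT vs g \<in> carrier TT" by (rule TTm.M.split_sum_closed[OF g])
  have "tmul (S TT us f) (S TT vs g) = S TT us (\<lambda>a a'. tmul (f a a') (S TT vs g))"
    by (rule linear_map_split_sum[OF bilinear_left[OF tmul_bilinear gc] mTT mTT f])
  also have "\<dots> = S TT us (\<lambda>a a'. S TT vs (\<lambda>b b'. tmul (f a a') (g b b')))"
    by (intro split_sum_cong linear_map_split_sum[OF bilinear_right[OF tmul_bilinear] mTT mTT] f g)
  finally show ?thesis .
qed

lemma Delta_mul:
  assumes "X \<in> carrier T" "Y \<in> carrier T"
  shows "Delta (mul X Y) = tmul (Delta X) (Delta Y)"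
proof (rule bilinear_words_ext[OF bilinear_comp[OF mul_bilinear Delta_linear]
      bilinear_comp_args[OF tmul_bilinear Delta_linear Delta_linear] mTT assms])
  fix us vs assume uv: "us \<in> L" "vs \<in> L"
  have "tmul (Delta (w us)) (Delta (w vs)) =
      S TT us (\<lambda>a a'. S TT vs (\<lambda>b b'. tmul (tp (w a) (w a')) (tp (w b) (w b'))))"
    unfolding Delta_word[OF uv(1)] Delta_word[OF uv(2)]
    by (intro tmul_split_sum tp_closed w_closed) (use uv in auto)
  also have "\<dots> = S TT us (\<lambda>a a'. S TT vs (\<lambda>b b'. tp (star a b) (star a' b')))"
  proof (intro split_sum_cong)
    fix a a' b b' assume "a @ a' = us" "b @ b' = vs"
    then have "a \<in> L" "a' \<in> L" "b \<in> L" "b' \<in> L" using uv by auto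
    then show "tmul (tp (w a) (w a')) (tp (w b) (w b')) = tp (star a b) (star a' b')"
      by (simp add: tmul_tp w_closed mul_word)
  qed
  also have "\<dots> = Delta (star us vs)" by (rule Delta_star[OF uv, symmetric])
  finally show "Delta (mul (w us) (w vs)) = tmul (Delta (w us)) (Delta (w vs))"
    using uv by (simp add: mul_word)
qed

definition lprod where "lprod us vs ws = mul (star us vs) (w ws)"
definition rprod where "rprod us vs ws = mul (w us) (star vs ws)"

lemma lprod_closed: "us \<in> L \<Longrightarrow> vs \<in> L \<Longrightarrow> ws \<in> L \<Longrightarrow> lprod us vs ws \<in> carrier T"
  and rprod_closed: "us \<in> L \<Longrightarrow> vs \<in> L \<Longrightarrow> ws \<in> L \<Longrightarrow> rprod us vs ws \<in> carrier T"
  by (simp_all add: lprod_def rprod_def mul_closed star_closed w_closed)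

lemma lprod_units:
  "us \<in> L \<Longrightarrow> vs \<in> L \<Longrightarrow> lprod us vs [] = star us vs"
  "us \<in> L \<Longrightarrow> vs \<in> L \<Longrightarrow> lprod us [] vs = star us vs"
  "us \<in> L \<Longrightarrow> vs \<in> L \<Longrightarrow> lprod [] us vs = star us vs"
  and rprod_units:
  "us \<in> L \<Longrightarrow> vs \<in> L \<Longrightarrow> rprod us vs [] = star us vs"
  "us \<in> L \<Longrightarrow> vs \<in> L \<Longrightarrow> rprod us [] vs = star us vs"
  "us \<in> L \<Longrightarrow> vs \<in> L \<Longrightarrow> rprod [] us vs = star us vs"
  by (simp_all add: lprod_def rprod_def star_Nil_left star_Nil_right mul_one_left mul_one_right
    star_closed mul_word)

text \<open>Multiplicativity of \<open>Delta\<close> for both products: the three words are cut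
  independently, and the left parts and the right parts are bracketed in the same way as the
  words.\<close>

lemma Delta_lprod:
  assumes "us \<in> L" "vs \<in> L" "ws \<in> L"
  shows "Delta (lprod us vs ws) = S TT us (\<lambda>a a'. S TT vs (\<lambda>b b'. S TT ws (\<lambda>c c'.
    tp (lprod a b c) (lprod a' b' c'))))"
proof -
  have "Delta (lprod us vs ws) =
    tmul (S TT us (\<lambda>a u'. S TT vs (\<lambda>b v'. tp (star a b) (star u' v')))) (S TT ws (\<lambda>a b. tp (w a) (w b)))"
    unfolding lprod_def using assms by (simp add: Delta_mul star_closed w_closed Delta_star Delta_word)
  also have "\<dots> = S TT us (\<lambda>a a'. S TT ws (\<lambda>c c'. tmul (S TT vs (\<lambda>b b'. tp (star a b) (star a' b'))) (tp (w c) (w c'))))"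
    by (intro tmul_split_sum TTm.M.split_sum_closed tp_closed w_closed star_closed) (use assms in auto)
  also have "\<dots> = S TT us (\<lambda>a a'. S TT ws (\<lambda>c c'. S TT vs (\<lambda>b b'. tmul (tp (star a b) (star a' b')) (tp (w c) (w c')))))"
    by (intro split_sum_cong linear_map_split_sum[OF bilinear_left[OF tmul_bilinear] mTT mTT]
      tp_closed w_closed star_closed) (use assms in auto)
  also have "\<dots> = S TT us (\<lambda>a a'. S TT ws (\<lambda>c c'. S TT vs (\<lambda>b b'. tp (lprod a b c) (lprod a' b' c'))))"
    unfolding lprod_def
    by (intro split_sum_cong tmul_tp star_closed w_closed) (use assms in auto)
  also have "\<dots> = S TT us (\<lambda>a a'. S TT vs (\<lambda>b b'. S TT ws (\<lambda>c c'. tp (lprod a b c) (lprod a' b' c'))))"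
    by (intro split_sum_cong TTm.M.split_sum_swap tp_closed lprod_closed) (use assms in auto)
  finally show ?thesis .
qed

lemma Delta_rprod:
  assumes "us \<in> L" "vs \<in> L" "ws \<in> L"
  shows "Delta (rprod us vs ws) = S TT us (\<lambda>a a'. S TT vs (\<lambda>b b'. S TT ws (\<lambda>c c'.
    tp (rprod a b c) (rprod a' b' c'))))"
proof -
  have "Delta (rprod us vs ws) =
    tmul (S TT us (\<lambda>a b. tp (w a) (w b))) (S TT vs (\<lambda>a u'. S TT ws (\<lambda>b v'. tp (star a b) (star u' v'))))"
    unfolding rprod_def using assms by (simp add: Delta_mul star_closed w_closed Delta_star Delta_word)
  also have "\<dots> = S TT us (\<lambda>a a'. S TT vs (\<lambda>b b'. tmul (tp (w a) (w a')) (S TT ws (\<lambda>c c'. tp (star b c) (star b' c')))))"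
    by (intro tmul_split_sum TTm.M.split_sum_closed tp_closed w_closed star_closed) (use assms in auto)
  also have "\<dots> = S TT us (\<lambda>a a'. S TT vs (\<lambda>b b'. S TT ws (\<lambda>c c'. tmul (tp (w a) (w a')) (tp (star b c) (star b' c')))))"
    by (intro split_sum_cong linear_map_split_sum[OF bilinear_right[OF tmul_bilinear] mTT mTT]
      tp_closed w_closed star_closed) (use assms in auto)
  also have "\<dots> = S TT us (\<lambda>a a'. S TT vs (\<lambda>b b'. S TT ws (\<lambda>c c'. tp (rprod a b c) (rprod a' b' c'))))"
    unfolding rprod_def
    by (intro split_sum_cong tmul_tp star_closed w_closed) (use assms in auto)
  finally show ?thesis .
qed

text \<open>The part of \<open>cmul (Delta (A us vs ws))\<close> that comes from cuts with a
  nonempty right part; \<open>A\<close> stands for either bracketing. The left parts in it are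
  shorter in total than the given words.\<close>

definition remainder where
  "remainder A us vs ws = S T us (\<lambda>a a'. S T vs (\<lambda>b b'. S T ws (\<lambda>c c'.
     if a' = [] \<and> b' = [] \<and> c' = [] then \<zero>\<^bsub>T\<^esub> else prep (letter (A a b c)) (A a' b' c'))))"

text \<open>\<open>decomposition\<close> applied to \<open>A us vs ws\<close>. The cut with three
  empty right parts has right tensor factor \<open>w []\<close> and yields the one-letter word; all
  other cuts make up \<open>remainder\<close>. The form for a general \<open>A\<close> serves both
  bracketings.\<close>

lemma triple_split:
  assumes A: "\<And>us vs ws. us \<in> L \<Longrightarrow> vs \<in> L \<Longrightarrow> ws \<in> L \<Longrightarrow> A us vs ws \<in> carrier T"
    and A0: "A [] [] [] = w []" and L: "us \<in> L" "vs \<in> L" "ws \<in> L"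
    and D: "Delta (A us vs ws) = S TT us (\<lambda>a a'. S TT vs (\<lambda>b b'. S TT ws (\<lambda>c c'. tp (A a b c) (A a' b' c'))))"
  shows "A us vs ws = eps (A us vs ws) \<odot>\<^bsub>T\<^esub> w [] \<oplus>\<^bsub>T\<^esub> (w [letter (A us vs ws)] \<oplus>\<^bsub>T\<^esub> remainder A us vs ws)"
    and "remainder A us vs ws \<in> carrier T"
proof -
  let ?F = "\<lambda>a a' b b' c c'. prep (letter (A a b c)) (A a' b' c')"
  let ?P = "\<lambda>a' b' c'. a' = [] \<and> b' = [] \<and> c' = ([] :: 'a list)"
  let ?G = "\<lambda>a a' b b' c c'. if ?P a' b' c' then ?F a a' b b' c c' else \<zero>\<^bsub>T\<^esub>"
  let ?N = "\<lambda>a a' b b' c c'. if ?P a' b' c' then \<zero>\<^bsub>T\<^esub> else ?F a a' b b' c c'"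
  have Fc: "?F a a' b b' c c' \<in> carrier T"
    if "a \<in> L" "a' \<in> L" "b \<in> L" "b' \<in> L" "c \<in> L" "c' \<in> L" for a a' b b' c c'
    using that by (simp add: prep_closed letter_closed A)
  have Gc: "?G a a' b b' c c' \<in> carrier T" and Nc: "?N a a' b b' c c' \<in> carrier T"
    if "a \<in> L" "a' \<in> L" "b \<in> L" "b' \<in> L" "c \<in> L" "c' \<in> L" for a a' b b' c c'
    using Fc[OF that] by auto
  show "remainder A us vs ws \<in> carrier T"
    unfolding remainder_def by (intro Tm.M.split_sum_closed Nc) (use L in auto)
  have "cmul (Delta (A us vs ws)) = S T us (\<lambda>a a'. cmul (S TT vs (\<lambda>b b'. S TT ws (\<lambda>c c'. tp (A a b c) (A a' b' c')))))"
    unfolding D by (rule linear_map_split_sum[OF cmul_linear mTT mT])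
      (intro TTm.M.split_sum_closed tp_closed A, use L in auto)
  also have "\<dots> = S T us (\<lambda>a a'. S T vs (\<lambda>b b'. cmul (S TT ws (\<lambda>c c'. tp (A a b c) (A a' b' c')))))"
    by (intro split_sum_cong linear_map_split_sum[OF cmul_linear mTT mT] TTm.M.split_sum_closed tp_closed A)
      (use L in auto)
  also have "\<dots> = S T us (\<lambda>a a'. S T vs (\<lambda>b b'. S T ws (\<lambda>c c'. cmul (tp (A a b c) (A a' b' c')))))"
    by (intro split_sum_cong linear_map_split_sum[OF cmul_linear mTT mT] tp_closed A)
      (use L in auto)
  also have "\<dots> = S T us (\<lambda>a a'. S T vs (\<lambda>b b'. S T ws (\<lambda>c c'. ?G a a' b b' c c' \<oplus>\<^bsub>T\<^esub> ?N a a' b b' c c')))"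
  proof (intro split_sum_cong)
    fix a a' b b' c c' assume "a @ a' = us" "b @ b' = vs" "c @ c' = ws"
    then have l: "a \<in> L" "a' \<in> L" "b \<in> L" "b' \<in> L" "c \<in> L" "c' \<in> L" using L by auto
    note Fc' = Fc[OF l]
    have eq: "cmul (tp (A a b c) (A a' b' c')) = ?F a a' b b' c c'"
      using l by (simp add: cmul_tp A)
    show "cmul (tp (A a b c) (A a' b' c')) = ?G a a' b b' c c' \<oplus>\<^bsub>T\<^esub> ?N a a' b b' c c'"
    proof (cases "?P a' b' c'")
      case True
      show ?thesis unfolding eq if_P[OF True] using Fc' by simp
    next
      case False
      show ?thesis unfolding eq if_not_P[OF False] using Fc' by simp
    qed
  qed
  also have "\<dots> = S T us (\<lambda>a a'. S T vs (\<lambda>b b'. S T ws (\<lambda>c c'. ?G a a' b b' c c') \<oplus>\<^bsub>T\<^esub> S T ws (\<lambda>c c'. ?N a a' b b' c c')))"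
    by (intro split_sum_cong Tm.M.split_sum_add Gc Nc) (use L in auto)
  also have "\<dots> = S T us (\<lambda>a a'. S T vs (\<lambda>b b'. S T ws (\<lambda>c c'. ?G a a' b b' c c')) \<oplus>\<^bsub>T\<^esub>
      S T vs (\<lambda>b b'. S T ws (\<lambda>c c'. ?N a a' b b' c c')))"
    by (intro split_sum_cong Tm.M.split_sum_add Tm.M.split_sum_closed Gc Nc) (use L in auto)
  also have "\<dots> = S T us (\<lambda>a a'. S T vs (\<lambda>b b'. S T ws (\<lambda>c c'. ?G a a' b b' c c'))) \<oplus>\<^bsub>T\<^esub> remainder A us vs ws"
    unfolding remainder_def
    by (intro split_sum_cong Tm.M.split_sum_add Tm.M.split_sum_closed Gc Nc) (use L in auto)
  \<comment> \<open>The summands \<open>?G\<close> vanish unless all three words are cut at their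
    ends.\<close>
  also have "S T us (\<lambda>a a'. S T vs (\<lambda>b b'. S T ws (\<lambda>c c'. ?G a a' b b' c c'))) =
      S T vs (\<lambda>b b'. S T ws (\<lambda>c c'. ?G us [] b b' c c'))"
    by (rule Tm.M.split_sum_last)
      (simp add: Tm.M.split_sum_zero, intro Tm.M.split_sum_closed Gc, use L in auto)
  also have "\<dots> = S T ws (\<lambda>c c'. ?G us [] vs [] c c')"
    by (rule Tm.M.split_sum_last)
      (simp add: Tm.M.split_sum_zero, intro Tm.M.split_sum_closed Gc, use L in auto)
  also have "\<dots> = ?G us [] vs [] ws []"
    by (rule Tm.M.split_sum_last) (simp, intro Gc, use L in auto)
  also have "\<dots> = w [letter (A us vs ws)]"
    using L by (simp add: A0 prep_word letter_closed A)
  finally show "A us vs ws = eps (A us vs ws) \<odot>\<^bsub>T\<^esub> w [] \<oplus>\<^bsub>T\<^esub> (w [letter (A us vs ws)] \<oplus>\<^bsub>T\<^esub> remainder A us vs ws)"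
    using decomposition[OF A[OF L]] by simp
qed

text \<open>
  Applying the decomposition to the coproducts of the two bracketings, every summand but the one
  with the full words on the left involves only shorter words.
\<close>

lemma products_step:
  assumes L: "us \<in> L" "vs \<in> L" "ws \<in> L"
    and IH: "\<And>us' vs' ws'. us' \<in> L \<Longrightarrow> vs' \<in> L \<Longrightarrow> ws' \<in> L \<Longrightarrow>
      length us' + length vs' + length ws' < length us + length vs + length ws \<Longrightarrow>
      lprod us' vs' ws' = rprod us' vs' ws'"
  shows "\<exists>z\<in>carrier T. lprod us vs ws = w [letter (lprod us vs ws)] \<oplus>\<^bsub>T\<^esub> z \<and>
    rprod us vs ws = w [letter (rprod us vs ws)] \<oplus>\<^bsub>T\<^esub> z"
proof -
  have r: "remainder lprod us vs ws = remainder rprod us vs ws"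
    unfolding remainder_def
  proof (intro split_sum_cong if_cong HOL.refl)
    fix a a' b b' c c' assume s: "a @ a' = us" "b @ b' = vs" "c @ c' = ws"
      and n: "\<not> (a' = [] \<and> b' = [] \<and> c' = [])"
    have l: "a \<in> L" "a' \<in> L" "b \<in> L" "b' \<in> L" "c \<in> L" "c' \<in> L" using L s by auto
    show "prep (letter (lprod a b c)) (lprod a' b' c') = prep (letter (rprod a b c)) (rprod a' b' c')"
    \<comment> \<open>With empty left parts the right parts are the full words, for which no
      equality is known yet; but then the left factor is the unit, whose letter component is
      zero.\<close>
    proof (cases "a = [] \<and> b = [] \<and> c = []")
      case True
      then show ?thesis
        using l by (simp add: lprod_units rprod_units star_Nil_left letter_word prep_zero_left
          lprod_closed rprod_closed)
    next
      case False
      have "lprod a b c = rprod a b c" by (rule IH) (use l s n in auto)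
      moreover have "lprod a' b' c' = rprod a' b' c'" by (rule IH) (use l s False in auto)
      ultimately show ?thesis by simp
    qed
  qed
  let ?e = "if us = [] \<and> vs = [] \<and> ws = [] then \<one>\<^bsub>K\<^esub> else \<zero>\<^bsub>K\<^esub>"
  have e: "eps (lprod us vs ws) = ?e" "eps (rprod us vs ws) = ?e"
    using L by (simp_all add: lprod_def rprod_def eps_mul star_closed w_closed eps_star eps_word)
  note l = triple_split[of lprod, OF lprod_closed _ L Delta_lprod[OF L]]
  note r' = triple_split[of rprod, OF rprod_closed _ L Delta_rprod[OF L]]
  have 0: "lprod [] [] [] = w []" "rprod [] [] [] = w []"
    by (simp_all add: lprod_units rprod_units star_Nil_left)
  let ?z = "?e \<odot>\<^bsub>T\<^esub> w [] \<oplus>\<^bsub>T\<^esub> remainder lprod us vs ws"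
  have c: "remainder lprod us vs ws \<in> carrier T" "?e \<odot>\<^bsub>T\<^esub> w [] \<in> carrier T"
    "w [letter (lprod us vs ws)] \<in> carrier T" "w [letter (rprod us vs ws)] \<in> carrier T"
    using l(2)[OF _ _ _ 0(1)] L by (simp_all add: one_closed w_closed letter_closed lprod_closed rprod_closed)
  show ?thesis
  proof (intro bexI[of _ ?z] conjI)
    show "?z \<in> carrier T" using c by simp
    show "lprod us vs ws = w [letter (lprod us vs ws)] \<oplus>\<^bsub>T\<^esub> ?z"
      using l(1)[OF _ _ _ 0(1)] L c unfolding e by (simp add: Tm.M.add.m_lcomm)
    show "rprod us vs ws = w [letter (rprod us vs ws)] \<oplus>\<^bsub>T\<^esub> ?z"
      using r'(1)[OF _ _ _ 0(2)] L c unfolding e r[symmetric] by (simp add: Tm.M.add.m_lcomm)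
  qed
qed

lemma linear_map_lsum_star:
  assumes f: "linear_map K T W f" and W: "module K W" and uv: "us \<in> L" "vs \<in> L"
  shows "f (star us vs) = lsum W (concat (map (\<lambda>k. map (\<lambda>ij. f (w (brace_blocks M ij us vs)))
    (tuple_pairs k (length us) (length vs))) [0..<Suc (length us + length vs)]))"
proof -
  have "set (concat (map (\<lambda>k. map (\<lambda>ij. w (brace_blocks M ij us vs))
    (tuple_pairs k (length us) (length vs))) [0..<Suc (length us + length vs)])) \<subseteq> carrier T"
    using w_closed blocks_closed[OF uv] by (auto simp del: upt_Suc)
  from linear_map_lsum[OF f mT W this] show ?thesis
    by (simp add: word_star_def map_concat o_def del: upt_Suc)
qed

text \<open>\<open>binf_left\<close> and \<open>binf_right\<close> sum from one block on,
  \<open>word_star\<close> from zero; a summand without blocks occurs only for two empty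
  words.\<close>

lemma drop_k0:
  assumes "us \<noteq> [] \<or> vs \<noteq> []"
  shows "concat (map (\<lambda>k. map f (tuple_pairs k (length us) (length vs))) [0..<Suc (length us + length vs)]) =
    concat (map (\<lambda>k. map f (tuple_pairs k (length us) (length vs))) [1..<Suc (length us + length vs)])"
proof -
  have "[0..<Suc (length us + length vs)] = 0 # [1..<Suc (length us + length vs)]"
    by (simp add: upt_conv_Cons del: upt_Suc)
  then show ?thesis using assms by (simp add: tuple_pairs_0 del: upt_Suc)
qed

text \<open>The inner product is expanded into words of blocks. By \<open>letter_star\<close> the
  letter component of each of these times \<open>ws\<close> is a brace, and the resulting sum is the
  left side of the B-infinity relation.\<close>

lemma letter_lprod:
  assumes L: "us \<in> L" "vs \<in> L" "ws \<in> L" and n: "us \<noteq> [] \<or> vs \<noteq> []"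
  shows "letter (lprod us vs ws) = binf_left R us vs ws"
proof -
  have lin: "linear_map K T R (\<lambda>X. letter (mul X (w ws)))"
    by (rule linear_map_comp[OF bilinear_left[OF mul_bilinear w_closed[OF L(3)]] letter_linear])
  have "letter (mul (w (brace_blocks M ij us vs)) (w ws)) = M (brace_blocks M ij us vs) ws"
    if "ij \<in> set (tuple_pairs k (length us) (length vs))" for ij k
    using blocks_closed[OF L(1,2) that] L(3) by (simp add: mul_word letter_star)
  then show ?thesis
    unfolding lprod_def linear_map_lsum_star[OF lin mR L(1,2)] drop_k0[OF n] binf_left_def
    by (intro arg_cong[where f = "lsum R"] arg_cong[where f = concat] map_cong) auto
qed

lemma letter_rprod:
  assumes L: "us \<in> L" "vs \<in> L" "ws \<in> L" and n: "vs \<noteq> [] \<or> ws \<noteq> []"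
  shows "letter (rprod us vs ws) = binf_right R us vs ws"
proof -
  have lin: "linear_map K T R (\<lambda>X. letter (mul (w us) X))"
    by (rule linear_map_comp[OF bilinear_right[OF mul_bilinear w_closed[OF L(1)]] letter_linear])
  have "letter (mul (w us) (w (brace_blocks M ij vs ws))) = M us (brace_blocks M ij vs ws)"
    if "ij \<in> set (tuple_pairs k (length vs) (length ws))" for ij k
    using blocks_closed[OF L(2,3) that] L(1) by (simp add: mul_word letter_star)
  then show ?thesis
    unfolding rprod_def linear_map_lsum_star[OF lin mR L(2,3)] drop_k0[OF n] binf_right_def
    by (intro arg_cong[where f = "lsum R"] arg_cong[where f = concat] map_cong) auto
qed

lemma products_eq_units:
  "us \<in> L \<Longrightarrow> vs \<in> L \<Longrightarrow> ws \<in> L \<Longrightarrow> us = [] \<or> vs = [] \<or> ws = [] \<Longrightarrow> lprod us vs ws = rprod us vs ws"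
  by (auto simp: lprod_units rprod_units)

text \<open>Once shorter triples agree, the bracketings can differ only in their letters, which are
  the two sides of the relation. Triples with an empty word are settled by the unit laws, since the
  relation speaks of nonempty words only.\<close>

lemma products_eq:
  assumes rel: "\<And>us vs ws. us \<in> L \<Longrightarrow> vs \<in> L \<Longrightarrow> ws \<in> L \<Longrightarrow> us \<noteq> [] \<Longrightarrow> vs \<noteq> [] \<Longrightarrow> ws \<noteq> [] \<Longrightarrow>
      binf_left R us vs ws = binf_right R us vs ws"
  shows "us \<in> L \<Longrightarrow> vs \<in> L \<Longrightarrow> ws \<in> L \<Longrightarrow> lprod us vs ws = rprod us vs ws"
proof (induction "length us + length vs + length ws" arbitrary: us vs ws rule: less_induct)
  case less
  have IH: "lprod us' vs' ws' = rprod us' vs' ws'"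
    if "us' \<in> L" "vs' \<in> L" "ws' \<in> L"
      "length us' + length vs' + length ws' < length us + length vs + length ws" for us' vs' ws'
    using less.hyps that by blast
  have ex: "\<exists>z\<in>carrier T. lprod us vs ws = w [letter (lprod us vs ws)] \<oplus>\<^bsub>T\<^esub> z \<and>
      rprod us vs ws = w [letter (rprod us vs ws)] \<oplus>\<^bsub>T\<^esub> z"
    by (rule products_step[OF less.prems]) (rule IH)
  show ?case
  proof (cases "us = [] \<or> vs = [] \<or> ws = []")
    case False
    obtain z where "lprod us vs ws = w [letter (lprod us vs ws)] \<oplus>\<^bsub>T\<^esub> z"
      "rprod us vs ws = w [letter (rprod us vs ws)] \<oplus>\<^bsub>T\<^esub> z"
      using ex by blast
    moreover have "letter (lprod us vs ws) = letter (rprod us vs ws)"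
      using False less.prems rel by (simp add: letter_lprod letter_rprod)
    ultimately show ?thesis by simp
  qed (use products_eq_units less.prems in blast)
qed

text \<open>Here the agreement of the letters is a conclusion. Both bracketings are a one-letter
  word plus the same \<open>z\<close>; applying \<open>g\<close> and cancelling \<open>g z\<close>
  equates the letters.\<close>

lemma products_eq_from_retraction:
  assumes g: "linear_map K T R g" "\<And>r. r \<in> C \<Longrightarrow> g (w [r]) = r"
    and eq: "\<And>us vs ws. us \<in> L \<Longrightarrow> vs \<in> L \<Longrightarrow> ws \<in> L \<Longrightarrow> g (lprod us vs ws) = g (rprod us vs ws)"
  shows "us \<in> L \<Longrightarrow> vs \<in> L \<Longrightarrow> ws \<in> L \<Longrightarrow> lprod us vs ws = rprod us vs ws"
proof (induction "length us + length vs + length ws" arbitrary: us vs ws rule: less_induct)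
  case less
  have IH: "lprod us' vs' ws' = rprod us' vs' ws'"
    if "us' \<in> L" "vs' \<in> L" "ws' \<in> L"
      "length us' + length vs' + length ws' < length us + length vs + length ws" for us' vs' ws'
    using less.hyps that by blast
  have ex: "\<exists>z\<in>carrier T. lprod us vs ws = w [letter (lprod us vs ws)] \<oplus>\<^bsub>T\<^esub> z \<and>
      rprod us vs ws = w [letter (rprod us vs ws)] \<oplus>\<^bsub>T\<^esub> z"
    by (rule products_step[OF less.prems]) (rule IH)
  obtain z where z: "z \<in> carrier T" "lprod us vs ws = w [letter (lprod us vs ws)] \<oplus>\<^bsub>T\<^esub> z"
    "rprod us vs ws = w [letter (rprod us vs ws)] \<oplus>\<^bsub>T\<^esub> z"
    using ex by blast
  have c: "letter (lprod us vs ws) \<in> C" "letter (rprod us vs ws) \<in> C"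
    using less.prems by (simp_all add: letter_closed lprod_closed rprod_closed)
  have "g (w [r] \<oplus>\<^bsub>T\<^esub> z) = r \<oplus>\<^bsub>R\<^esub> g z" if "r \<in> C" for r
    using linear_map_add[OF g(1), of "w [r]" z] g(2) that z(1) by (simp add: w_closed)
  then have "letter (lprod us vs ws) \<oplus>\<^bsub>R\<^esub> g z = letter (rprod us vs ws) \<oplus>\<^bsub>R\<^esub> g z"
    using eq[OF less.prems] z(2,3) c by metis
  then have "letter (lprod us vs ws) = letter (rprod us vs ws)"
    using c linear_map_closed[OF g(1) z(1)] by simp
  with z show ?case by simp
qed

end

section \<open>The second product as the multiplication of a record\<close>

lemma dot_alg_simps [simp]:
  "carrier (dot_alg A) = carrier A" "mult (dot_alg A) = dot A" "one (dot_alg A) = one A"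
  "zero (dot_alg A) = zero A" "add (dot_alg A) = add A" "smult (dot_alg A) = smult A"
  "dot (dot_alg A) = dot A"
  by (simp_all add: dot_alg_def)

lemma comult_dot_alg [simp]: "comult (dot_alg A) = comult A"
  by (simp add: dot_alg_def)

lemma dot_alg_struct [simp]:
  "tensor K (dot_alg A) B = tensor K A B" "tensor K B (dot_alg A) = tensor K B A"
  "ptens K (dot_alg A) B = ptens K A B" "ptens K B (dot_alg A) = ptens K B A"
  by (rule tensor_struct_cong; simp)+

lemma linear_map_dot_alg [simp]:
  "linear_map K (dot_alg A) = linear_map K A" "linear_map K B (dot_alg A) = linear_map K B A"
  by (auto simp: linear_map_def fun_eq_iff)

lemma bilinear_dot_alg [simp]:
  "bilinear K (dot_alg A) (dot_alg A) (dot_alg A) = bilinear K A A A"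
  by (simp add: bilinear_def fun_eq_iff)

lemma module_dot_alg: "module K A \<Longrightarrow> module K (dot_alg A)"
  by (erule module_cong) simp_all

lemma coassociative_dot_alg [simp]: "coassociative K (dot_alg A) \<longleftrightarrow> coassociative K A"
  by (simp add: coassociative_def tensor_assoc_def map_tensor_def)

lemma counit_dot_alg [simp]: "counit K (dot_alg A) e \<longleftrightarrow> counit K A e"
  by (simp add: counit_def lin_lift_struct_cong[of "dot_alg A" A])

text \<open>The index set of the sum subtracted in the recursion of \<open>two_as_brace\<close>, as
  a single list.\<close>

definition long_pairs where
  "long_pairs p q = concat (map (\<lambda>k. reduced_pairs k p q) [2..<Suc (p + q)])"

lemma long_pairsD:
  assumes "(a, b) \<in> set (long_pairs p q)"
  shows "length a = length b" "sum_list a = p" "sum_list b = q"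
    "\<And>i j. (i, j) \<in> set (zip a b) \<Longrightarrow> i + j < p + q"
proof -
  from assms have *: "2 \<le> length a" "length a = length b" "sum_list a = p" "sum_list b = q"
    "(0, 0) \<notin> set (zip a b)"
    by (auto simp: long_pairs_def reduced_pairs_def in_set_tuple_pairs)
  then show "length a = length b" "sum_list a = p" "sum_list b = q" by auto
  show "i + j < p + q" if "(i, j) \<in> set (zip a b)" for i j
    using reduced_column_bound(2)[OF *(2,5) that] * by simp
qed

lemma long_pairs_decrease:
  assumes "ab \<in> set (long_pairs p q)" "(x, y) \<in> set (zip (blocks (fst ab) us) (blocks (snd ab) vs))"
  shows "length x + length y < p + q"
proof -
  from assms(1) obtain k where "2 \<le> k" "ab \<in> set (reduced_pairs k p q)"
    by (auto simp: long_pairs_def)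
  then show ?thesis using reduced_pairs_decrease assms(2) by blast
qed

context pre_binf
begin

text \<open>For nonempty words there is no pair without columns, the only pair with one column gives
  \<open>M us vs\<close>, and pairs with a column \<open>(0, 0)\<close> contribute zero. This
  matches the full sums in the product of words with the reduced sums in
  \<open>two_as_brace\<close>.\<close>

lemma block_sum_split:
  assumes h: "multilinear K R W h" and W: "module K W" and uv: "us \<in> L" "vs \<in> L" "us \<noteq> []" "vs \<noteq> []"
  shows "lsum W (concat (map (\<lambda>k. map (\<lambda>ij. h (brace_blocks M ij us vs))
      (tuple_pairs k (length us) (length vs))) [0..<Suc (length us + length vs)])) =
    h [M us vs] \<oplus>\<^bsub>W\<^esub> lsum W (map (\<lambda>ij. h (brace_blocks M ij us vs)) (long_pairs (length us) (length vs)))"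
proof -
  interpret W: module K W by fact
  let ?p = "length us" and ?q = "length vs"
  let ?f = "\<lambda>ij. h (brace_blocks M ij us vs)"
  let ?ts = "concat (map (\<lambda>k. tuple_pairs k ?p ?q) [2..<Suc (?p + ?q)])"
  have "0 < ?p" "0 < ?q" using uv by auto
  then have k: "[0..<Suc (?p + ?q)] = 0 # 1 # [2..<Suc (?p + ?q)]"
    by (simp add: upt_conv_Cons numeral_2_eq_2 del: upt_Suc)
  have c: "?f ij \<in> carrier W" if ij: "ij \<in> set ?ts" for ij
  proof -
    obtain k where "ij \<in> set (tuple_pairs k ?p ?q)" using ij by (auto simp del: upt_Suc)
    then show ?thesis by (rule multilinear_closed[OF h blocks_closed[OF uv(1,2)]])
  qed
  have "long_pairs ?p ?q = filter (\<lambda>(a, b). (0, 0) \<notin> set (zip a b)) ?ts"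
    by (simp add: long_pairs_def reduced_pairs_def filter_concat o_def del: upt_Suc)
  moreover have "lsum W (map ?f (filter (\<lambda>(a, b). (0, 0) \<notin> set (zip a b)) ?ts)) = lsum W (map ?f ?ts)"
  proof (rule W.M.lsum_filter)
    fix ij assume ij: "ij \<in> set ?ts" "\<not> (case ij of (a, b) \<Rightarrow> (0, 0) \<notin> set (zip a b))"
    obtain a b where ab: "ij = (a, b)" by fastforce
    have "M [] [] \<in> set (brace_blocks M (a, b) us vs)"
      using ij by (intro brace_blocks_zero_column) (auto simp: ab in_set_tuple_pairs simp del: upt_Suc)
    then show "?f ij = \<zero>\<^bsub>W\<^esub>"
      using ij blocks_closed[OF uv(1,2)]
      by (intro multilinear_zero[OF h mR W]) (auto simp: ab brace_00 simp del: upt_Suc)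
  qed (rule c)
  moreover have "lsum W (concat (map (\<lambda>k. map ?f (tuple_pairs k ?p ?q)) [0..<Suc (?p + ?q)])) =
      h [M us vs] \<oplus>\<^bsub>W\<^esub> lsum W (map ?f ?ts)"
    unfolding k using uv
    by (simp add: tuple_pairs_0 tuple_pairs_1 brace_blocks_Cons brace_blocks_Nil map_concat o_def del: upt_Suc)
  ultimately show ?thesis by simp
qed

lemma star_split:
  assumes "us \<in> L" "vs \<in> L" "us \<noteq> []" "vs \<noteq> []"
  shows "star us vs = w [M us vs] \<oplus>\<^bsub>T\<^esub>
    lsum T (map (\<lambda>ij. w (brace_blocks M ij us vs)) (long_pairs (length us) (length vs)))"
  unfolding word_star_def by (rule block_sum_split[OF w_multilinear mT assms])

end

section \<open>The algebra of braces of a 2-associative algebra\<close>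

locale two_as_alg =
  fixes K :: "('k, 'x) ring_scheme" and A :: "('k, 'a, 'y) two_as_scheme"
  assumes two_as: "two_as_algebra K A"
begin

lemma star_algebra: "assoc_algebra K A" and dot_algebra: "assoc_algebra K (dot_alg A)"
  using two_as by (simp_all add: two_as_algebra_def)

lemmas mA = assoc_algebra_module[OF star_algebra]
lemmas star_bilinear = assoc_algebra_bilinear[OF star_algebra]
lemmas dot_bilinear = assoc_algebra_bilinear[OF dot_algebra, simplified]

end

sublocale two_as_alg \<subseteq> As: ring A by (rule assoc_algebra_ring[OF star_algebra])
sublocale two_as_alg \<subseteq> Am: module K A by (rule mA)

context two_as_alg
begin

lemma dot_ring: "ring (dot_alg A)" by (rule assoc_algebra_ring[OF dot_algebra])

lemma dot_closed: "x \<in> carrier A \<Longrightarrow> y \<in> carrier A \<Longrightarrow> dot A x y \<in> carrier A"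
  by (rule bilinear_closed[OF dot_bilinear])

lemma dot_assoc:
  "x \<in> carrier A \<Longrightarrow> y \<in> carrier A \<Longrightarrow> z \<in> carrier A \<Longrightarrow> dot A (dot A x y) z = dot A x (dot A y z)"
  using monoid.m_assoc[OF ring.is_monoid[OF dot_ring], of x y z] by simp

lemma dot_one: "x \<in> carrier A \<Longrightarrow> dot A \<one>\<^bsub>A\<^esub> x = x" "x \<in> carrier A \<Longrightarrow> dot A x \<one>\<^bsub>A\<^esub> = x"
  using monoid.l_one[OF ring.is_monoid[OF dot_ring], of x] monoid.r_one[OF ring.is_monoid[OF dot_ring], of x]
  by simp_all

lemma dots_simps: "dots A [] = \<one>\<^bsub>A\<^esub>" "dots A (u # us) = dot A u (dots A us)"
  by (simp_all add: dots_def)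

lemma dots_closed: "us \<in> lists (carrier A) \<Longrightarrow> dots A us \<in> carrier A"
  by (induction us rule: list.induct) (simp_all add: dots_simps dot_closed)

lemma dots_append: "us \<in> lists (carrier A) \<Longrightarrow> vs \<in> lists (carrier A) \<Longrightarrow>
    dots A (us @ vs) = dot A (dots A us) (dots A vs)"
  by (induction us rule: list.induct) (simp_all add: dots_simps dot_one dots_closed dot_assoc)

lemma dots_multilinear: "multilinear K A A (dots A)"
proof (rule multilinearI)
  fix us vs assume uv: "us \<in> lists (carrier A)" "vs \<in> lists (carrier A)"
  have "linear_map K A A (\<lambda>x. dot A (dots A us) (dot A x (dots A vs)))"
    using uv by (intro linear_map_comp[OF bilinear_left[OF dot_bilinear] bilinear_right[OF dot_bilinear]] dots_closed)
  then show "linear_map K A A (\<lambda>x. dots A (us @ x # vs))"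
    by (rule linear_map_cong[OF _ _ mA]) (use uv in \<open>simp add: dots_append dots_simps\<close>)
qed (rule dots_closed)

lemma two_as_brace_rec:
  assumes "us \<noteq> []" "vs \<noteq> []"
  shows "two_as_brace A us vs = (dots A us \<otimes>\<^bsub>A\<^esub> dots A vs) \<ominus>\<^bsub>A\<^esub>
    lsum A (map (\<lambda>ab. dots A (brace_blocks (two_as_brace A) ab us vs)) (long_pairs (length us) (length vs)))"
  using assms by (subst two_as_brace.simps) (simp add: long_pairs_def map_concat o_def del: upt_Suc)

lemma two_as_brace_Nil:
  "two_as_brace A [] [] = \<zero>\<^bsub>A\<^esub>" "two_as_brace A [u] [] = u" "two_as_brace A [] [u] = u"
  "2 \<le> length us \<Longrightarrow> two_as_brace A us [] = \<zero>\<^bsub>A\<^esub>" "2 \<le> length us \<Longrightarrow> two_as_brace A [] us = \<zero>\<^bsub>A\<^esub>"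
  by (auto simp: two_as_brace.simps)

text \<open>
  Inside an induction on the length the brace is known to be closed and linear only on shorter
  words; truncation makes it total, as the lemmas on blocks require.
\<close>

abbreviation (input) "truncated n us vs \<equiv> (if length us + length vs < n then two_as_brace A us vs else \<zero>\<^bsub>A\<^esub>)"

lemma truncated_blocks:
  assumes "ab \<in> set (long_pairs (length us) (length vs))"
  shows "brace_blocks (two_as_brace A) ab us vs =
    brace_blocks (\<lambda>us' vs'. truncated (length us + length vs) us' vs') ab us vs"
  using long_pairs_decrease[OF assms] by (intro brace_blocks_cong) auto

lemma two_as_brace_closed:
  "us \<in> lists (carrier A) \<Longrightarrow> vs \<in> lists (carrier A) \<Longrightarrow> two_as_brace A us vs \<in> carrier A"
proof (induction "length us + length vs" arbitrary: us vs rule: less_induct)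
  case less
  show ?case
  proof (cases "us = [] \<or> vs = []")
    case True
    then show ?thesis using less.prems by (cases "us @ vs") (auto simp: two_as_brace.simps)
  next
    case False
    have "dots A (brace_blocks (two_as_brace A) ab us vs) \<in> carrier A"
      if "ab \<in> set (long_pairs (length us) (length vs))" for ab
    proof -
      obtain a b where ab: "ab = (a, b)" by fastforce
      have "brace_blocks (\<lambda>us' vs'. truncated (length us + length vs) us' vs') (a, b) us vs \<in> lists (carrier A)"
        by (rule brace_blocks_closed[where C = "carrier A"])
          (use less long_pairsD(1) that ab in auto)
      then show ?thesis using truncated_blocks[OF that] dots_closed by (simp add: ab)
    qed
    then show ?thesis using False less.prems by (simp add: two_as_brace_rec dots_closed As.lsum_map_closed)
  qed
qed

text \<open>The leading term of the recursion is multilinear because both products are. The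
  subtracted sum involves only blocks of total length below \<open>?N\<close>, so the induction
  hypothesis applies to the truncated brace and \<open>brace_blocks_linear\<close> gives the
  rest.\<close>

lemma two_as_brace_linear:
  assumes "a \<in> lists (carrier A)" "b \<in> lists (carrier A)" "vs \<in> lists (carrier A)"
  shows "linear_map K A A (\<lambda>x. two_as_brace A (a @ x # b) vs) \<and>
    linear_map K A A (\<lambda>x. two_as_brace A vs (a @ x # b))"
  using assms
proof (induction "Suc (length a + length b) + length vs" arbitrary: a b vs rule: less_induct)
  case less
  note ab = less.prems(1,2)
  let ?N = "Suc (length a + length b) + length vs"
  show ?case
  proof (cases "vs = []")
    case True
    show ?thesis
    proof (cases "a = [] \<and> b = []")
      case True
      with \<open>vs = []\<close> show ?thesis by (simp add: two_as_brace_Nil linear_map_id)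
    next
      case False
      then have "two_as_brace A (a @ x # b) vs = \<zero>\<^bsub>A\<^esub>" "two_as_brace A vs (a @ x # b) = \<zero>\<^bsub>A\<^esub>" for x
        using \<open>vs = []\<close> by (cases a; cases b; simp add: two_as_brace_Nil)+
      then show ?thesis by (simp add: linear_map_const_zero mA)
    qed
  next
    case False
    let ?M = "\<lambda>us' vs'. truncated ?N us' vs'"
    have len: "length (a @ x # b) + length vs = ?N" "length vs + length (a @ x # b) = ?N" for x by simp_all
    have Mc: "?M us' vs' \<in> carrier A" if "us' \<in> lists (carrier A)" "vs' \<in> lists (carrier A)" for us' vs'
      using that by (simp add: two_as_brace_closed)
    have Ml: "linear_map K A A (\<lambda>x. ?M (a' @ x # b') vs')" "linear_map K A A (\<lambda>x. ?M vs' (a' @ x # b'))"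
      if "a' \<in> lists (carrier A)" "b' \<in> lists (carrier A)" "vs' \<in> lists (carrier A)"
        "Suc (length a' + length b') + length vs' < ?N" for a' b' vs'
      using less.hyps[of a' b' vs'] that by (simp_all add: add.commute)
    have l1: "linear_map K A A (\<lambda>x. dots A (brace_blocks (two_as_brace A) ij (a @ x # b) vs))"
      if ij: "ij \<in> set (long_pairs (Suc (length a + length b)) (length vs))" for ij
    proof -
      obtain \<alpha> \<beta> where e: "ij = (\<alpha>, \<beta>)" by fastforce
      note p = long_pairsD[OF ij[unfolded e]]
      have "linear_map K A A (\<lambda>x. dots A (brace_blocks ?M ij (a @ x # b) vs))"
        unfolding e
        by (rule brace_blocks_linear[OF _ dots_multilinear, where N = ?N])
          (use p less.prems Mc Ml in auto)
      moreover have "brace_blocks (two_as_brace A) ij (a @ x # b) vs = brace_blocks ?M ij (a @ x # b) vs" for x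
        using truncated_blocks[of ij "a @ x # b" vs, unfolded len(1)] ij by simp
      ultimately show ?thesis by simp
    qed
    have l2: "linear_map K A A (\<lambda>x. dots A (brace_blocks (two_as_brace A) ij vs (a @ x # b)))"
      if ij: "ij \<in> set (long_pairs (length vs) (Suc (length a + length b)))" for ij
    proof -
      obtain \<alpha> \<beta> where e: "ij = (\<alpha>, \<beta>)" by fastforce
      note p = long_pairsD[OF ij[unfolded e]]
      \<comment> \<open>Exchanging the two words exchanges the entries of each column and preserves
        its sum.\<close>
      have z: "i + j < ?N" if "(i, j) \<in> set (zip \<beta> \<alpha>)" for i j
        using p(4)[of j i] that by (auto simp: zip_map_swap[of \<beta> \<alpha>])
      have "linear_map K A A (\<lambda>x. dots A (brace_blocks ?M ij vs (a @ x # b)))"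
        unfolding e brace_blocks_flip[of ?M \<alpha>]
        by (rule brace_blocks_linear[OF _ dots_multilinear, where N = ?N])
          (use p z less.prems Mc Ml in auto)
      moreover have "brace_blocks (two_as_brace A) ij vs (a @ x # b) = brace_blocks ?M ij vs (a @ x # b)" for x
        using truncated_blocks[of ij vs "a @ x # b", unfolded len(2)] ij by simp
      ultimately show ?thesis by simp
    qed
    have "linear_map K A A (\<lambda>x. (dots A (a @ x # b) \<otimes>\<^bsub>A\<^esub> dots A vs) \<ominus>\<^bsub>A\<^esub>
      lsum A (map (\<lambda>ij. dots A (brace_blocks (two_as_brace A) ij (a @ x # b) vs))
        (long_pairs (Suc (length a + length b)) (length vs))))"
      by (intro linear_map_minus_fun linear_map_lsum_fun l1 mA
        linear_map_comp[OF multilinear_linear[OF dots_multilinear ab] bilinear_left[OF star_bilinear]]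
        dots_closed less.prems)
    moreover have "linear_map K A A (\<lambda>x. (dots A vs \<otimes>\<^bsub>A\<^esub> dots A (a @ x # b)) \<ominus>\<^bsub>A\<^esub>
      lsum A (map (\<lambda>ij. dots A (brace_blocks (two_as_brace A) ij vs (a @ x # b)))
        (long_pairs (length vs) (Suc (length a + length b)))))"
      by (intro linear_map_minus_fun linear_map_lsum_fun l2 mA
        linear_map_comp[OF multilinear_linear[OF dots_multilinear ab] bilinear_right[OF star_bilinear]]
        dots_closed less.prems)
    ultimately show ?thesis using False by (simp add: two_as_brace_rec)
  qed
qed

abbreviation "Br \<equiv> binf_of_two_as A"

lemma Br_simps: "carrier Br = carrier A" "mult Br = mult A" "one Br = one A" "zero Br = zero A"
  "add Br = add A" "smult Br = smult A" "brace Br = two_as_brace A"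
  by (simp_all add: binf_of_two_as_def)

lemma linear_map_Br: "linear_map K Br = linear_map K A" "linear_map K B Br = linear_map K B A"
  by (auto simp: linear_map_def Br_simps fun_eq_iff)

lemma multilinear_Br: "multilinear K Br = multilinear K A" "multilinear K B Br = multilinear K B A"
  by (auto simp: multilinear_def linear_map_Br Br_simps fun_eq_iff)

text \<open>This makes the product and the coproduct of words over \<open>A\<close> available; the
  B-infinity relation is deduced from them afterwards.\<close>

lemma pre_binf_Br: "pre_binf K Br"
proof (rule pre_binf.intro)
  show "module K Br" by (rule module_cong[OF mA]) (simp_all add: Br_simps)
  show "multilinear K Br Br (\<lambda>us. brace Br us vs)" if "vs \<in> lists (carrier Br)" for vs
    using that two_as_brace_linear two_as_brace_closed
    by (auto simp: multilinear_Br Br_simps intro!: multilinearI)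
  show "multilinear K Br Br (brace Br us)" if "us \<in> lists (carrier Br)" for us
    using that two_as_brace_linear two_as_brace_closed
    by (auto simp: multilinear_Br Br_simps intro!: multilinearI)
qed (simp_all add: Br_simps two_as_brace_Nil)

end

sublocale two_as_alg \<subseteq> W: pre_binf K "binf_of_two_as A" by (rule pre_binf_Br)

context two_as_alg
begin

definition ev where "ev = lin_lift A (dots A)"

lemma dots_multilinear': "multilinear K Br A (dots A)"
  using dots_multilinear by (simp add: multilinear_Br)

lemma ev_linear: "linear_map K W.T A ev"
  unfolding ev_def by (rule words_lift_linear[OF dots_multilinear' W.mR mA])

lemma ev_word: "us \<in> lists (carrier A) \<Longrightarrow> ev (W.w us) = dots A us"
  unfolding ev_def using words_lift_word[OF dots_multilinear' W.mR mA] by (simp add: Br_simps)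

text \<open>The recursion of \<open>two_as_brace\<close> is this equation solved for the summand
  with a single block, which \<open>star_split\<close> isolates.\<close>

lemma ev_star:
  assumes uv: "us \<in> lists (carrier A)" "vs \<in> lists (carrier A)"
  shows "ev (W.star us vs) = dots A us \<otimes>\<^bsub>A\<^esub> dots A vs"
proof (cases "us = [] \<or> vs = []")
  case True
  then show ?thesis using uv
    by (auto simp: W.star_Nil_left W.star_Nil_right Br_simps ev_word dots_simps dots_closed)
next
  case False
  have L: "us \<in> W.L" "vs \<in> W.L" using uv by (simp_all add: Br_simps)
  have "ev (W.star us vs) = ev (W.w [two_as_brace A us vs]) \<oplus>\<^bsub>A\<^esub>
      lsum A (map (\<lambda>ij. dots A (brace_blocks (two_as_brace A) ij us vs)) (long_pairs (length us) (length vs)))"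
  proof -
    have b: "brace_blocks (two_as_brace A) ij us vs \<in> lists (carrier A)"
      if "ij \<in> set (long_pairs (length us) (length vs))" for ij
      using that uv two_as_brace_closed
      by (cases ij rule: prod.exhaust) (auto intro!: brace_blocks_closed[where C = "carrier A"] dest: long_pairsD(1))
    have c: "W.w (brace_blocks (two_as_brace A) ij us vs) \<in> carrier W.T"
      if "ij \<in> set (long_pairs (length us) (length vs))" for ij
      using b[OF that] by (intro W.w_closed) (simp add: Br_simps)
    then have c': "set (map (\<lambda>ij. W.w (brace_blocks (two_as_brace A) ij us vs)) (long_pairs (length us) (length vs))) \<subseteq> carrier W.T"
      by auto
    have "W.star us vs = W.w [two_as_brace A us vs] \<oplus>\<^bsub>W.T\<^esub>
        lsum W.T (map (\<lambda>ij. W.w (brace_blocks (two_as_brace A) ij us vs)) (long_pairs (length us) (length vs)))"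
      using W.star_split[OF L] False by (simp add: Br_simps)
    then show ?thesis
      using linear_map_add[OF ev_linear, of "W.w [two_as_brace A us vs]"] linear_map_lsum[OF ev_linear W.mT mA c']
        W.Tm.M.lsum_closed[OF c'] uv b
      by (simp add: W.w_closed Br_simps two_as_brace_closed o_def ev_word cong: map_cong)
  qed
  also have "\<dots> = two_as_brace A us vs \<oplus>\<^bsub>A\<^esub>
      lsum A (map (\<lambda>ij. dots A (brace_blocks (two_as_brace A) ij us vs)) (long_pairs (length us) (length vs)))"
    using uv by (simp add: ev_word two_as_brace_closed dots_simps dot_one)
  also have "\<dots> = dots A us \<otimes>\<^bsub>A\<^esub> dots A vs"
  proof -
    have "dots A (brace_blocks (two_as_brace A) ij us vs) \<in> carrier A"
      if "ij \<in> set (long_pairs (length us) (length vs))" for ij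
      using that uv two_as_brace_closed
      by (cases ij rule: prod.exhaust) (auto intro!: dots_closed brace_blocks_closed[where C = "carrier A"] dest: long_pairsD(1))
    then show ?thesis
      using False uv by (simp add: two_as_brace_rec dots_closed a_minus_def As.a_assoc As.l_neg As.lsum_map_closed)
  qed
  finally show ?thesis .
qed

lemma ev_mul:
  assumes "X \<in> carrier W.T" "Y \<in> carrier W.T"
  shows "ev (W.mul X Y) = ev X \<otimes>\<^bsub>A\<^esub> ev Y"
  by (rule W.bilinear_words_ext[OF bilinear_comp[OF W.mul_bilinear ev_linear]
      bilinear_comp_args[OF star_bilinear ev_linear ev_linear] mA assms])
    (simp add: W.mul_word Br_simps ev_star ev_word)

text \<open>\<open>ev\<close> is a retraction of the required kind: it sends a one-letter word to
  its letter, and it maps both bracketings to the same element because \<open>*\<close> is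
  associative in \<open>A\<close>.\<close>

lemma brace_products_eq:
  assumes "us \<in> lists (carrier A)" "vs \<in> lists (carrier A)" "ws \<in> lists (carrier A)"
  shows "W.lprod us vs ws = W.rprod us vs ws"
proof (rule W.products_eq_from_retraction)
  show "linear_map K W.T Br ev" using ev_linear by (simp add: linear_map_Br)
  show "ev (W.w [r]) = r" if "r \<in> carrier Br" for r
    using that by (simp add: Br_simps ev_word dots_simps dot_one)
  show "ev (W.lprod us vs ws) = ev (W.rprod us vs ws)"
    if "us \<in> W.L" "vs \<in> W.L" "ws \<in> W.L" for us vs ws
    using that
    by (simp add: W.lprod_def W.rprod_def ev_mul W.star_closed W.w_closed ev_star ev_word Br_simps dots_closed As.m_assoc)
qed (simp_all add: assms Br_simps)

end

section \<open>The 2-associative bialgebra of words\<close>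

locale binf = pre_binf +
  assumes brace_rel: "us \<in> lists (carrier R) \<Longrightarrow> vs \<in> lists (carrier R) \<Longrightarrow> ws \<in> lists (carrier R) \<Longrightarrow>
    us \<noteq> [] \<Longrightarrow> vs \<noteq> [] \<Longrightarrow> ws \<noteq> [] \<Longrightarrow> binf_left R us vs ws = binf_right R us vs ws"

lemma (in binf) binf_algebra: "binf_algebra K R"
proof -
  have "brace R (us @ (x \<oplus>\<^bsub>R\<^esub> y) # us') vs = brace R (us @ x # us') vs \<oplus>\<^bsub>R\<^esub> brace R (us @ y # us') vs"
    "brace R vs (us @ (x \<oplus>\<^bsub>R\<^esub> y) # us') = brace R vs (us @ x # us') \<oplus>\<^bsub>R\<^esub> brace R vs (us @ y # us')"
    if "us \<in> L" "us' \<in> L" "vs \<in> L" "x \<in> C" "y \<in> C" for us us' vs x y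
    using that multilinear_add[OF brace_multilinear1, of vs us us' x y]
      multilinear_add[OF brace_multilinear2, of vs us us' x y] by simp_all
  moreover have "brace R (us @ (c \<odot>\<^bsub>R\<^esub> x) # us') vs = c \<odot>\<^bsub>R\<^esub> brace R (us @ x # us') vs"
    "brace R vs (us @ (c \<odot>\<^bsub>R\<^esub> x) # us') = c \<odot>\<^bsub>R\<^esub> brace R vs (us @ x # us')"
    if "us \<in> L" "us' \<in> L" "vs \<in> L" "x \<in> C" "c \<in> carrier K" for us us' vs x c
    using that multilinear_smult[OF brace_multilinear1, of vs us us' x c]
      multilinear_smult[OF brace_multilinear2, of vs us us' x c] by simp_all
  ultimately show ?thesis
    unfolding binf_algebra_def
    by (simp add: mR brace_closed brace_00 brace_10 brace_01 brace_n0 brace_0n brace_rel)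
qed

lemma binf_if_algebra:
  assumes "binf_algebra K R"
  shows "binf K R"
proof -
  note B = assms[unfolded binf_algebra_def]
  show ?thesis
  proof (intro binf.intro pre_binf.intro binf_axioms.intro)
    show "multilinear K R R (\<lambda>us. brace R us vs)" if "vs \<in> lists (carrier R)" for vs
      using B that by (intro multilinearI linear_mapI) auto
    show "multilinear K R R (brace R us)" if "us \<in> lists (carrier R)" for us
      using B that by (intro multilinearI linear_mapI) auto
  qed (use B in auto)
qed

text \<open>The two bracketings are equal, hence so are their letter components, which are the two
  sides of the relation.\<close>

lemma (in two_as_alg) binf_Br: "binf K Br"
proof (intro binf.intro pre_binf_Br binf_axioms.intro)
  fix us vs ws assume "us \<in> W.L" "vs \<in> W.L" "ws \<in> W.L" "us \<noteq> []" "vs \<noteq> []" "ws \<noteq> []"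
  then show "binf_left Br us vs ws = binf_right Br us vs ws"
    using W.letter_lprod[of us vs ws] W.letter_rprod[of us vs ws] brace_products_eq[of us vs ws]
    by (simp add: Br_simps)
qed

section \<open>Homomorphisms of 2-associative algebras and their braces\<close>

definition two_as_hom where
  "two_as_hom K A B f \<longleftrightarrow> linear_map K A B f \<and> f \<one>\<^bsub>A\<^esub> = \<one>\<^bsub>B\<^esub> \<and>
    (\<forall>x\<in>carrier A. \<forall>y\<in>carrier A. f (x \<otimes>\<^bsub>A\<^esub> y) = f x \<otimes>\<^bsub>B\<^esub> f y) \<and>
    (\<forall>x\<in>carrier A. \<forall>y\<in>carrier A. f (dot A x y) = dot B (f x) (f y))"

lemma brace_blocks_map:
  assumes "length a = length b" "us \<in> lists C" "vs \<in> lists C"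
    and "\<And>x y. (x, y) \<in> set (zip (blocks a us) (blocks b vs)) \<Longrightarrow> x \<in> lists C \<Longrightarrow> y \<in> lists C \<Longrightarrow>
      g (M x y) = M' (map g x) (map g y)"
  shows "map g (brace_blocks M (a, b) us vs) = brace_blocks M' (a, b) (map g us) (map g vs)"
  using assms
proof (induction a b arbitrary: us vs rule: list_induct2)
  case (Cons i a j b)
  have "take i us \<in> lists C" "take j vs \<in> lists C" "drop i us \<in> lists C" "drop j vs \<in> lists C"
    using Cons.prems by (auto simp: in_lists_conv_set dest: in_set_takeD in_set_dropD)
  then show ?case using Cons by (simp add: brace_blocks_Cons take_map drop_map)
qed (simp add: brace_blocks_Nil)

lemma two_as_hom_dots:
  assumes f: "two_as_hom K A B f" and "two_as_alg K A" and us: "us \<in> lists (carrier A)"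
  shows "f (dots A us) = dots B (map f us)"
proof -
  interpret A: two_as_alg K A by fact
  show ?thesis using us
  proof (induction us rule: list.induct)
    case (Cons u us)
    then show ?case using f A.dots_closed[of us] by (simp add: dots_def two_as_hom_def)
  qed (use f in \<open>simp add: dots_def two_as_hom_def\<close>)
qed

text \<open>The braces are given by recursive formulas in the two products and the linear structure,
  all preserved by a homomorphism; the induction follows that recursion.\<close>

lemma two_as_hom_brace:
  assumes f: "two_as_hom K A B f" and A: "two_as_alg K A" and B: "two_as_alg K B"
    and "us \<in> lists (carrier A)" "vs \<in> lists (carrier A)"
  shows "f (two_as_brace A us vs) = two_as_brace B (map f us) (map f vs)"
  using assms(4,5)
proof (induction "length us + length vs" arbitrary: us vs rule: less_induct)
  case less
  interpret A: two_as_alg K A by fact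
  interpret B: two_as_alg K B by fact
  have lin: "linear_map K A B f" using f by (simp add: two_as_hom_def)
  show ?case
  proof (cases "us = [] \<or> vs = []")
    case True
    then show ?thesis using linear_map_zero[OF lin A.mA B.mA]
      by (cases us; cases vs) (auto simp: two_as_brace.simps)
  next
    case False
    let ?ps = "long_pairs (length us) (length vs)"
    have c: "brace_blocks (two_as_brace A) ij us vs \<in> lists (carrier A)" if ij: "ij \<in> set ?ps" for ij
    proof -
      obtain a b where "ij = (a, b)" by fastforce
      then show ?thesis using ij less.prems A.two_as_brace_closed
        by (auto intro!: brace_blocks_closed[where C = "carrier A"] dest: long_pairsD(1))
    qed
    have m: "f (dots A (brace_blocks (two_as_brace A) ij us vs)) =
        dots B (brace_blocks (two_as_brace B) ij (map f us) (map f vs))" if ij: "ij \<in> set ?ps" for ij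
    proof -
      obtain a b where ab: "ij = (a, b)" by fastforce
      have "map f (brace_blocks (two_as_brace A) (a, b) us vs) = brace_blocks (two_as_brace B) (a, b) (map f us) (map f vs)"
      proof (rule brace_blocks_map[OF _ less.prems])
        show "length a = length b" using ij ab by (auto dest: long_pairsD)
        fix x y assume "(x, y) \<in> set (zip (blocks a us) (blocks b vs))" "x \<in> lists (carrier A)" "y \<in> lists (carrier A)"
        then show "f (two_as_brace A x y) = two_as_brace B (map f x) (map f y)"
          using less.hyps long_pairs_decrease[OF ij, of x y us vs] by (simp add: ab)
      qed
      then show ?thesis using two_as_hom_dots[OF f A c[OF ij]] by (simp add: ab)
    qed
    have s: "set (map (\<lambda>ij. dots A (brace_blocks (two_as_brace A) ij us vs)) ?ps) \<subseteq> carrier A"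
      using c A.dots_closed by auto
    have "f (two_as_brace A us vs) = f (dots A us \<otimes>\<^bsub>A\<^esub> dots A vs) \<ominus>\<^bsub>B\<^esub>
      f (lsum A (map (\<lambda>ij. dots A (brace_blocks (two_as_brace A) ij us vs)) ?ps))"
      using False less.prems A.As.lsum_closed[OF s]
      by (simp add: A.two_as_brace_rec linear_map_minus[OF lin A.mA B.mA] A.dots_closed)
    also have "f (dots A us \<otimes>\<^bsub>A\<^esub> dots A vs) = dots B (map f us) \<otimes>\<^bsub>B\<^esub> dots B (map f vs)"
      using f less.prems A.dots_closed by (simp add: two_as_hom_def two_as_hom_dots[OF f A, symmetric])
    also have "f (lsum A (map (\<lambda>ij. dots A (brace_blocks (two_as_brace A) ij us vs)) ?ps)) =
        lsum B (map (\<lambda>ij. dots B (brace_blocks (two_as_brace B) ij (map f us) (map f vs))) ?ps)"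
      unfolding linear_map_lsum[OF lin A.mA B.mA s] by (simp add: m cong: map_cong)
    also have "(dots B (map f us) \<otimes>\<^bsub>B\<^esub> dots B (map f vs)) \<ominus>\<^bsub>B\<^esub> \<dots> = two_as_brace B (map f us) (map f vs)"
      using False by (simp add: B.two_as_brace_rec)
    finally show ?thesis .
  qed
qed

section \<open>Bialgebra axioms and primitive elements of the word algebra\<close>

context binf
begin

text \<open>Associativity on words extends to arbitrary elements by linearity, one argument at a
  time from the last to the first.\<close>

lemma mul_assoc:
  assumes X: "X \<in> carrier T" and Y: "Y \<in> carrier T" and Z: "Z \<in> carrier T"
  shows "mul (mul X Y) Z = mul X (mul Y Z)"
proof -
  note l = bilinear_left[OF mul_bilinear] and r = bilinear_right[OF mul_bilinear]
  have 1: "mul (mul (w us) (w vs)) (w ws) = mul (w us) (mul (w vs) (w ws))"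
    if "us \<in> L" "vs \<in> L" "ws \<in> L" for us vs ws
    using products_eq[OF brace_rel that] that by (simp add: lprod_def rprod_def mul_word)
  have 2: "mul (mul (w us) (w vs)) Z = mul (w us) (mul (w vs) Z)" if "us \<in> L" "vs \<in> L" for us vs
    by (rule words_ext[OF r linear_map_comp[OF r r] mR mT Z])
      (use that 1 in \<open>simp_all add: w_closed mul_closed\<close>)
  have 3: "mul (mul (w us) Y) Z = mul (w us) (mul Y Z)" if "us \<in> L" for us
    by (rule words_ext[OF linear_map_comp[OF r l] linear_map_comp[OF l r] mR mT Y])
      (use that 2 Z in \<open>simp_all add: w_closed\<close>)
  show ?thesis
    by (rule words_ext[OF linear_map_comp[OF l l] l mR mT X])
      (use 3 Y Z in \<open>simp_all add: mul_closed\<close>)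
qed

lemma conc_assoc:
  assumes X: "X \<in> carrier T" and Y: "Y \<in> carrier T" and Z: "Z \<in> carrier T"
  shows "conc (conc X Y) Z = conc X (conc Y Z)"
proof -
  note l = bilinear_left[OF conc_bilinear] and r = bilinear_right[OF conc_bilinear]
  note c = bilinear_closed[OF conc_bilinear]
  have 2: "conc (conc (w us) (w vs)) Z = conc (w us) (conc (w vs) Z)" if "us \<in> L" "vs \<in> L" for us vs
    by (rule words_ext[OF r linear_map_comp[OF r r] mR mT Z])
      (use that in \<open>simp_all add: w_closed c conc_word\<close>)
  have 3: "conc (conc (w us) Y) Z = conc (w us) (conc Y Z)" if "us \<in> L" for us
    by (rule words_ext[OF linear_map_comp[OF r l] linear_map_comp[OF l r] mR mT Y])
      (use that 2 Z in \<open>simp_all add: w_closed\<close>)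
  show ?thesis
    by (rule words_ext[OF linear_map_comp[OF l l] l mR mT X])
      (use 3 Y Z in \<open>simp_all add: c\<close>)
qed

lemma conc_one: "X \<in> carrier T \<Longrightarrow> conc (w []) X = X" "X \<in> carrier T \<Longrightarrow> conc X (w []) = X"
  by (rule words_ext[OF bilinear_right[OF conc_bilinear one_closed] linear_map_id mR mT];
      simp add: conc_word)
    (rule words_ext[OF bilinear_left[OF conc_bilinear one_closed] linear_map_id mR mT];
      simp add: conc_word)

lemma two_as_algebra_Tfc: "two_as_algebra K H"
  unfolding two_as_algebra_def
proof
  show "assoc_algebra K H"
    by (rule assoc_algebraI[OF mH])
      (simp_all add: bilinear_Tfc Tfc_simps mul_bilinear one_closed mul_assoc mul_one_left mul_one_right)
  show "assoc_algebra K (dot_alg H)"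
    by (rule assoc_algebraI[OF module_dot_alg[OF mH]])
      (simp_all add: bilinear_Tfc Tfc_simps conc_bilinear one_closed conc_assoc conc_one)
qed

lemma two_as_alg_Tfc: "two_as_alg K H"
  by (rule two_as_alg.intro[OF two_as_algebra_Tfc])

text \<open>Applied to a word, both sides are sums over its factorizations into three words, and
  \<open>split_sum_assoc\<close> compares them. The rest moves the maps between tensor products
  through these sums.\<close>

lemma coassociative_Tfc: "coassociative K H"
proof -
  let ?W = "tensor K T TT" and ?W' = "tensor K TT T"
  have mW: "module K ?W" "module K ?W'" by (simp_all add: module_tensor mT mTT)
  note ml = map_tensor_linear[OF mT mT mTT mT Delta_linear linear_map_id']
  note mr = map_tensor_linear[OF mT mT mT mTT linear_map_id' Delta_linear]
  note al = tensor_assoc_linear[OF mT]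
  note pl = ptens_bilinear[OF mTT mT] and pr = ptens_bilinear[OF mT mTT]
  have Dc: "Delta x \<in> carrier TT" if "x \<in> carrier T" for x
    using linear_map_closed[OF Delta_linear that] .
  have "tensor_assoc K T (map_tensor K TT T Delta id (Delta x)) = map_tensor K T TT id Delta (Delta x)"
    if x: "x \<in> carrier T" for x
  proof (rule words_ext[OF linear_map_comp[OF linear_map_comp[OF Delta_linear ml] al]
        linear_map_comp[OF Delta_linear mr] mR mW(1) x])
    fix us assume us: "us \<in> L"
    define G where "G a b c = ptens K T TT (w a) (tp (w b) (w c))" for a b c
    have Gc: "G a b c \<in> carrier ?W" if "a \<in> L" "b \<in> L" "c \<in> L" for a b c
      using that by (simp add: G_def ptens_closed mT mTT w_closed)
    have "map_tensor K T TT id Delta (Delta (w us)) = S ?W us (\<lambda>a b. map_tensor K T TT id Delta (tp (w a) (w b)))"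
      unfolding Delta_word[OF us]
      by (rule linear_map_split_sum[OF mr mTT mW(1)]) (intro tp_closed w_closed, use us in auto)
    also have "\<dots> = S ?W us (\<lambda>a bc. S ?W bc (\<lambda>b c. G a b c))"
    proof (rule split_sum_cong)
      fix a bc assume "a @ bc = us"
      then have l: "a \<in> L" "bc \<in> L" using us by auto
      have "map_tensor K T TT id Delta (tp (w a) (w bc)) = ptens K T TT (w a) (Delta (w bc))"
        using l map_tensor_ptens[OF mT mT mT mTT linear_map_id' Delta_linear] by (simp add: w_closed)
      also have "\<dots> = S ?W bc (\<lambda>b c. G a b c)"
        unfolding Delta_word[OF l(2)] G_def
        by (rule linear_map_split_sum[OF bilinear_right[OF pr w_closed[OF l(1)]] mTT mW(1)])
          (intro tp_closed w_closed, use l in auto)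
      finally show "map_tensor K T TT id Delta (tp (w a) (w bc)) = S ?W bc (\<lambda>b c. G a b c)" .
    qed
    also have "\<dots> = S ?W us (\<lambda>ab c. S ?W ab (\<lambda>a b. G a b c))"
      by (intro abelian_monoid.split_sum_assoc Gc)
        (use us mW(1) in \<open>auto simp: module_def abelian_group_def\<close>)
    also have "\<dots> = S ?W us (\<lambda>ab c. tensor_assoc K T (map_tensor K TT T Delta id (tp (w ab) (w c))))"
    proof (rule split_sum_cong)
      fix ab c assume "ab @ c = us"
      then have l: "ab \<in> L" "c \<in> L" using us by auto
      have pc: "ptens K TT T (tp (w a) (w b)) (w c) \<in> carrier ?W'" if "a \<in> L" "b \<in> L" for a b
        using that l by (simp add: ptens_closed mT mTT w_closed)
      have "map_tensor K TT T Delta id (tp (w ab) (w c)) = ptens K TT T (Delta (w ab)) (w c)"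
        using l map_tensor_ptens[OF mT mT mTT mT Delta_linear linear_map_id'] by (simp add: w_closed)
      also have "\<dots> = S ?W' ab (\<lambda>a b. ptens K TT T (tp (w a) (w b)) (w c))"
        unfolding Delta_word[OF l(1)]
        by (rule linear_map_split_sum[OF bilinear_left[OF pl w_closed[OF l(2)]] mTT mW(2)])
          (intro tp_closed w_closed, use l in auto)
      finally have "tensor_assoc K T (map_tensor K TT T Delta id (tp (w ab) (w c))) =
        tensor_assoc K T (S ?W' ab (\<lambda>a b. ptens K TT T (tp (w a) (w b)) (w c)))" by simp
      also have "\<dots> = S ?W ab (\<lambda>a b. tensor_assoc K T (ptens K TT T (tp (w a) (w b)) (w c)))"
        by (rule linear_map_split_sum[OF al mW(2,1)]) (intro pc, use l in auto)
      also have "\<dots> = S ?W ab (\<lambda>a b. G a b c)"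
        unfolding G_def by (intro split_sum_cong tensor_assoc_ptens[OF mT] w_closed) (use l in auto)
      finally show "S ?W ab (\<lambda>a b. G a b c) = tensor_assoc K T (map_tensor K TT T Delta id (tp (w ab) (w c)))"
        by simp
    qed
    also have "\<dots> = tensor_assoc K T (map_tensor K TT T Delta id (Delta (w us)))"
      unfolding Delta_word[OF us]
      by (rule linear_map_split_sum[OF linear_map_comp[OF ml al] mTT mW(1), symmetric])
        (intro tp_closed w_closed, use us in auto)
    finally show "tensor_assoc K T (map_tensor K TT T Delta id (Delta (w us))) =
        map_tensor K T TT id Delta (Delta (w us))" by simp
  qed
  then show ?thesis
    using Delta_linear
    by (simp add: coassociative_def Tfc_simps Tfc_struct linear_map_Tfc tensor_assoc_def map_tensor_def)
qed

lemma smult_bilinear: "bilinear K T T T (\<lambda>a b. eps a \<odot>\<^bsub>T\<^esub> b)"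
proof -
  have "bilinear K (self_module K) T T (\<lambda>c b. c \<odot>\<^bsub>T\<^esub> b)"
    by (intro bilinearI linear_mapI)
      (simp_all add: self_simps Tm.smult_l_distr Tm.smult_r_distr Tm.smult_assoc1[symmetric] Rm.R.m_comm)
  from bilinear_comp_args[OF this eps_linear linear_map_id] show ?thesis .
qed

lemma smult_bilinear': "bilinear K T T T (\<lambda>a b. eps b \<odot>\<^bsub>T\<^esub> a)"
  using smult_bilinear by (auto simp: bilinear_def)

lemma counit_Tfc: "counit K H eps"
proof -
  have "lin_lift T (\<lambda>(a, b). eps a \<odot>\<^bsub>T\<^esub> b) (Delta x) = x \<and>
      lin_lift T (\<lambda>(a, b). eps b \<odot>\<^bsub>T\<^esub> a) (Delta x) = x" if x: "x \<in> carrier T" for x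
  proof
    note l = tensor_lift_linear[OF smult_bilinear mT mT mT] and r = tensor_lift_linear[OF smult_bilinear' mT mT mT]
    show "lin_lift T (\<lambda>(a, b). eps a \<odot>\<^bsub>T\<^esub> b) (Delta x) = x"
    proof (rule words_ext[OF linear_map_comp[OF Delta_linear l] linear_map_id mR mT x])
      fix us assume us: "us \<in> L"
      have "lin_lift T (\<lambda>(a, b). eps a \<odot>\<^bsub>T\<^esub> b) (Delta (w us)) =
        S T us (\<lambda>a b. lin_lift T (\<lambda>(a, b). eps a \<odot>\<^bsub>T\<^esub> b) (tp (w a) (w b)))"
        unfolding Delta_word[OF us]
        by (rule linear_map_split_sum[OF l mTT mT]) (intro tp_closed w_closed, use us in auto)
      also have "\<dots> = S T us (\<lambda>a b. eps (w a) \<odot>\<^bsub>T\<^esub> w b)"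
        by (intro split_sum_cong tensor_lift_ptens[OF smult_bilinear mT mT mT] w_closed) (use us in auto)
      also have "\<dots> = eps (w []) \<odot>\<^bsub>T\<^esub> w us"
        by (rule Tm.M.split_sum_first) (use us in \<open>auto simp: eps_word w_closed\<close>)
      finally show "lin_lift T (\<lambda>(a, b). eps a \<odot>\<^bsub>T\<^esub> b) (Delta (w us)) = w us"
        using us by (simp add: eps_word w_closed)
    qed
    show "lin_lift T (\<lambda>(a, b). eps b \<odot>\<^bsub>T\<^esub> a) (Delta x) = x"
    proof (rule words_ext[OF linear_map_comp[OF Delta_linear r] linear_map_id mR mT x])
      fix us assume us: "us \<in> L"
      have "lin_lift T (\<lambda>(a, b). eps b \<odot>\<^bsub>T\<^esub> a) (Delta (w us)) =
        S T us (\<lambda>a b. lin_lift T (\<lambda>(a, b). eps b \<odot>\<^bsub>T\<^esub> a) (tp (w a) (w b)))"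
        unfolding Delta_word[OF us]
        by (rule linear_map_split_sum[OF r mTT mT]) (intro tp_closed w_closed, use us in auto)
      also have "\<dots> = S T us (\<lambda>a b. eps (w b) \<odot>\<^bsub>T\<^esub> w a)"
        by (intro split_sum_cong tensor_lift_ptens[OF smult_bilinear' mT mT mT] w_closed) (use us in auto)
      also have "\<dots> = eps (w []) \<odot>\<^bsub>T\<^esub> w us"
        by (rule Tm.M.split_sum_last) (use us in \<open>auto simp: eps_word w_closed\<close>)
      finally show "lin_lift T (\<lambda>(a, b). eps b \<odot>\<^bsub>T\<^esub> a) (Delta (w us)) = w us"
        using us by (simp add: eps_word w_closed)
    qed
  qed
  then show ?thesis
    using eps_linear
    by (simp add: counit_def linear_map_Tfc Tfc_simps lin_lift_struct_cong[of H T])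
qed

abbreviation dmul where "dmul \<equiv> tensor_mult K (dot_alg H)"

lemma dmul_bilinear: "bilinear K TT TT TT dmul"
  using tensor_mult_bilinear[OF module_dot_alg[OF mH]] conc_bilinear
  by (simp add: bilinear_Tfc Tfc_simps Tfc_struct)

lemma dmul_tp: "a \<in> carrier T \<Longrightarrow> b \<in> carrier T \<Longrightarrow> a' \<in> carrier T \<Longrightarrow> b' \<in> carrier T \<Longrightarrow>
    dmul (tp a b) (tp a' b') = tp (conc a a') (conc b b')"
  using tensor_mult_ptens[OF module_dot_alg[OF mH], of a b a' b'] conc_bilinear
  by (simp add: bilinear_Tfc Tfc_simps Tfc_struct)

text \<open>On words this is \<open>split_sum_append\<close>: the first term collects the cuts in
  the second word, the second term those in the first, and the cut between the two words is counted
  twice.\<close>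

lemma Delta_conc:
  assumes X: "X \<in> carrier T" and Y: "Y \<in> carrier T"
  shows "Delta (conc X Y) =
    dmul (tp X (w [])) (Delta Y) \<oplus>\<^bsub>TT\<^esub> dmul (Delta X) (tp (w []) Y) \<ominus>\<^bsub>TT\<^esub> tp X Y"
proof (rule bilinear_words_ext[OF bilinear_comp[OF conc_bilinear Delta_linear] _ mTT X Y])
  note tl = bilinear_left[OF tp_bilinear] and tr = bilinear_right[OF tp_bilinear]
  have 1: "bilinear K T T TT (\<lambda>X Y. dmul (tp X (w [])) (Delta Y))"
    by (rule bilinear_comp_args[OF dmul_bilinear tl[OF one_closed] Delta_linear])
  have 2: "bilinear K T T TT (\<lambda>X Y. dmul (Delta X) (tp (w []) Y))"
    by (rule bilinear_comp_args[OF dmul_bilinear Delta_linear tr[OF one_closed]])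
  show "bilinear K T T TT (\<lambda>X Y. dmul (tp X (w [])) (Delta Y) \<oplus>\<^bsub>TT\<^esub> dmul (Delta X) (tp (w []) Y) \<ominus>\<^bsub>TT\<^esub> tp X Y)"
    using 1 2 tp_bilinear unfolding bilinear_def
    by (intro conjI ballI linear_map_minus_fun linear_map_add_fun mTT) auto
  fix us vs assume uv: "us \<in> L" "vs \<in> L"
  have c: "tp (w a) (w b) \<in> carrier TT" if "a \<in> L" "b \<in> L" for a b
    using that by (simp add: tp_closed w_closed)
  have "dmul (tp (w us) (w [])) (Delta (w vs)) = S TT vs (\<lambda>a b. dmul (tp (w us) (w [])) (tp (w a) (w b)))"
    unfolding Delta_word[OF uv(2)]
    by (rule linear_map_split_sum[OF bilinear_right[OF dmul_bilinear] mTT mTT]) (use uv c in auto)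
  also have "\<dots> = S TT vs (\<lambda>a b. tp (w (us @ a)) (w b))"
    by (intro split_sum_cong) (use uv in \<open>auto simp: dmul_tp w_closed conc_word\<close>)
  finally have l: "dmul (tp (w us) (w [])) (Delta (w vs)) = S TT vs (\<lambda>a b. tp (w (us @ a)) (w b))" .
  have "dmul (Delta (w us)) (tp (w []) (w vs)) = S TT us (\<lambda>a b. dmul (tp (w a) (w b)) (tp (w []) (w vs)))"
    unfolding Delta_word[OF uv(1)]
    by (rule linear_map_split_sum[OF bilinear_left[OF dmul_bilinear] mTT mTT]) (use uv c in auto)
  also have "\<dots> = S TT us (\<lambda>a b. tp (w a) (w (b @ vs)))"
    by (intro split_sum_cong) (use uv in \<open>auto simp: dmul_tp w_closed conc_word\<close>)
  finally have r: "dmul (Delta (w us)) (tp (w []) (w vs)) = S TT us (\<lambda>a b. tp (w a) (w (b @ vs)))" .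
  have cl: "S TT vs (\<lambda>a b. tp (w (us @ a)) (w b)) \<in> carrier TT" "S TT us (\<lambda>a b. tp (w a) (w (b @ vs))) \<in> carrier TT"
    "Delta (w (us @ vs)) \<in> carrier TT" "tp (w us) (w vs) \<in> carrier TT"
    using uv by (auto intro!: TTm.M.split_sum_closed c linear_map_closed[OF Delta_linear] w_closed)
  have "Delta (w (us @ vs)) \<oplus>\<^bsub>TT\<^esub> tp (w us) (w vs) =
      S TT us (\<lambda>a b. tp (w a) (w (b @ vs))) \<oplus>\<^bsub>TT\<^esub> S TT vs (\<lambda>a b. tp (w (us @ a)) (w b))"
  proof -
    have "us @ vs \<in> L" using uv by simp
    then have e: "a \<in> L \<and> b \<in> L" if "a @ b = us @ vs" for a b using that by (metis append_in_lists_conv)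
    show ?thesis
      unfolding Delta_word[OF \<open>us @ vs \<in> L\<close>]
      by (rule TTm.M.split_sum_append) (use e c in blast)
  qed
  then have "Delta (w (us @ vs)) = S TT us (\<lambda>a b. tp (w a) (w (b @ vs))) \<oplus>\<^bsub>TT\<^esub>
      S TT vs (\<lambda>a b. tp (w (us @ a)) (w b)) \<ominus>\<^bsub>TT\<^esub> tp (w us) (w vs)"
    using cl by (metis TTm.M.add.inv_solve_right TTm.M.a_closed a_minus_def)
  then show "Delta (conc (w us) (w vs)) =
    dmul (tp (w us) (w [])) (Delta (w vs)) \<oplus>\<^bsub>TT\<^esub> dmul (Delta (w us)) (tp (w []) (w vs)) \<ominus>\<^bsub>TT\<^esub> tp (w us) (w vs)"
    using uv cl by (simp add: conc_word l r TTm.M.a_comm)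
qed

lemma two_as_bialgebra_Tfc: "two_as_bialgebra K H"
proof -
  have "bialgebra K H"
    unfolding bialgebra_def
  proof (intro conjI ballI exI[of _ eps])
    show "assoc_algebra K H" using two_as_algebra_Tfc by (simp add: two_as_algebra_def)
  qed (simp_all add: coassociative_Tfc counit_Tfc Tfc_simps Tfc_struct Delta_word TTm.M.split_sum_Nil
      tp_closed one_closed Delta_mul eps_mul eps_word)
  moreover have "inf_bialgebra K (dot_alg H)"
    unfolding inf_bialgebra_def
  proof (intro conjI ballI exI[of _ eps])
    show "assoc_algebra K (dot_alg H)" using two_as_algebra_Tfc by (simp add: two_as_algebra_def)
  qed (simp_all add: coassociative_Tfc counit_Tfc Tfc_simps Tfc_struct Delta_conc)
  ultimately show ?thesis by (simp add: two_as_bialgebra_def)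
qed

text \<open>Counitality, applied to the coproduct of a primitive \<open>x\<close>, kills the
  multiple of \<open>w []\<close> in \<open>decomposition\<close>. Of the two terms of the
  coproduct, the one with \<open>w []\<close> on the left has zero letter component, and the other
  gives the one-letter word of \<open>letter x\<close>.\<close>

lemma Prim_Tfc: "Prim K H = (\<lambda>r. w [r]) ` C"
proof (intro equalityI subsetI)
  fix x assume "x \<in> Prim K H"
  then have x: "x \<in> carrier T" and D: "Delta x = tp x (w []) \<oplus>\<^bsub>TT\<^esub> tp (w []) x"
    by (simp_all add: Prim_def Tfc_simps Tfc_struct)
  have c: "tp x (w []) \<in> carrier TT" "tp (w []) x \<in> carrier TT"
    using x by (simp_all add: tp_closed one_closed)
  note l = tensor_lift_linear[OF smult_bilinear mT mT mT]
  have "x = lin_lift T (\<lambda>(a, b). eps a \<odot>\<^bsub>T\<^esub> b) (Delta x)"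
    using counit_Tfc x by (simp add: counit_def Tfc_simps lin_lift_struct_cong[of H T])
  also have "\<dots> = eps x \<odot>\<^bsub>T\<^esub> w [] \<oplus>\<^bsub>T\<^esub> x"
    unfolding D linear_map_add[OF l c]
    using x by (simp add: tensor_lift_ptens[OF smult_bilinear mT mT mT] one_closed eps_word)
  finally have "eps x \<odot>\<^bsub>T\<^esub> w [] = \<zero>\<^bsub>T\<^esub>"
    using x one_closed eps_closed[OF x] by (metis Tm.M.add.r_cancel_one' Tm.smult_closed)
  moreover have "cmul (Delta x) = w [letter x]"
    unfolding D linear_map_add[OF cmul_linear c]
    using x by (simp add: cmul_tp one_closed letter_word prep_zero_left prep_word letter_closed w_closed)
  ultimately have "x = w [letter x]"
    using decomposition[OF x] x by (simp add: w_closed letter_closed)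
  then show "x \<in> (\<lambda>r. w [r]) ` C" using letter_closed[OF x] by blast
next
  fix x assume "x \<in> (\<lambda>r. w [r]) ` C"
  then show "x \<in> Prim K H"
    by (elim imageE)
      (simp add: Prim_def Tfc_simps Tfc_struct w_closed Delta_word split_sum_Cons TTm.M.split_sum_Nil
        tp_closed TTm.M.a_comm)
qed

lemma dots_letters: "us \<in> L \<Longrightarrow> dots H (map (\<lambda>r. w [r]) us) = w us"
  by (induction us rule: list.induct) (simp_all add: dots_def Tfc_simps conc_word)

text \<open>\<open>star_split\<close> writes the product of two words as \<open>w [M us vs]\<close>
  plus words of several blocks, and by induction the recursion of \<open>two_as_brace\<close> in
  \<open>H\<close> subtracts exactly the latter. The one-letter words thus form a copy of
  \<open>R\<close> inside the braces of \<open>H\<close>.\<close>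

lemma brace_letters:
  "us \<in> L \<Longrightarrow> vs \<in> L \<Longrightarrow> two_as_brace H (map (\<lambda>r. w [r]) us) (map (\<lambda>r. w [r]) vs) = w [M us vs]"
proof (induction "length us + length vs" arbitrary: us vs rule: less_induct)
  case less
  interpret H: two_as_alg K H by (rule two_as_alg_Tfc)
  let ?i = "\<lambda>r. w [r]"
  have w0: "w [\<zero>\<^bsub>R\<^esub>] = \<zero>\<^bsub>T\<^esub>"
    using multilinear_zero[OF w_multilinear mR mT, of "[\<zero>\<^bsub>R\<^esub>]"] by simp
  show ?case
  proof (cases "us = [] \<or> vs = []")
    case True
    consider "us @ vs = []" | u where "u \<in> C" "us @ vs = [u]" | "2 \<le> length (us @ vs)"
      using less.prems by (cases "us @ vs" rule: remdups_adj.cases) (auto simp: append_eq_Cons_conv)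
    then show ?thesis
    proof cases
      case 1
      then show ?thesis by (simp add: H.two_as_brace_Nil brace_00 w0 Tfc_simps)
    next
      case 2
      then show ?thesis
        by (auto simp: append_eq_Cons_conv H.two_as_brace_Nil brace_10 brace_01)
    next
      case 3
      then show ?thesis using True less.prems
        by (auto simp: H.two_as_brace_Nil brace_n0 brace_0n w0 Tfc_simps)
    qed
  next
    case False
    let ?ps = "long_pairs (length us) (length vs)"
    have b: "brace_blocks M ij us vs \<in> L" if ij: "ij \<in> set ?ps" for ij
    proof -
      obtain a b where "ij = (a, b)" by fastforce
      then show ?thesis using ij less.prems brace_closed
        by (auto intro!: brace_blocks_closed[where C = C] dest: long_pairsD(1))
    qed
    have m: "dots H (brace_blocks (two_as_brace H) ij (map ?i us) (map ?i vs)) = w (brace_blocks M ij us vs)"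
      if ij: "ij \<in> set ?ps" for ij
    proof -
      obtain a b where ab: "ij = (a, b)" by fastforce
      have "map ?i (brace_blocks M (a, b) us vs) = brace_blocks (two_as_brace H) (a, b) (map ?i us) (map ?i vs)"
      proof (rule brace_blocks_map[OF _ less.prems])
        show "length a = length b" using ij ab by (auto dest: long_pairsD)
        fix x y assume "(x, y) \<in> set (zip (blocks a us) (blocks b vs))" "x \<in> L" "y \<in> L"
        then show "w [M x y] = two_as_brace H (map ?i x) (map ?i y)"
          using less.hyps[of x y] long_pairs_decrease[OF ij, of x y us vs] by (simp add: ab)
      qed
      then show ?thesis using dots_letters[OF b[OF ij]] by (simp add: ab)
    qed
    let ?s = "lsum T (map (\<lambda>ij. w (brace_blocks M ij us vs)) ?ps)"
    have c: "?s \<in> carrier T" "w [M us vs] \<in> carrier T"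
      using b less.prems by (auto intro!: Tm.M.lsum_map_closed w_closed simp: brace_closed)
    have "two_as_brace H (map ?i us) (map ?i vs) = star us vs \<ominus>\<^bsub>H\<^esub> ?s"
      using False less.prems
      by (simp add: H.two_as_brace_rec dots_letters m Tfc_simps mul_word lsum_cong[of H T] cong: map_cong)
    also have "\<dots> = (w [M us vs] \<oplus>\<^bsub>T\<^esub> ?s) \<ominus>\<^bsub>T\<^esub> ?s"
      using False less.prems by (simp add: star_split a_minus_cong[of H T] Tfc_simps)
    also have "\<dots> = w [M us vs]"
      using c by (simp add: a_minus_def Tm.M.a_assoc Tm.M.r_neg)
    finally show ?thesis .
  qed
qed

end

section \<open>The free algebras\<close>

locale vspace =
  fixes K :: "('k, 'x) ring_scheme" and V :: "('k, 'v, 'y) module_scheme"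
  assumes mV: "module K V"
begin

abbreviation "P2 \<equiv> free_two_as_pres K V"
abbreviation "A2 \<equiv> free_two_as K V"
abbreviation "PB \<equiv> free_binf_pres K V"
abbreviation "FB \<equiv> free_binf K V"
abbreviation "TB \<equiv> binf_terms K V"

lemma P2_simps: "ops P2 = {(One_op, 0), (Star_op, 2), (Dot_op, 2)}" "gens P2 = carrier V"
  by (simp_all add: free_two_as_pres_def Let_def)

lemma PB_simps: "ops PB = {((p, q), p + q) | p q. True}" "gens PB = carrier V"
  by (simp_all add: free_binf_pres_def Let_def)

lemma pres_P2: "pres K P2"
proof (rule pres.intro)
  show "cring K" using mV by (rule module_cring)
  interpret V: module K V by (rule mV)
  show "rels P2 \<subseteq> pterms K P2 \<times> pterms K P2"
    unfolding P2_simps by (auto simp: free_two_as_pres_def Let_def intro!: lterms.intros)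
qed

end

text \<open>Formal terms do not form an abelian monoid, so the earlier lemmas on sums do not apply
  to them; closure under zero and addition takes the place of the axioms.\<close>

lemma lsum_hom:
  assumes "set xs \<subseteq> C" "\<zero>\<^bsub>R\<^esub> \<in> C" "\<And>x y. x \<in> C \<Longrightarrow> y \<in> C \<Longrightarrow> x \<oplus>\<^bsub>R\<^esub> y \<in> C"
  shows "lsum R xs \<in> C"
    and "g \<zero>\<^bsub>R\<^esub> = \<zero>\<^bsub>S\<^esub> \<Longrightarrow> (\<And>x y. x \<in> C \<Longrightarrow> y \<in> C \<Longrightarrow> g (x \<oplus>\<^bsub>R\<^esub> y) = g x \<oplus>\<^bsub>S\<^esub> g y) \<Longrightarrow>
      g (lsum R xs) = lsum S (map g xs)"
proof -
  show *: "lsum R xs \<in> C" using assms by (induction xs) auto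
  show "g (lsum R xs) = lsum S (map g xs)"
    if "g \<zero>\<^bsub>R\<^esub> = \<zero>\<^bsub>S\<^esub>" "\<And>x y. x \<in> C \<Longrightarrow> y \<in> C \<Longrightarrow> g (x \<oplus>\<^bsub>R\<^esub> y) = g x \<oplus>\<^bsub>S\<^esub> g y"
    using assms(1)
  proof (induction xs)
    case (Cons x xs)
    have "lsum R xs \<in> C" using Cons.prems assms(2,3) by (induction xs) auto
    with Cons that show ?case by simp
  qed (simp add: that)
qed

text \<open>A homomorphism for zero, addition and braces between structures without axioms. The
  source will be the formal terms; the target will be the terms themselves, the free algebra, or any
  B-infinity algebra.\<close>

locale brace_hom =
  fixes C :: "'a set" and R :: "('k, 'a, 'y) binf_scheme" and S :: "('k, 'b, 'z) binf_scheme" and g :: "'a \<Rightarrow> 'b"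
  assumes bc: "us \<in> lists C \<Longrightarrow> vs \<in> lists C \<Longrightarrow> brace R us vs \<in> C"
    and zc: "\<zero>\<^bsub>R\<^esub> \<in> C" and ac: "x \<in> C \<Longrightarrow> y \<in> C \<Longrightarrow> x \<oplus>\<^bsub>R\<^esub> y \<in> C"
    and gb: "us \<in> lists C \<Longrightarrow> vs \<in> lists C \<Longrightarrow> g (brace R us vs) = brace S (map g us) (map g vs)"
    and gz: "g \<zero>\<^bsub>R\<^esub> = \<zero>\<^bsub>S\<^esub>" and ga: "x \<in> C \<Longrightarrow> y \<in> C \<Longrightarrow> g (x \<oplus>\<^bsub>R\<^esub> y) = g x \<oplus>\<^bsub>S\<^esub> g y"
begin

lemma blocks:
  assumes "ab \<in> set (tuple_pairs k p q)" "us \<in> lists C" "vs \<in> lists C"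
  shows "brace_blocks (brace R) ab us vs \<in> lists C"
    and "map g (brace_blocks (brace R) ab us vs) = brace_blocks (brace S) ab (map g us) (map g vs)"
proof -
  obtain a b where ab: "ab = (a, b)" by fastforce
  then have l: "length a = length b" using assms(1) by (simp add: in_set_tuple_pairs)
  show "brace_blocks (brace R) ab us vs \<in> lists C"
    unfolding ab by (rule brace_blocks_closed[OF bc l assms(2,3)])
  show "map g (brace_blocks (brace R) ab us vs) = brace_blocks (brace S) ab (map g us) (map g vs)"
    unfolding ab by (rule brace_blocks_map[OF l assms(2,3)]) (rule gb)
qed

text \<open>Both sides of the relation are built from zero, addition and braces alone, hence commute
  with \<open>g\<close>. This carries the formal relation over to classes of terms and to their
  evaluations.\<close>

lemma
  assumes "us \<in> lists C" "vs \<in> lists C" "ws \<in> lists C"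
  shows left_closed: "binf_left R us vs ws \<in> C"
    and left_hom: "g (binf_left R us vs ws) = binf_left S (map g us) (map g vs) (map g ws)"
    and right_closed: "binf_right R us vs ws \<in> C"
    and right_hom: "g (binf_right R us vs ws) = binf_right S (map g us) (map g vs) (map g ws)"
proof -
  let ?L = "concat (map (\<lambda>l. map (\<lambda>ab. brace R (brace_blocks (brace R) ab us vs) ws)
      (tuple_pairs l (length us) (length vs))) [1..<Suc (length us + length vs)])"
  let ?R = "concat (map (\<lambda>l. map (\<lambda>bc. brace R us (brace_blocks (brace R) bc vs ws))
      (tuple_pairs l (length vs) (length ws))) [1..<Suc (length vs + length ws)])"
  have L: "set ?L \<subseteq> C" using blocks(1)[OF _ assms(1,2)] bc assms by (auto simp del: upt_Suc)
  have R: "set ?R \<subseteq> C" using blocks(1)[OF _ assms(2,3)] bc assms by (auto simp del: upt_Suc)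
  show "binf_left R us vs ws \<in> C" "binf_right R us vs ws \<in> C"
    unfolding binf_left_def binf_right_def using lsum_hom(1)[OF L zc ac] lsum_hom(1)[OF R zc ac] by blast+
  have "map g ?L = concat (map (\<lambda>l. map (\<lambda>ab. brace S (brace_blocks (brace S) ab (map g us) (map g vs)) (map g ws))
      (tuple_pairs l (length us) (length vs))) [1..<Suc (length us + length vs)])"
    unfolding map_concat map_map o_def
    by (intro arg_cong[where f = concat] map_cong HOL.refl) (simp add: gb blocks assms)
  then show "g (binf_left R us vs ws) = binf_left S (map g us) (map g vs) (map g ws)"
    unfolding binf_left_def using lsum_hom(2)[OF L zc ac gz ga] by simp
  have "map g ?R = concat (map (\<lambda>l. map (\<lambda>bc. brace S (map g us) (brace_blocks (brace S) bc (map g vs) (map g ws)))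
      (tuple_pairs l (length vs) (length ws))) [1..<Suc (length vs + length ws)])"
    unfolding map_concat map_map o_def
    by (intro arg_cong[where f = concat] map_cong HOL.refl) (simp add: gb blocks assms)
  then show "g (binf_right R us vs ws) = binf_right S (map g us) (map g vs) (map g ws)"
    unfolding binf_right_def using lsum_hom(2)[OF R zc ac gz ga] by simp
qed

end

context vspace
begin

lemma TB_simps: "carrier TB = pterms K PB" "zero TB = Zero" "add TB = Plus" "smult TB = Scale"
  "brace TB us vs = Op (length us, length vs) (us @ vs)"
  by (simp_all add: binf_terms_def PB_simps)

lemma brace_hom_TB:
  assumes "\<And>us vs. us \<in> lists (pterms K PB) \<Longrightarrow> vs \<in> lists (pterms K PB) \<Longrightarrow>
      g (Op (length us, length vs) (us @ vs)) = brace S (map g us) (map g vs)"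
    and "g Zero = \<zero>\<^bsub>S\<^esub>"
    and "\<And>s t. s \<in> pterms K PB \<Longrightarrow> t \<in> pterms K PB \<Longrightarrow> g (Plus s t) = g s \<oplus>\<^bsub>S\<^esub> g t"
  shows "brace_hom (pterms K PB) TB S g"
  by unfold_locales (auto simp: TB_simps assms intro!: lterms.intros simp: PB_simps)

lemma in_rels_PB: "(s, t) \<in> rels PB \<longleftrightarrow> (\<exists>v w. s = Gen (v \<oplus>\<^bsub>V\<^esub> w) \<and> t = Plus (Gen v) (Gen w) \<and> v \<in> carrier V \<and> w \<in> carrier V) \<or>
      (\<exists>c v. s = Gen (c \<odot>\<^bsub>V\<^esub> v) \<and> t = Scale c (Gen v) \<and> c \<in> carrier K \<and> v \<in> carrier V) \<or>
      (s = brace TB [] [] \<and> t = Zero) \<or> (s = brace TB [t] [] \<and> t \<in> pterms K PB) \<or>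
      (s = brace TB [] [t] \<and> t \<in> pterms K PB) \<or>
      (\<exists>ts. s = brace TB ts [] \<and> t = Zero \<and> ts \<in> lists (pterms K PB) \<and> 2 \<le> length ts) \<or>
      (\<exists>ts. s = brace TB [] ts \<and> t = Zero \<and> ts \<in> lists (pterms K PB) \<and> 2 \<le> length ts) \<or>
      (\<exists>us vs ws. s = binf_left TB us vs ws \<and> t = binf_right TB us vs ws \<and> us \<in> lists (pterms K PB) \<and>
        vs \<in> lists (pterms K PB) \<and> ws \<in> lists (pterms K PB) \<and> us \<noteq> [] \<and> vs \<noteq> [] \<and> ws \<noteq> [])"
  unfolding TB_simps(1)[symmetric]
  by (subst free_binf_pres_def) (simp only: Let_def presentation.simps Un_iff mem_Collect_eq prod.inject
    insert_iff empty_iff, blast)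

lemma pres_PB: "pres K PB"
proof (rule pres.intro)
  show "cring K" using mV by (rule module_cring)
  interpret V: module K V by (rule mV)
  \<comment> \<open>The identity is taken for the sake of the closure facts: both sides of the
    relation are again terms.\<close>
  interpret h: brace_hom "pterms K PB" TB TB id
    by (rule brace_hom_TB) (simp_all add: TB_simps)
  have b: "brace TB us vs \<in> pterms K PB" if "us \<in> lists (pterms K PB)" "vs \<in> lists (pterms K PB)" for us vs
    using h.bc that .
  have g: "Gen v \<in> pterms K PB" if "v \<in> carrier V" for v
    using that by (auto intro!: lterms.intros simp: PB_simps)
  show "rels PB \<subseteq> pterms K PB \<times> pterms K PB"
    using b h.left_closed h.right_closed
    by (subst free_binf_pres_def) (auto simp: Let_def TB_simps(1) g intro!: lterms.intros(2-4))
qed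

end

sublocale vspace \<subseteq> Q2: pres K "free_two_as_pres K V" by (rule pres_P2)
sublocale vspace \<subseteq> QB: pres K "free_binf_pres K V" by (rule pres_PB)

section \<open>Universal properties of the two free algebras\<close>

context vspace
begin

lemma A2_simps: "carrier A2 = carrier (presented K P2)" "zero A2 = zero (presented K P2)"
  "add A2 = add (presented K P2)" "smult A2 = smult (presented K P2)"
  "X \<otimes>\<^bsub>A2\<^esub> Y = presented_op K P2 Star_op [X, Y]" "\<one>\<^bsub>A2\<^esub> = presented_op K P2 One_op []"
  "dot A2 X Y = presented_op K P2 Dot_op [X, Y]"
  by (simp_all add: free_two_as_def Let_def)

lemma mult_A2: "mult A2 = (\<lambda>X Y. presented_op K P2 Star_op [X, Y])"
  "dot A2 = (\<lambda>X Y. presented_op K P2 Dot_op [X, Y])"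
  by (simp_all add: free_two_as_def Let_def)

lemma module_A2: "module K A2"
  by (rule module_cong[OF Q2.module_presented]) (simp_all add: A2_simps)

lemma linear_map_A2: "linear_map K A2 = linear_map K (presented K P2)"
  "linear_map K B A2 = linear_map K B (presented K P2)"
  by (auto simp: linear_map_def A2_simps fun_eq_iff)

lemma op2_bilinear:
  assumes "q \<in> {Star_op, Dot_op}"
  shows "bilinear K A2 A2 A2 (\<lambda>X Y. presented_op K P2 q [X, Y])"
proof (rule bilinearI)
  have q: "(q, Suc (Suc 0)) \<in> ops P2" using assms by (auto simp: P2_simps numeral_2_eq_2)
  show "linear_map K A2 A2 (\<lambda>Y. presented_op K P2 q [X, Y])" if "X \<in> carrier A2" for X
    using Q2.presented_op_linear[of "[X]" "[]" q] that q by (simp add: linear_map_A2 A2_simps)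
  show "linear_map K A2 A2 (\<lambda>X. presented_op K P2 q [X, Y])" if "Y \<in> carrier A2" for Y
    using Q2.presented_op_linear[of "[]" "[Y]" q] that q by (simp add: linear_map_A2 A2_simps)
qed

lemma one_A2_closed: "\<one>\<^bsub>A2\<^esub> \<in> carrier A2"
  unfolding A2_simps by (rule Q2.presented_op_closed) (simp_all add: P2_simps)

lemma one_A2: "\<one>\<^bsub>A2\<^esub> = cls K P2 (Op One_op [])" "Op One_op [] \<in> pterms K P2"
  using Q2.presented_op_cls[of "[]" One_op] by (auto simp: A2_simps P2_simps intro!: lterms.intros)

lemma op2_cls:
  assumes "q \<in> {Star_op, Dot_op}" "s \<in> pterms K P2" "t \<in> pterms K P2"
  shows "presented_op K P2 q [cls K P2 s, cls K P2 t] = cls K P2 (Op q [s, t])" "Op q [s, t] \<in> pterms K P2"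
  using Q2.presented_op_cls[of "[s, t]" q] assms by (auto simp: P2_simps intro!: lterms.intros)

lemma op2_assoc_units:
  assumes q: "q \<in> {Star_op, Dot_op}" and "X \<in> carrier A2" "Y \<in> carrier A2" "Z \<in> carrier A2"
  shows "presented_op K P2 q [presented_op K P2 q [X, Y], Z] = presented_op K P2 q [X, presented_op K P2 q [Y, Z]]"
    and "presented_op K P2 q [\<one>\<^bsub>A2\<^esub>, X] = X" "presented_op K P2 q [X, \<one>\<^bsub>A2\<^esub>] = X"
proof -
  obtain r s t where rst: "r \<in> pterms K P2" "s \<in> pterms K P2" "t \<in> pterms K P2"
    "X = cls K P2 r" "Y = cls K P2 s" "Z = cls K P2 t"
    using assms(2-4) Q2.carrier_cases unfolding A2_simps by metis
  have rel: "(Op q [Op q [r, s], t], Op q [r, Op q [s, t]]) \<in> rels P2"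
    "(Op q [Op One_op [], r], r) \<in> rels P2" "(Op q [r, Op One_op []], r) \<in> rels P2"
    using q rst(1-3) by (simp_all add: free_two_as_pres_def Let_def P2_simps[unfolded free_two_as_pres_def Let_def])
  show "presented_op K P2 q [presented_op K P2 q [X, Y], Z] = presented_op K P2 q [X, presented_op K P2 q [Y, Z]]"
    using Q2.cls_eqI[OF lcong.rel[OF rel(1)]] q by (simp add: rst op2_cls)
  show "presented_op K P2 q [\<one>\<^bsub>A2\<^esub>, X] = X" "presented_op K P2 q [X, \<one>\<^bsub>A2\<^esub>] = X"
    using Q2.cls_eqI[OF lcong.rel[OF rel(2)]] Q2.cls_eqI[OF lcong.rel[OF rel(3)]] q
    by (simp_all add: rst one_A2 op2_cls)
qed

lemma two_as_alg_A2: "two_as_alg K A2"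
proof (intro two_as_alg.intro, unfold two_as_algebra_def, intro conjI)
  show "assoc_algebra K A2"
    by (rule assoc_algebraI[OF module_A2])
      (use op2_bilinear[of Star_op] op2_assoc_units[of Star_op] in \<open>simp_all add: mult_A2 one_A2_closed\<close>)
  show "assoc_algebra K (dot_alg A2)"
    by (rule assoc_algebraI[OF module_dot_alg[OF module_A2]])
      (use op2_bilinear[of Dot_op] op2_assoc_units[of Dot_op] in \<open>simp_all add: mult_A2 one_A2_closed\<close>)
qed

abbreviation "gen2 v \<equiv> cls K P2 (Gen v)"
abbreviation "genB v \<equiv> cls K PB (Gen v)"

lemma gen2_closed: "v \<in> carrier V \<Longrightarrow> gen2 v \<in> carrier A2"
  unfolding A2_simps by (rule Q2.cls_carrier) (auto simp: P2_simps intro!: lterms.intros)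

lemma gen2_linear: "linear_map K V A2 gen2"
proof -
  interpret V: module K V by (rule mV)
  have g: "Gen v \<in> pterms K P2" if "v \<in> carrier V" for v
    using that by (auto simp: P2_simps intro!: lterms.intros)
  have "(Gen (x \<oplus>\<^bsub>V\<^esub> y), Plus (Gen x) (Gen y)) \<in> rels P2" if "x \<in> carrier V" "y \<in> carrier V" for x y
    using that by (auto simp: free_two_as_pres_def Let_def)
  moreover have "(Gen (c \<odot>\<^bsub>V\<^esub> x), Scale c (Gen x)) \<in> rels P2" if "x \<in> carrier V" "c \<in> carrier K" for x c
    using that by (auto simp: free_two_as_pres_def Let_def)
  ultimately show ?thesis
    unfolding linear_map_A2
    by (intro linear_mapI)
      (simp_all add: Q2.presented_add Q2.presented_smult g Q2.cls_carrier Q2.cls_eqI[OF lcong.rel])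
qed

lemma free_two_as_universal:
  assumes B: "two_as_alg K B" and f: "linear_map K V B f"
  shows "\<exists>g. two_as_hom K A2 B g \<and> (\<forall>v\<in>carrier V. g (gen2 v) = f v)"
proof -
  interpret B: two_as_alg K B by fact
  define I where "I q ts = (case q of One_op \<Rightarrow> \<one>\<^bsub>B\<^esub> | Star_op \<Rightarrow> (ts ! 0) \<otimes>\<^bsub>B\<^esub> (ts ! 1)
    | Dot_op \<Rightarrow> dot B (ts ! 0) (ts ! 1))" for q ts
  have f': "f \<in> gens P2 \<rightarrow> carrier B" using linear_map_closed[OF f] by (auto simp: P2_simps)
  have Ic: "I q ts \<in> carrier B" if "(q, length ts) \<in> ops P2" "ts \<in> lists (carrier B)" for q ts
    using that by (auto simp: P2_simps I_def numeral_2_eq_2 length_Suc_conv B.dot_closed)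
  have Il: "linear_map K B B (\<lambda>x. I q (ss @ x # us))"
    if ops: "(q, Suc (length ss + length us)) \<in> ops P2"
      and su: "ss \<in> lists (carrier B)" "us \<in> lists (carrier B)" for q ss us
  proof -
    have q: "q = Star_op \<or> q = Dot_op" and l: "length ss + length us = 1"
      using ops by (auto simp: P2_simps)
    consider y where "y \<in> carrier B" "ss = [y]" "us = []" | y where "y \<in> carrier B" "ss = []" "us = [y]"
      using l su by (cases ss; cases us) auto
    then show ?thesis using q bilinear_left[OF B.star_bilinear] bilinear_right[OF B.star_bilinear]
        bilinear_left[OF B.dot_bilinear] bilinear_right[OF B.dot_bilinear]
      by cases (auto simp: I_def)
  qed
  have c: "geval B f I t \<in> carrier B" if "t \<in> pterms K P2" for t
    using geval_closed[OF B.mA f' Ic that] .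
  have rel: "geval B f I s = geval B f I t" if "(s, t) \<in> rels P2" for s t
  proof -
    note c' = c[unfolded P2_simps]
    show ?thesis
      using that c' unfolding free_two_as_pres_def Let_def
      by (auto simp: linear_map_add[OF f] linear_map_smult[OF f] I_def B.As.m_assoc B.dot_assoc B.dot_one)
  qed
  have m: "pmodel K P2 B f I"
    unfolding pmodel_def using B.mA f' Ic Il rel by blast
  have lin: "linear_map K A2 B (Q2.plift B f I)"
    unfolding linear_map_A2 by (rule Q2.plift_linear[OF m])
  have "two_as_hom K A2 B (Q2.plift B f I)"
    unfolding two_as_hom_def A2_simps
    using lin Q2.plift_op[OF m, of "[]" One_op] Q2.plift_op[OF m, of "[_, _]" Star_op]
      Q2.plift_op[OF m, of "[_, _]" Dot_op]
    by (simp add: P2_simps I_def)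
  moreover have "Q2.plift B f I (gen2 v) = f v" if "v \<in> carrier V" for v
    using Q2.plift_cls[OF m, of "Gen v"] that by (simp add: P2_simps lterms.intros)
  ultimately show ?thesis by blast
qed

lemma free_two_as_induct [consumes 1, case_names Gen Zero Plus Scale One Star Dot]:
  assumes "X \<in> carrier A2"
    and "\<And>v. v \<in> carrier V \<Longrightarrow> Pr (gen2 v)"
    and "Pr \<zero>\<^bsub>A2\<^esub>"
    and "\<And>X Y. X \<in> carrier A2 \<Longrightarrow> Y \<in> carrier A2 \<Longrightarrow> Pr X \<Longrightarrow> Pr Y \<Longrightarrow> Pr (X \<oplus>\<^bsub>A2\<^esub> Y)"
    and "\<And>c X. c \<in> carrier K \<Longrightarrow> X \<in> carrier A2 \<Longrightarrow> Pr X \<Longrightarrow> Pr (c \<odot>\<^bsub>A2\<^esub> X)"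
    and "Pr \<one>\<^bsub>A2\<^esub>"
    and "\<And>X Y. X \<in> carrier A2 \<Longrightarrow> Y \<in> carrier A2 \<Longrightarrow> Pr X \<Longrightarrow> Pr Y \<Longrightarrow> Pr (X \<otimes>\<^bsub>A2\<^esub> Y)"
    and "\<And>X Y. X \<in> carrier A2 \<Longrightarrow> Y \<in> carrier A2 \<Longrightarrow> Pr X \<Longrightarrow> Pr Y \<Longrightarrow> Pr (dot A2 X Y)"
  shows "Pr X"
  using assms(1) unfolding A2_simps
proof (induction rule: Q2.presented_induct)
  case (Op q Xs)
  then consider "q = One_op" "Xs = []" | X Y where "q = Star_op \<or> q = Dot_op" "Xs = [X, Y]"
    by (auto simp: P2_simps numeral_2_eq_2 length_Suc_conv)
  then show ?case
  proof cases
    case 1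
    then show ?thesis using assms(6) by (simp add: A2_simps)
  next
    case (2 X Y)
    have XY: "X \<in> carrier A2" "Y \<in> carrier A2" using Op.hyps(1) by (simp_all add: 2 A2_simps)
    have "Pr X" "Pr Y" using Op.IH by (simp_all add: 2)
    then show ?thesis using assms(7)[OF XY] assms(8)[OF XY] 2 by (elim disjE) (simp_all add: A2_simps)
  qed
qed (use assms in \<open>simp_all add: A2_simps P2_simps\<close>)

lemma FB_simps: "carrier FB = carrier (presented K PB)" "zero FB = zero (presented K PB)"
  "add FB = add (presented K PB)" "smult FB = smult (presented K PB)"
  "brace FB us vs = presented_op K PB (length us, length vs) (us @ vs)"
  by (simp_all add: free_binf_def Let_def)

lemma module_FB: "module K FB"
  by (rule module_cong[OF QB.module_presented]) (simp_all add: FB_simps)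

lemma linear_map_FB: "linear_map K FB = linear_map K (presented K PB)"
  "linear_map K B FB = linear_map K B (presented K PB)"
  by (auto simp: linear_map_def FB_simps fun_eq_iff)

lemma in_ops_PB: "((p, q), n) \<in> ops PB \<longleftrightarrow> n = p + q"
  by (auto simp: PB_simps)

lemma brace_FB_cls:
  assumes "us \<in> lists (pterms K PB)" "vs \<in> lists (pterms K PB)"
  shows "brace FB (map (cls K PB) us) (map (cls K PB) vs) = cls K PB (Op (length us, length vs) (us @ vs))"
  using QB.presented_op_cls[of "us @ vs" "(length us, length vs)"] assms
  by (simp add: FB_simps in_ops_PB)

lemma binf_FB: "binf K FB"
proof (intro binf.intro pre_binf.intro binf_axioms.intro)
  show "module K FB" by (rule module_FB)
  have bc: "brace FB us vs \<in> carrier FB" if "us \<in> lists (carrier FB)" "vs \<in> lists (carrier FB)" for us vs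
    using that unfolding FB_simps by (intro QB.presented_op_closed) (auto simp: in_ops_PB)
  show "multilinear K FB FB (\<lambda>us. brace FB us vs)" if "vs \<in> lists (carrier FB)" for vs
  proof (rule multilinearI)
    fix a b assume "a \<in> lists (carrier FB)" "b \<in> lists (carrier FB)"
    then show "linear_map K FB FB (\<lambda>x. brace FB (a @ x # b) vs)"
      using QB.presented_op_linear[of a "b @ vs" "(Suc (length a + length b), length vs)"] that
      by (simp add: FB_simps linear_map_FB in_ops_PB)
  qed (use that bc in simp)
  show "multilinear K FB FB (brace FB us)" if "us \<in> lists (carrier FB)" for us
  proof (rule multilinearI)
    fix a b assume "a \<in> lists (carrier FB)" "b \<in> lists (carrier FB)"
    then show "linear_map K FB FB (\<lambda>x. brace FB us (a @ x # b))"
      using QB.presented_op_linear[of "us @ a" b "(length us, Suc (length a + length b))"] that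
      by (simp add: FB_simps linear_map_FB in_ops_PB)
  qed (use that bc in simp)
  have rel: "cls K PB s = cls K PB t" if "(s, t) \<in> rels PB" for s t
    using QB.cls_eqI[OF lcong.rel[OF that]] .
  have z: "\<zero>\<^bsub>FB\<^esub> = cls K PB Zero" by (simp add: FB_simps QB.presented_zero)
  have rels: "(brace TB [] [], Zero) \<in> rels PB"
    "t \<in> pterms K PB \<Longrightarrow> (brace TB [t] [], t) \<in> rels PB"
    "t \<in> pterms K PB \<Longrightarrow> (brace TB [] [t], t) \<in> rels PB"
    "ts \<in> lists (pterms K PB) \<Longrightarrow> 2 \<le> length ts \<Longrightarrow> (brace TB ts [], Zero) \<in> rels PB"
    "ts \<in> lists (pterms K PB) \<Longrightarrow> 2 \<le> length ts \<Longrightarrow> (brace TB [] ts, Zero) \<in> rels PB"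
    "us \<in> lists (pterms K PB) \<Longrightarrow> vs \<in> lists (pterms K PB) \<Longrightarrow> ws \<in> lists (pterms K PB) \<Longrightarrow>
      us \<noteq> [] \<Longrightarrow> vs \<noteq> [] \<Longrightarrow> ws \<noteq> [] \<Longrightarrow> (binf_left TB us vs ws, binf_right TB us vs ws) \<in> rels PB"
    for t ts us vs ws
    by (subst in_rels_PB, blast)+
  show "brace FB [] [] = \<zero>\<^bsub>FB\<^esub>"
    using rel[OF rels(1)] brace_FB_cls[of "[]" "[]"] by (simp add: z TB_simps)
  show "brace FB [u] [] = u" if "u \<in> carrier FB" for u
  proof -
    obtain t where t: "t \<in> pterms K PB" "u = cls K PB t"
      using \<open>u \<in> carrier FB\<close> QB.carrier_cases unfolding FB_simps by metis
    then show ?thesis using rel[OF rels(2)[OF t(1)]] brace_FB_cls[of "[t]" "[]"] by (simp add: TB_simps)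
  qed
  show "brace FB [] [u] = u" if "u \<in> carrier FB" for u
  proof -
    obtain t where t: "t \<in> pterms K PB" "u = cls K PB t"
      using \<open>u \<in> carrier FB\<close> QB.carrier_cases unfolding FB_simps by metis
    then show ?thesis using rel[OF rels(3)[OF t(1)]] brace_FB_cls[of "[]" "[t]"] by (simp add: TB_simps)
  qed
  show "brace FB us [] = \<zero>\<^bsub>FB\<^esub>" if us: "us \<in> lists (carrier FB)" and l: "2 \<le> length us" for us
  proof -
    obtain ts where t: "ts \<in> lists (pterms K PB)" "us = map (cls K PB) ts"
      using us QB.carrier_lists_cases unfolding FB_simps by metis
    then show ?thesis using rel[OF rels(4)[OF t(1)]] l brace_FB_cls[of ts "[]"] by (simp add: TB_simps z)
  qed
  show "brace FB [] us = \<zero>\<^bsub>FB\<^esub>" if us: "us \<in> lists (carrier FB)" and l: "2 \<le> length us" for us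
  proof -
    obtain ts where t: "ts \<in> lists (pterms K PB)" "us = map (cls K PB) ts"
      using us QB.carrier_lists_cases unfolding FB_simps by metis
    then show ?thesis using rel[OF rels(5)[OF t(1)]] l brace_FB_cls[of "[]" ts] by (simp add: TB_simps z)
  qed
  show "binf_left FB us vs ws = binf_right FB us vs ws"
    if L: "us \<in> lists (carrier FB)" "vs \<in> lists (carrier FB)" "ws \<in> lists (carrier FB)"
      and n: "us \<noteq> []" "vs \<noteq> []" "ws \<noteq> []" for us vs ws
  proof -
    \<comment> \<open>Taking classes is a homomorphism on formal terms, so the classes of the two
      relation terms are the two sides of the relation in the free algebra.\<close>
    interpret h: brace_hom "pterms K PB" TB FB "cls K PB"
      by (rule brace_hom_TB) (simp_all add: brace_FB_cls z, simp add: FB_simps QB.presented_add)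
    obtain us' vs' ws' where t: "us' \<in> lists (pterms K PB)" "us = map (cls K PB) us'"
      "vs' \<in> lists (pterms K PB)" "vs = map (cls K PB) vs'"
      "ws' \<in> lists (pterms K PB)" "ws = map (cls K PB) ws'"
      using L QB.carrier_lists_cases unfolding FB_simps by metis
    have "us' \<noteq> []" "vs' \<noteq> []" "ws' \<noteq> []" using n t by auto
    from rel[OF rels(6)[OF t(1,3,5) this]] show ?thesis
      using h.left_hom[OF t(1,3,5)] h.right_hom[OF t(1,3,5)] by (simp add: t)
  qed
qed

lemma genB_closed: "v \<in> carrier V \<Longrightarrow> genB v \<in> carrier FB"
  unfolding FB_simps by (rule QB.cls_carrier) (auto simp: PB_simps intro!: lterms.intros)

lemma genB_linear: "linear_map K V FB genB"
proof -
  interpret V: module K V by (rule mV)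
  have g: "Gen v \<in> pterms K PB" if "v \<in> carrier V" for v
    using that by (auto simp: PB_simps intro!: lterms.intros)
  have "(Gen (x \<oplus>\<^bsub>V\<^esub> y), Plus (Gen x) (Gen y)) \<in> rels PB" if "x \<in> carrier V" "y \<in> carrier V" for x y
    using that by (auto simp: free_binf_pres_def Let_def)
  moreover have "(Gen (c \<odot>\<^bsub>V\<^esub> x), Scale c (Gen x)) \<in> rels PB" if "x \<in> carrier V" "c \<in> carrier K" for x c
    using that by (auto simp: free_binf_pres_def Let_def)
  ultimately show ?thesis
    unfolding linear_map_FB
    by (intro linear_mapI)
      (simp_all add: QB.presented_add QB.presented_smult g QB.cls_carrier QB.cls_eqI[OF lcong.rel])
qed

lemma free_binf_universal:
  assumes B: "binf K B" and f: "linear_map K V B f"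
  shows "\<exists>g. linear_map K FB B g \<and> (\<forall>v\<in>carrier V. g (genB v) = f v) \<and>
    (\<forall>us\<in>lists (carrier FB). \<forall>vs\<in>lists (carrier FB). g (brace FB us vs) = brace B (map g us) (map g vs))"
proof -
  interpret B: binf K B by fact
  \<comment> \<open>The symbol \<open>(p, q)\<close> receives a single list of \<open>p + q\<close>
    arguments, which is cut after \<open>p\<close> to recover the two arguments of the
    brace.\<close>
  define I where "I = (\<lambda>(p, q :: nat) ts. brace B (take p ts) (drop p ts))"
  have td: "take n xs \<in> lists (carrier B)" "drop n xs \<in> lists (carrier B)" if "xs \<in> lists (carrier B)" for n xs
    using that by (auto simp: in_lists_conv_set dest: in_set_takeD in_set_dropD)
  have f': "f \<in> gens PB \<rightarrow> carrier B" using linear_map_closed[OF f] by (auto simp: PB_simps)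
  have Ic: "I q ts \<in> carrier B" if "(q, length ts) \<in> ops PB" "ts \<in> lists (carrier B)" for q ts
    using that td by (cases q) (auto simp: I_def B.brace_closed)
  have Il: "linear_map K B B (\<lambda>x. I q (ss @ x # us))"
    if l: "ss \<in> lists (carrier B)" "us \<in> lists (carrier B)" for q ss us
  proof (cases q)
    case (Pair p r)
    show ?thesis
    proof (cases "p \<le> length ss")
      case True
      then show ?thesis
        using multilinear_linear[OF B.brace_multilinear2[OF td(1)[OF l(1)]] td(2)[OF l(1)] l(2)]
        by (simp add: I_def Pair)
    next
      case False
      then obtain n where "p = Suc (length ss + n)" by (metis add_Suc_right less_imp_Suc_add not_le)
      then show ?thesis
        using multilinear_linear[OF B.brace_multilinear1[OF td(2)[OF l(2)]] l(1) td(1)[OF l(2)]]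
        by (simp add: I_def Pair)
    qed
  qed
  have c: "geval B f I t \<in> carrier B" if "t \<in> pterms K PB" for t
    using geval_closed[OF B.mR f' Ic that] .
  have cl: "map (geval B f I) ts \<in> lists (carrier B)" if "ts \<in> lists (pterms K PB)" for ts
    using that c by (auto simp: in_lists_conv_set)
  \<comment> \<open>Evaluation is a homomorphism on formal terms and turns the formal relation into
    the one that holds in \<open>B\<close>.\<close>
  interpret h: brace_hom "pterms K PB" TB B "geval B f I"
    by (rule brace_hom_TB) (simp_all add: I_def)
  have rel: "geval B f I s = geval B f I t" if "(s, t) \<in> rels PB" for s t
  proof -
    have 1: "geval B f I (brace TB us vs) = brace B (map (geval B f I) us) (map (geval B f I) vs)" for us vs
      by (simp add: TB_simps I_def)
    note that[unfolded in_rels_PB]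
    then show ?thesis
    proof (elim disjE exE conjE)
      fix us vs ws assume "s = binf_left TB us vs ws" "t = binf_right TB us vs ws" "us \<in> lists (pterms K PB)"
        "vs \<in> lists (pterms K PB)" "ws \<in> lists (pterms K PB)" "us \<noteq> []" "vs \<noteq> []" "ws \<noteq> []"
      then show ?thesis using h.left_hom[of us vs ws] h.right_hom[of us vs ws] B.brace_rel[OF cl cl cl]
        by simp
    qed (use c cl in \<open>simp_all add: 1 linear_map_add[OF f] linear_map_smult[OF f] B.brace_00 B.brace_10
      B.brace_01 B.brace_n0 B.brace_0n\<close>)
  qed
  have m: "pmodel K PB B f I"
    unfolding pmodel_def using B.mR f' Ic Il rel by blast
  have "linear_map K FB B (QB.plift B f I)"
    unfolding linear_map_FB by (rule QB.plift_linear[OF m])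
  moreover have "QB.plift B f I (genB v) = f v" if "v \<in> carrier V" for v
    using QB.plift_cls[OF m, of "Gen v"] that by (simp add: PB_simps lterms.intros)
  moreover have "QB.plift B f I (brace FB us vs) = brace B (map (QB.plift B f I) us) (map (QB.plift B f I) vs)"
    if "us \<in> lists (carrier FB)" "vs \<in> lists (carrier FB)" for us vs
    using QB.plift_op[OF m, of "us @ vs" "(length us, length vs)"] that by (simp add: FB_simps in_ops_PB I_def)
  ultimately show ?thesis by blast
qed

text \<open>Every element is a combination of iterated braces of generators. The operation
  \<open>m\<close> is left open so that the target may carry its braces outside a
  \<open>binf\<close> record, as \<open>Tfc\<close> does with \<open>two_as_brace\<close>.\<close>

lemma free_binf_ext:
  assumes "linear_map K FB W f" "linear_map K FB W g" "module K W" "X \<in> carrier FB"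
    and "\<And>v. v \<in> carrier V \<Longrightarrow> f (genB v) = g (genB v)"
    and "\<And>us vs. us \<in> lists (carrier FB) \<Longrightarrow> vs \<in> lists (carrier FB) \<Longrightarrow> f (brace FB us vs) = m (map f us) (map f vs)"
    and "\<And>us vs. us \<in> lists (carrier FB) \<Longrightarrow> vs \<in> lists (carrier FB) \<Longrightarrow> g (brace FB us vs) = m (map g us) (map g vs)"
  shows "f X = g X"
  using assms(4) unfolding FB_simps
proof (induction rule: QB.presented_induct)
  case Zero
  show ?case using linear_map_zero[OF assms(1) module_FB assms(3)] linear_map_zero[OF assms(2) module_FB assms(3)]
    by (simp add: FB_simps)
next
  case (Op q Xs)
  obtain p r where q: "q = (p, r)" by fastforce
  have l: "length Xs = p + r" using Op by (simp add: q in_ops_PB)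
  have c: "take p Xs \<in> lists (carrier FB)" "drop p Xs \<in> lists (carrier FB)"
    using Op(1) by (auto simp: in_lists_conv_set FB_simps dest: in_set_takeD in_set_dropD)
  have e: "map f (take p Xs) = map g (take p Xs)" "map f (drop p Xs) = map g (drop p Xs)"
    using Op(3) by (auto dest: in_set_takeD in_set_dropD)
  have "presented_op K PB q Xs = brace FB (take p Xs) (drop p Xs)" by (simp add: FB_simps q l)
  then show ?case using assms(6)[OF c] assms(7)[OF c] e by simp
qed (use assms(5) in \<open>simp_all add: PB_simps linear_map_add[OF assms(1)[unfolded linear_map_FB]]
  linear_map_add[OF assms(2)[unfolded linear_map_FB]] linear_map_smult[OF assms(1)[unfolded linear_map_FB]]
  linear_map_smult[OF assms(2)[unfolded linear_map_FB]]\<close>)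

end

section \<open>Transport of the bialgebra structure\<close>

lemma functional_smult_bilinear:
  assumes e: "linear_map K A (self_module K) e" and "module K A" "module K B"
  shows "bilinear K A B B (\<lambda>a b. e a \<odot>\<^bsub>B\<^esub> b)"
proof -
  interpret B: module K B by fact
  have "bilinear K (self_module K) B B (\<lambda>c b. c \<odot>\<^bsub>B\<^esub> b)"
    by (intro bilinearI linear_mapI)
      (simp_all add: self_module_def B.smult_l_distr B.smult_r_distr B.smult_assoc1[symmetric] B.R.m_comm)
  from bilinear_comp_args[OF this e linear_map_id] show ?thesis .
qed

lemma bilinear_flip: "bilinear K A B C f \<Longrightarrow> bilinear K B A C (\<lambda>b a. f a b)"
  by (simp add: bilinear_def)

lemma tensor_ext2:
  assumes f: "bilinear K (tensor K A B) C W f" and g: "bilinear K (tensor K A B) C W g"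
    and m: "module K A" "module K B" "module K W" and X: "X \<in> carrier (tensor K A B)" "c \<in> carrier C"
    and "\<And>a b. a \<in> carrier A \<Longrightarrow> b \<in> carrier B \<Longrightarrow> f (ptens K A B a b) c = g (ptens K A B a b) c"
  shows "f X c = g X c"
  using tensor_ext[OF bilinear_left[OF f X(2)] bilinear_left[OF g X(2)] m X(1)] assms(8) by blast

text \<open>Both composites are linear, so it suffices to compare them on tensors of three elements,
  reached by applying \<open>tensor_ext\<close> twice.\<close>

lemma tensor_assoc_natural:
  assumes m: "module K A" "module K B" and f: "linear_map K A B f"
    and X: "X \<in> carrier (tensor K (tensor K A A) A)"
  shows "tensor_assoc K B (map_tensor K (tensor K B B) B (map_tensor K B B f f) f X) =
    map_tensor K B (tensor K B B) f (map_tensor K B B f f) (tensor_assoc K A X)"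
proof -
  let ?AA = "tensor K A A" and ?BB = "tensor K B B"
  have mm: "module K ?AA" "module K ?BB" "module K (tensor K B ?BB)" by (simp_all add: m module_tensor)
  note ff = map_tensor_linear[OF m(1,1,2,2) f f]
  note lin1 = linear_map_comp[OF map_tensor_linear[OF mm(1) m(1) mm(2) m(2) ff f] tensor_assoc_linear[OF m(2)]]
  note lin2 = linear_map_comp[OF tensor_assoc_linear[OF m(1)] map_tensor_linear[OF m(1) mm(1) m(2) mm(2) f ff]]
  note fc = linear_map_closed[OF f]
  show ?thesis
  proof (rule tensor_ext[OF lin1 lin2 mm(1) m(1) mm(3) X])
    fix s c assume s: "s \<in> carrier ?AA" and c: "c \<in> carrier A"
    show "tensor_assoc K B (map_tensor K ?BB B (map_tensor K B B f f) f (ptens K ?AA A s c)) =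
      map_tensor K B ?BB f (map_tensor K B B f f) (tensor_assoc K A (ptens K ?AA A s c))"
    proof (rule tensor_ext[OF linear_map_comp[OF bilinear_left[OF ptens_bilinear[OF mm(1) m(1)] c] lin1]
          linear_map_comp[OF bilinear_left[OF ptens_bilinear[OF mm(1) m(1)] c] lin2] m(1,1) mm(3) s])
      fix a b assume "a \<in> carrier A" "b \<in> carrier A"
      then show "tensor_assoc K B (map_tensor K ?BB B (map_tensor K B B f f) f (ptens K ?AA A (ptens K A A a b) c)) =
        map_tensor K B ?BB f (map_tensor K B B f f) (tensor_assoc K A (ptens K ?AA A (ptens K A A a b) c))"
        using c fc
        by (simp add: map_tensor_ptens[OF mm(1) m(1) mm(2) m(2) ff f] map_tensor_ptens[OF m(1,1,2,2) f f]
          map_tensor_ptens[OF m(1) mm(1) m(2) mm(2) f ff] tensor_assoc_ptens m ptens_closed)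
    qed
  qed
qed

lemma tensor_mult_natural:
  assumes m: "module K A" "module K B" and f: "linear_map K A B f"
    and mA: "bilinear K A A A (mult A)" and mB: "bilinear K B B B (mult B)"
    and hom: "\<And>x y. x \<in> carrier A \<Longrightarrow> y \<in> carrier A \<Longrightarrow> f (x \<otimes>\<^bsub>A\<^esub> y) = f x \<otimes>\<^bsub>B\<^esub> f y"
    and s: "s \<in> carrier (tensor K A A)" and t: "t \<in> carrier (tensor K A A)"
  shows "map_tensor K B B f f (tensor_mult K A s t) =
    tensor_mult K B (map_tensor K B B f f s) (map_tensor K B B f f t)"
proof -
  let ?AA = "tensor K A A" and ?BB = "tensor K B B"
  have mm: "module K ?AA" "module K ?BB" by (simp_all add: m module_tensor)
  note ff = map_tensor_linear[OF m(1,1,2,2) f f]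
  note fc = linear_map_closed[OF f]
  note b1 = bilinear_comp[OF tensor_mult_bilinear[OF m(1) mA] ff]
  note b2 = bilinear_comp_args[OF tensor_mult_bilinear[OF m(2) mB] ff ff]
  show ?thesis
  proof (rule tensor_ext2[OF b1 b2 m(1,1) mm(2) s t])
    fix a b assume ab: "a \<in> carrier A" "b \<in> carrier A"
    have p: "ptens K A A a b \<in> carrier ?AA" using ab by (simp add: ptens_closed m)
    show "map_tensor K B B f f (tensor_mult K A (ptens K A A a b) t) =
      tensor_mult K B (map_tensor K B B f f (ptens K A A a b)) (map_tensor K B B f f t)"
    proof (rule tensor_ext[OF bilinear_right[OF b1 p] bilinear_right[OF b2 p] m(1,1) mm(2) t])
      fix a' b' assume "a' \<in> carrier A" "b' \<in> carrier A"
      then show "map_tensor K B B f f (tensor_mult K A (ptens K A A a b) (ptens K A A a' b')) =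
        tensor_mult K B (map_tensor K B B f f (ptens K A A a b)) (map_tensor K B B f f (ptens K A A a' b'))"
        using ab fc bilinear_closed[OF mA]
        by (simp add: tensor_mult_ptens[OF m(1) mA] tensor_mult_ptens[OF m(2) mB]
          map_tensor_ptens[OF m(1,1,2,2) f f] hom)
    qed
  qed
qed

text \<open>Applying \<open>e'\<close> to the left and \<open>e\<close> to the right factor of the
  coproduct of \<open>x\<close> gives \<open>e x\<close> by one counit law and \<open>e' x\<close>
  by the other.\<close>

lemma counit_unique:
  assumes "module K H" and D: "linear_map K H (tensor K H H) (comult H)"
    and e: "counit K H e" and e': "counit K H e'" and x: "x \<in> carrier H"
  shows "e x = e' x"
proof -
  note mH = assms(1)
  interpret H: module K H by fact
  have mK: "module K (self_module K)" by (rule module_self[OF module_cring[OF mH]])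
  have l: "linear_map K H (self_module K) e" "linear_map K H (self_module K) e'"
    using e e' by (simp_all add: counit_def)
  have ec: "e a \<in> carrier K" "e' a \<in> carrier K" if "a \<in> carrier H" for a
    using linear_map_closed[OF l(1) that] linear_map_closed[OF l(2) that] by (simp_all add: self_module_def)
  have t: "comult H x \<in> carrier (tensor K H H)" by (rule linear_map_closed[OF D x])
  note b1 = functional_smult_bilinear[OF l(2) mH mH]
  note b2 = bilinear_flip[OF functional_smult_bilinear[OF l(1) mH mH]]
  have "e x = e (lin_lift H (\<lambda>(a, b). e' a \<odot>\<^bsub>H\<^esub> b) (comult H x))"
    using e' x by (simp add: counit_def)
  also have "\<dots> = e' (lin_lift H (\<lambda>(a, b). e b \<odot>\<^bsub>H\<^esub> a) (comult H x))"
  proof (rule tensor_ext[OF linear_map_comp[OF tensor_lift_linear[OF b1 mH mH mH] l(1)]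
        linear_map_comp[OF tensor_lift_linear[OF b2 mH mH mH] l(2)] mH mH mK t])
    fix a b assume ab: "a \<in> carrier H" "b \<in> carrier H"
    then show "e (lin_lift H (\<lambda>(a, b). e' a \<odot>\<^bsub>H\<^esub> b) (ptens K H H a b)) =
      e' (lin_lift H (\<lambda>(a, b). e b \<odot>\<^bsub>H\<^esub> a) (ptens K H H a b))"
      using linear_map_smult[OF l(1), of "e' a" b] linear_map_smult[OF l(2), of "e b" a] ec
      by (simp add: tensor_lift_ptens[OF b1 mH mH mH] tensor_lift_ptens[OF b2 mH mH mH]
        self_module_def H.R.m_comm)
  qed
  also have "\<dots> = e' x" using e x by (simp add: counit_def)
  finally show ?thesis .
qed

lemma with_comult_simps [simp]:
  "carrier (with_comult A D) = carrier A" "mult (with_comult A D) = mult A" "one (with_comult A D) = one A"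
  "zero (with_comult A D) = zero A" "add (with_comult A D) = add A" "smult (with_comult A D) = smult A"
  "dot (with_comult A D) = dot A" "comult (with_comult A D) = D"
  by (simp_all add: with_comult_def)

lemma with_comult_struct [simp]:
  "tensor K (with_comult A D) B = tensor K A B" "tensor K B (with_comult A D) = tensor K B A"
  "ptens K (with_comult A D) B = ptens K A B" "ptens K B (with_comult A D) = ptens K B A"
  by (rule tensor_struct_cong; simp)+

lemma linear_map_with_comult [simp]:
  "linear_map K (with_comult A D) = linear_map K A" "linear_map K B (with_comult A D) = linear_map K B A"
  by (auto simp: linear_map_def fun_eq_iff)

lemma map_tensor_with_comult [simp]:
  "map_tensor K (with_comult A D) B = map_tensor K A B" "map_tensor K B (with_comult A D) = map_tensor K B A"
  by (simp_all add: map_tensor_def fun_eq_iff)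

lemma tensor_assoc_with_comult [simp]: "tensor_assoc K (with_comult A D) = tensor_assoc K A"
  by (simp add: tensor_assoc_def)

lemma tensor_mult_with_comult [simp]:
  "tensor_mult K (with_comult A D) = tensor_mult K A"
  "tensor_mult K (dot_alg (with_comult A D)) = tensor_mult K (dot_alg A)"
  by (simp_all add: tensor_mult_def fun_eq_iff)

lemma assoc_algebra_cong:
  assumes "assoc_algebra K A" "carrier B = carrier A" "mult B = mult A" "one B = one A"
    "zero B = zero A" "add B = add A" "smult B = smult A"
  shows "assoc_algebra K B"
proof -
  interpret A: ring A by (rule assoc_algebra_ring[OF assms(1)])
  note m = module_cong[OF assoc_algebra_module[OF assms(1)] assms(2,6,5,7)]
  have "bilinear K B B B (mult B)"
    using assoc_algebra_bilinear[OF assms(1)] by (simp add: bilinear_def linear_map_def assms)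
  with m show ?thesis by (rule assoc_algebraI) (simp_all add: assms A.m_assoc)
qed

text \<open>\<open>A\<close> carries no coproduct yet and receives one from \<open>H\<close> along
  the mutually inverse homomorphisms \<open>\<phi>\<close> and \<open>\<psi>\<close>. In the
  application \<open>A\<close> is the free 2-associative algebra and \<open>H\<close> consists of
  the words over the free B-infinity algebra.\<close>

locale transport = two_as_alg K A
  for K :: "('k, 'x) ring_scheme" and A :: "('k, 'a) two_as" +
  fixes H :: "('k, 'b, 'z) two_as_bialg_scheme" and \<phi> \<psi>
  assumes bialg: "two_as_bialgebra K H" and phi: "two_as_hom K A H \<phi>" and psi: "two_as_hom K H A \<psi>"
    and psi_phi: "x \<in> carrier A \<Longrightarrow> \<psi> (\<phi> x) = x" and phi_psi: "y \<in> carrier H \<Longrightarrow> \<phi> (\<psi> y) = y"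
begin

lemma H_algebras: "assoc_algebra K H" "assoc_algebra K (dot_alg H)"
  using bialg by (simp_all add: two_as_bialgebra_def bialgebra_def inf_bialgebra_def)

lemmas mH' = assoc_algebra_module[OF H_algebras(1)]
lemmas H_bilinear = assoc_algebra_bilinear[OF H_algebras(1)]
lemmas H_dot_bilinear = assoc_algebra_bilinear[OF H_algebras(2)]

lemma phi_linear: "linear_map K A H \<phi>" and psi_linear: "linear_map K H A \<psi>"
  using phi psi by (simp_all add: two_as_hom_def)

lemmas phi_closed = linear_map_closed[OF phi_linear]
lemmas psi_closed = linear_map_closed[OF psi_linear]
lemmas psi2 = map_tensor_linear[OF mH' mH' mA mA psi_linear psi_linear]

lemma coassoc_H: "coassociative K H"
  using bialg by (simp add: two_as_bialgebra_def bialgebra_def)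

lemma comult_linear: "linear_map K H (tensor K H H) (comult H)"
  using coassoc_H by (simp add: coassociative_def)

lemmas comult_closed = linear_map_closed[OF comult_linear]

text \<open>Restricted to the carrier because the coproduct of the free 2-associative algebra is
  specified to be extensional.\<close>

definition D where "D = restrict (\<lambda>x. map_tensor K A A \<psi> \<psi> (comult H (\<phi> x))) (carrier A)"

lemma D_eq: "x \<in> carrier A \<Longrightarrow> D x = map_tensor K A A \<psi> \<psi> (comult H (\<phi> x))"
  by (simp add: D_def)

lemma D_psi: "y \<in> carrier H \<Longrightarrow> D (\<psi> y) = map_tensor K A A \<psi> \<psi> (comult H y)"
  by (simp add: D_eq psi_closed phi_psi)

lemma D_linear: "linear_map K A (tensor K A A) D"
  using linear_map_cong[OF linear_map_comp[OF linear_map_comp[OF phi_linear comult_linear] psi2] _ mA, of D]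
  by (simp add: D_eq)

abbreviation "HA \<equiv> with_comult A D"

text \<open>\<open>D\<close> after \<open>\<psi>\<close> is the coproduct of \<open>H\<close>
  followed by \<open>\<psi>\<close> on both factors. Either side of coassociativity for
  \<open>D\<close> is therefore the image under \<open>\<psi>\<close> of the corresponding side for
  \<open>H\<close>.\<close>

lemma coassociative_HA: "coassociative K HA"
proof -
  let ?AA = "tensor K A A" and ?HH = "tensor K H H"
  have mm: "module K ?AA" "module K ?HH" by (simp_all add: mA mH' module_tensor)
  have "tensor_assoc K A (map_tensor K ?AA A D id (D x)) = map_tensor K A ?AA id D (D x)"
    if x: "x \<in> carrier A" for x
  proof -
    let ?t = "comult H (\<phi> x)"
    have t: "?t \<in> carrier ?HH" using x by (intro comult_closed phi_closed)
    have cl: "map_tensor K ?HH H (comult H) id ?t \<in> carrier (tensor K ?HH H)"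
      by (rule map_tensor_closed[OF mH' mH' mm(2) mH' comult_linear linear_map_id' t])
    have "map_tensor K ?AA A D id (D x) = map_tensor K ?AA A (\<lambda>a. D (\<psi> a)) (\<lambda>a. id (\<psi> a)) ?t"
      unfolding D_eq[OF x]
      by (rule map_tensor_comp[OF mH' mH' mA mA mm(1) mA psi_linear psi_linear D_linear linear_map_id' t])
    also have "\<dots> = map_tensor K ?AA A (\<lambda>a. map_tensor K A A \<psi> \<psi> (comult H a)) (\<lambda>a. \<psi> (id a)) ?t"
      by (rule map_tensor_cong[OF mH' mH' t]) (simp_all add: D_psi)
    also have "\<dots> = map_tensor K ?AA A (map_tensor K A A \<psi> \<psi>) \<psi> (map_tensor K ?HH H (comult H) id ?t)"
      by (rule map_tensor_comp[OF mH' mH' mm(2) mH' mm(1) mA comult_linear linear_map_id' psi2 psi_linear t, symmetric])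
    finally have "tensor_assoc K A (map_tensor K ?AA A D id (D x)) =
        map_tensor K A ?AA \<psi> (map_tensor K A A \<psi> \<psi>) (tensor_assoc K H (map_tensor K ?HH H (comult H) id ?t))"
      using tensor_assoc_natural[OF mH' mA psi_linear cl] by simp
    also have "tensor_assoc K H (map_tensor K ?HH H (comult H) id ?t) = map_tensor K H ?HH id (comult H) ?t"
      using coassoc_H phi_closed[OF x] by (simp add: coassociative_def)
    also have "map_tensor K A ?AA \<psi> (map_tensor K A A \<psi> \<psi>) (map_tensor K H ?HH id (comult H) ?t) =
        map_tensor K A ?AA (\<lambda>a. \<psi> (id a)) (\<lambda>a. map_tensor K A A \<psi> \<psi> (comult H a)) ?t"
      by (rule map_tensor_comp[OF mH' mH' mH' mm(2) mA mm(1) linear_map_id' comult_linear psi_linear psi2 t])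
    also have "\<dots> = map_tensor K A ?AA (\<lambda>a. id (\<psi> a)) (\<lambda>a. D (\<psi> a)) ?t"
      by (rule map_tensor_cong[OF mH' mH' t]) (simp_all add: D_psi)
    also have "\<dots> = map_tensor K A ?AA id D (D x)"
      unfolding D_eq[OF x]
      by (rule map_tensor_comp[OF mH' mH' mA mA mA mm(1) psi_linear psi_linear linear_map_id' D_linear t, symmetric])
    finally show ?thesis .
  qed
  then show ?thesis using D_linear by (simp add: coassociative_def)
qed

lemma counit_HA:
  assumes e: "counit K H e"
  shows "counit K HA (\<lambda>x. e (\<phi> x))"
proof -
  have l: "linear_map K H (self_module K) e" using e by (simp add: counit_def)
  have l': "linear_map K A (self_module K) (\<lambda>x. e (\<phi> x))" by (rule linear_map_comp[OF phi_linear l])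
  have ec: "e a \<in> carrier K" if "a \<in> carrier H" for a
    using linear_map_closed[OF l that] by (simp add: self_module_def)
  note b = functional_smult_bilinear[OF l mH' mH'] and b' = functional_smult_bilinear[OF l' mA mA]
  note c = bilinear_flip[OF b] and c' = bilinear_flip[OF b']
  have "lin_lift A (\<lambda>(a, b). e (\<phi> a) \<odot>\<^bsub>A\<^esub> b) (D x) = x \<and> lin_lift A (\<lambda>(a, b). e (\<phi> b) \<odot>\<^bsub>A\<^esub> a) (D x) = x"
    if x: "x \<in> carrier A" for x
  proof
    let ?t = "comult H (\<phi> x)"
    have t: "?t \<in> carrier (tensor K H H)" using x by (intro comult_closed phi_closed)
    have "lin_lift A (\<lambda>(a, b). e (\<phi> a) \<odot>\<^bsub>A\<^esub> b) (map_tensor K A A \<psi> \<psi> ?t) = \<psi> (lin_lift H (\<lambda>(a, b). e a \<odot>\<^bsub>H\<^esub> b) ?t)"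
    proof (rule tensor_ext[OF linear_map_comp[OF psi2 tensor_lift_linear[OF b' mA mA mA]]
          linear_map_comp[OF tensor_lift_linear[OF b mH' mH' mH'] psi_linear] mH' mH' mA t])
      fix u v assume "u \<in> carrier H" "v \<in> carrier H"
      then show "lin_lift A (\<lambda>(a, b). e (\<phi> a) \<odot>\<^bsub>A\<^esub> b) (map_tensor K A A \<psi> \<psi> (ptens K H H u v)) =
          \<psi> (lin_lift H (\<lambda>(a, b). e a \<odot>\<^bsub>H\<^esub> b) (ptens K H H u v))"
        using linear_map_smult[OF psi_linear ec]
        by (simp add: map_tensor_ptens[OF mH' mH' mA mA psi_linear psi_linear] psi_closed phi_psi
          tensor_lift_ptens[OF b' mA mA mA] tensor_lift_ptens[OF b mH' mH' mH'])
    qed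
    then show "lin_lift A (\<lambda>(a, b). e (\<phi> a) \<odot>\<^bsub>A\<^esub> b) (D x) = x"
      using e x phi_closed[OF x] by (simp add: D_eq counit_def psi_phi)
    have "lin_lift A (\<lambda>(a, b). e (\<phi> b) \<odot>\<^bsub>A\<^esub> a) (map_tensor K A A \<psi> \<psi> ?t) = \<psi> (lin_lift H (\<lambda>(a, b). e b \<odot>\<^bsub>H\<^esub> a) ?t)"
    proof (rule tensor_ext[OF linear_map_comp[OF psi2 tensor_lift_linear[OF c' mA mA mA]]
          linear_map_comp[OF tensor_lift_linear[OF c mH' mH' mH'] psi_linear] mH' mH' mA t])
      fix u v assume "u \<in> carrier H" "v \<in> carrier H"
      then show "lin_lift A (\<lambda>(a, b). e (\<phi> b) \<odot>\<^bsub>A\<^esub> a) (map_tensor K A A \<psi> \<psi> (ptens K H H u v)) =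
          \<psi> (lin_lift H (\<lambda>(a, b). e b \<odot>\<^bsub>H\<^esub> a) (ptens K H H u v))"
        using linear_map_smult[OF psi_linear ec]
        by (simp add: map_tensor_ptens[OF mH' mH' mA mA psi_linear psi_linear] psi_closed phi_psi
          tensor_lift_ptens[OF c' mA mA mA] tensor_lift_ptens[OF c mH' mH' mH'])
    qed
    then show "lin_lift A (\<lambda>(a, b). e (\<phi> b) \<odot>\<^bsub>A\<^esub> a) (D x) = x"
      using e x phi_closed[OF x] by (simp add: D_eq counit_def psi_phi)
  qed
  then show ?thesis
    using l' by (simp add: counit_def lin_lift_struct_cong[of HA A])
qed

lemma psi2_ptens: "u \<in> carrier H \<Longrightarrow> v \<in> carrier H \<Longrightarrow>
    map_tensor K A A \<psi> \<psi> (ptens K H H u v) = ptens K A A (\<psi> u) (\<psi> v)"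
  by (rule map_tensor_ptens[OF mH' mH' mA mA psi_linear psi_linear])

lemma two_as_bialgebra_HA: "two_as_bialgebra K HA"
proof -
  interpret HR: ring H by (rule assoc_algebra_ring[OF H_algebras(1)])
  have hom: "\<phi> \<one>\<^bsub>A\<^esub> = \<one>\<^bsub>H\<^esub>" "\<psi> \<one>\<^bsub>H\<^esub> = \<one>\<^bsub>A\<^esub>"
    "\<And>x y. x \<in> carrier A \<Longrightarrow> y \<in> carrier A \<Longrightarrow> \<phi> (x \<otimes>\<^bsub>A\<^esub> y) = \<phi> x \<otimes>\<^bsub>H\<^esub> \<phi> y"
    "\<And>x y. x \<in> carrier A \<Longrightarrow> y \<in> carrier A \<Longrightarrow> \<phi> (dot A x y) = dot H (\<phi> x) (\<phi> y)"
    "\<And>x y. x \<in> carrier H \<Longrightarrow> y \<in> carrier H \<Longrightarrow> \<psi> (x \<otimes>\<^bsub>H\<^esub> y) = \<psi> x \<otimes>\<^bsub>A\<^esub> \<psi> y"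
    "\<And>x y. x \<in> carrier H \<Longrightarrow> y \<in> carrier H \<Longrightarrow> \<psi> (dot H x y) = dot A (\<psi> x) (\<psi> y)"
    using phi psi by (simp_all add: two_as_hom_def)
  obtain e where e: "counit K H e" "e \<one>\<^bsub>H\<^esub> = \<one>\<^bsub>K\<^esub>"
    "\<And>x y. x \<in> carrier H \<Longrightarrow> y \<in> carrier H \<Longrightarrow> e (x \<otimes>\<^bsub>H\<^esub> y) = e x \<otimes>\<^bsub>K\<^esub> e y"
    using bialg by (auto simp: two_as_bialgebra_def bialgebra_def)
  have H1: "comult H \<one>\<^bsub>H\<^esub> = ptens K H H \<one>\<^bsub>H\<^esub> \<one>\<^bsub>H\<^esub>"
    using bialg by (simp add: two_as_bialgebra_def bialgebra_def)
  have D_one: "D \<one>\<^bsub>A\<^esub> = ptens K A A \<one>\<^bsub>A\<^esub> \<one>\<^bsub>A\<^esub>"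
    by (simp add: D_eq hom H1 psi2_ptens)
  have D_mult: "D (x \<otimes>\<^bsub>A\<^esub> y) = tensor_mult K A (D x) (D y)" if xy: "x \<in> carrier A" "y \<in> carrier A" for x y
  proof -
    have "D (x \<otimes>\<^bsub>A\<^esub> y) = map_tensor K A A \<psi> \<psi> (comult H (\<phi> x \<otimes>\<^bsub>H\<^esub> \<phi> y))"
      using xy by (simp add: D_eq hom)
    also have "comult H (\<phi> x \<otimes>\<^bsub>H\<^esub> \<phi> y) = tensor_mult K H (comult H (\<phi> x)) (comult H (\<phi> y))"
      using bialg xy by (simp add: two_as_bialgebra_def bialgebra_def phi_closed)
    also have "map_tensor K A A \<psi> \<psi> \<dots> = tensor_mult K A (D x) (D y)"
      unfolding D_eq[OF xy(1)] D_eq[OF xy(2)]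
      by (rule tensor_mult_natural[OF mH' mA psi_linear H_bilinear star_bilinear hom(5)])
        (simp_all add: xy comult_closed phi_closed)
    finally show ?thesis .
  qed
  have D_dot: "D (dot A x y) = tensor_mult K (dot_alg A) (ptens K A A x \<one>\<^bsub>A\<^esub>) (D y)
      \<oplus>\<^bsub>tensor K A A\<^esub> tensor_mult K (dot_alg A) (D x) (ptens K A A \<one>\<^bsub>A\<^esub> y) \<ominus>\<^bsub>tensor K A A\<^esub> ptens K A A x y"
    if xy: "x \<in> carrier A" "y \<in> carrier A" for x y
  proof -
    let ?HH = "tensor K H H" and ?m = "tensor_mult K (dot_alg H)" and ?f = "map_tensor K A A \<psi> \<psi>"
    have mm: "module K ?HH" "module K (tensor K A A)" by (simp_all add: mA mH' module_tensor)
    interpret HH: module K ?HH by (rule mm(1))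
    have p: "\<phi> x \<in> carrier H" "\<phi> y \<in> carrier H" using xy by (simp_all add: phi_closed)
    have c: "ptens K H H (\<phi> x) \<one>\<^bsub>H\<^esub> \<in> carrier ?HH" "ptens K H H \<one>\<^bsub>H\<^esub> (\<phi> y) \<in> carrier ?HH"
      "ptens K H H (\<phi> x) (\<phi> y) \<in> carrier ?HH" "comult H (\<phi> x) \<in> carrier ?HH" "comult H (\<phi> y) \<in> carrier ?HH"
      using p by (simp_all add: ptens_closed mH' comult_closed)
    \<comment> \<open>Naturality is applied to \<open>dot_alg\<close>, where the second product is
      the multiplication of the record.\<close>
    have nat: "?f (?m s t) = tensor_mult K (dot_alg A) (?f s) (?f t)"
      if "s \<in> carrier ?HH" "t \<in> carrier ?HH" for s t
      using tensor_mult_natural[of K "dot_alg H" "dot_alg A" \<psi> s t] that H_dot_bilinear dot_bilinear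
      by (simp add: module_dot_alg mH' mA psi_linear hom map_tensor_def)
    have mc: "?m s t \<in> carrier ?HH" if "s \<in> carrier ?HH" "t \<in> carrier ?HH" for s t
      using bilinear_closed[OF tensor_mult_bilinear[OF module_dot_alg[OF mH'] H_dot_bilinear]] that by simp
    have "D (dot A x y) = ?f (comult H (dot H (\<phi> x) (\<phi> y)))"
      using xy by (simp add: D_eq hom dot_closed)
    also have "comult H (dot H (\<phi> x) (\<phi> y)) = ?m (ptens K H H (\<phi> x) \<one>\<^bsub>H\<^esub>) (comult H (\<phi> y))
        \<oplus>\<^bsub>?HH\<^esub> ?m (comult H (\<phi> x)) (ptens K H H \<one>\<^bsub>H\<^esub> (\<phi> y)) \<ominus>\<^bsub>?HH\<^esub> ptens K H H (\<phi> x) (\<phi> y)"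
      using bialg p by (simp add: two_as_bialgebra_def inf_bialgebra_def)
    also have "?f \<dots> = ?f (?m (ptens K H H (\<phi> x) \<one>\<^bsub>H\<^esub>) (comult H (\<phi> y)))
        \<oplus>\<^bsub>tensor K A A\<^esub> ?f (?m (comult H (\<phi> x)) (ptens K H H \<one>\<^bsub>H\<^esub> (\<phi> y)))
        \<ominus>\<^bsub>tensor K A A\<^esub> ?f (ptens K H H (\<phi> x) (\<phi> y))"
      using c by (simp add: linear_map_minus[OF psi2 mm] linear_map_add[OF psi2] mc)
    also have "\<dots> = tensor_mult K (dot_alg A) (ptens K A A x \<one>\<^bsub>A\<^esub>) (D y)
      \<oplus>\<^bsub>tensor K A A\<^esub> tensor_mult K (dot_alg A) (D x) (ptens K A A \<one>\<^bsub>A\<^esub> y) \<ominus>\<^bsub>tensor K A A\<^esub> ptens K A A x y"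
      using c p xy by (simp add: nat psi2_ptens psi_phi hom D_eq)
    finally show ?thesis .
  qed
  have "bialgebra K HA"
    unfolding bialgebra_def
  proof (intro conjI exI[of _ "\<lambda>x. e (\<phi> x)"])
    show "assoc_algebra K HA" by (rule assoc_algebra_cong[OF star_algebra]) simp_all
  qed (simp_all add: coassociative_HA counit_HA e hom phi_closed D_one D_mult)
  moreover have "inf_bialgebra K (dot_alg HA)"
    unfolding inf_bialgebra_def
  proof (intro conjI exI[of _ "\<lambda>x. e (\<phi> x)"])
    show "assoc_algebra K (dot_alg HA)" by (rule assoc_algebra_cong[OF dot_algebra]) simp_all
  qed (simp_all add: coassociative_HA counit_HA e D_dot)
  ultimately show ?thesis by (simp add: two_as_bialgebra_def)
qed

lemma comult_phi:
  assumes x: "x \<in> carrier A"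
  shows "comult H (\<phi> x) = map_tensor K H H \<phi> \<phi> (D x)"
proof -
  have t: "comult H (\<phi> x) \<in> carrier (tensor K H H)" using x by (intro comult_closed phi_closed)
  show ?thesis
    unfolding D_eq[OF x]
      map_tensor_comp[OF mH' mH' mA mA mH' mH' psi_linear psi_linear phi_linear phi_linear t]
    by (rule map_tensor_id[OF mH' mH' t, symmetric]) (simp_all add: phi_psi)
qed

lemma iso_HA: "two_as_bialg_iso K HA H \<phi>"
proof -
  have b: "bij_betw \<phi> (carrier A) (carrier H)"
    by (rule bij_betw_byWitness[of _ \<psi>]) (auto simp: psi_phi phi_psi phi_closed psi_closed)
  \<comment> \<open>The isomorphism has to respect arbitrary counits; a counit of \<open>H\<close>
    composed with \<open>\<phi>\<close> is one of \<open>HA\<close>, and a counit is unique.\<close>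
  have c: "e' (\<phi> x) = e x" if "counit K HA e" "counit K H e'" "x \<in> carrier A" for e e' x
    using counit_unique[of K HA "\<lambda>x. e' (\<phi> x)" e x] counit_HA[OF that(2)] that D_linear
      module_cong[OF mA, of HA] by simp
  show ?thesis
    unfolding two_as_bialg_iso_def
    using bialg two_as_bialgebra_HA b c phi comult_phi by (simp add: two_as_hom_def)
qed

lemma Prim_HA:
  assumes x: "x \<in> carrier A"
  shows "x \<in> Prim K HA \<longleftrightarrow> \<phi> x \<in> Prim K H"
proof -
  interpret HR: ring H by (rule assoc_algebra_ring[OF H_algebras(1)])
  have hom: "\<phi> \<one>\<^bsub>A\<^esub> = \<one>\<^bsub>H\<^esub>" "\<psi> \<one>\<^bsub>H\<^esub> = \<one>\<^bsub>A\<^esub>" using phi psi by (simp_all add: two_as_hom_def)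
  note phi2 = map_tensor_linear[OF mA mA mH' mH' phi_linear phi_linear]
  have pt: "map_tensor K H H \<phi> \<phi> (ptens K A A u v) = ptens K H H (\<phi> u) (\<phi> v)"
    if "u \<in> carrier A" "v \<in> carrier A" for u v
    using map_tensor_ptens[OF mA mA mH' mH' phi_linear phi_linear that] .
  show ?thesis
  proof
    assume "x \<in> Prim K HA"
    then have "D x = ptens K A A x \<one>\<^bsub>A\<^esub> \<oplus>\<^bsub>tensor K A A\<^esub> ptens K A A \<one>\<^bsub>A\<^esub> x" by (simp add: Prim_def)
    then show "\<phi> x \<in> Prim K H"
      using x by (simp add: Prim_def phi_closed comult_phi linear_map_add[OF phi2] ptens_closed mA pt hom)
  next
    assume "\<phi> x \<in> Prim K H"
    then have "comult H (\<phi> x) = ptens K H H (\<phi> x) \<one>\<^bsub>H\<^esub> \<oplus>\<^bsub>tensor K H H\<^esub> ptens K H H \<one>\<^bsub>H\<^esub> (\<phi> x)"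
      by (simp add: Prim_def)
    then show "x \<in> Prim K HA"
      using x by (simp add: Prim_def D_eq linear_map_add[OF psi2] ptens_closed mH' phi_closed psi2_ptens hom psi_phi)
  qed
qed

end

lemma two_as_hom_comp:
  assumes f: "two_as_hom K A B f" and g: "two_as_hom K B C g"
  shows "two_as_hom K A C (\<lambda>x. g (f x))"
proof -
  have "linear_map K A B f" using f by (simp add: two_as_hom_def)
  note linear_map_closed[OF this]
  with f g show ?thesis using linear_map_comp[of K A B f C g] by (simp add: two_as_hom_def)
qed

section \<open>The isomorphism\<close>

lemma (in vspace) free_two_as_ext:
  assumes f: "two_as_hom K A2 W f" and g: "two_as_hom K A2 W g" and "module K W" and "X \<in> carrier A2"
    and "\<And>v. v \<in> carrier V \<Longrightarrow> f (gen2 v) = g (gen2 v)"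
  shows "f X = g X"
proof -
  have l: "linear_map K A2 W f" "linear_map K A2 W g" using f g by (simp_all add: two_as_hom_def)
  show ?thesis using assms(4)
  proof (induction rule: free_two_as_induct)
    case Zero
    then show ?case
      using linear_map_zero[OF l(1) module_A2 assms(3)] linear_map_zero[OF l(2) module_A2 assms(3)] by simp
  next
    case (Plus X Y)
    then show ?case using linear_map_add[OF l(1)] linear_map_add[OF l(2)] by simp
  next
    case (Scale c X)
    then show ?case using linear_map_smult[OF l(1)] linear_map_smult[OF l(2)] by simp
  qed (use f g assms(5) in \<open>simp_all add: two_as_hom_def\<close>)
qed

lemma (in vspace) free_two_as_iso_words:
  "\<exists>\<phi> \<psi>. two_as_hom K A2 (Tfc K FB) \<phi> \<and> two_as_hom K (Tfc K FB) A2 \<psi> \<and>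
    (\<forall>x\<in>carrier A2. \<psi> (\<phi> x) = x) \<and> (\<forall>y\<in>carrier (Tfc K FB). \<phi> (\<psi> y) = y) \<and>
    (\<forall>v\<in>carrier V. \<phi> (gen2 v) = word K FB [genB v])"
proof -
  interpret B: binf K FB by (rule binf_FB)
  interpret A: two_as_alg K A2 by (rule two_as_alg_A2)
  interpret T: two_as_alg K "Tfc K FB" by (rule B.two_as_alg_Tfc)
  have w1: "linear_map K FB (Tfc K FB) (\<lambda>r. B.w [r])"
    using multilinear_linear[OF B.w_multilinear, of "[]" "[]"] by (simp add: B.linear_map_Tfc)
  obtain \<phi> where phi: "two_as_hom K A2 (Tfc K FB) \<phi>" and phi_gen: "\<And>v. v \<in> carrier V \<Longrightarrow> \<phi> (gen2 v) = B.w [genB v]"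
    using free_two_as_universal[OF B.two_as_alg_Tfc linear_map_comp[OF genB_linear w1]] by blast
  have "linear_map K V A.Br gen2" using gen2_linear by (simp add: A.linear_map_Br)
  \<comment> \<open>Here it is used that the braces of a 2-associative algebra satisfy the
    B-infinity relation. The map \<open>j\<close> realizes iterated braces of generators inside the
    free 2-associative algebra.\<close>
  from free_binf_universal[OF A.binf_Br this] obtain j where
    j: "linear_map K FB A2 j" "\<And>v. v \<in> carrier V \<Longrightarrow> j (genB v) = gen2 v"
    "\<And>us vs. us \<in> B.L \<Longrightarrow> vs \<in> B.L \<Longrightarrow> j (brace FB us vs) = two_as_brace A2 (map j us) (map j vs)"
    by (auto simp: A.linear_map_Br A.Br_simps)
  note jc = linear_map_closed[OF j(1)]
  have jl: "map j us \<in> lists (carrier A2)" if "us \<in> B.L" for us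
    using that jc by (auto simp: in_lists_conv_set)
  have ml: "multilinear K FB A2 (\<lambda>us. dots A2 (map j us))"
  proof (rule multilinearI)
    fix us vs assume "us \<in> B.L" "vs \<in> B.L"
    then show "linear_map K FB A2 (\<lambda>x. dots A2 (map j (us @ x # vs)))"
      using linear_map_comp[OF j(1) multilinear_linear[OF A.dots_multilinear jl jl]] by simp
  qed (intro A.dots_closed jl)
  \<comment> \<open>\<open>j\<close> on each letter, followed by the evaluation of words through the
    second product.\<close>
  define \<psi> where "\<psi> = lin_lift A2 (\<lambda>us. dots A2 (map j us))"
  have psi_linear: "linear_map K B.T A2 \<psi>"
    unfolding \<psi>_def by (rule words_lift_linear[OF ml B.mR A.mA])
  have psi_word: "\<psi> (B.w us) = dots A2 (map j us)" if "us \<in> B.L" for us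
    unfolding \<psi>_def by (rule words_lift_word[OF ml B.mR A.mA that])
  \<comment> \<open>Applying \<open>j\<close> to all letters takes blocks to blocks, which reduces
    multiplicativity of \<open>\<psi>\<close> to that of the evaluation \<open>A.ev\<close>.\<close>
  have psi_star: "\<psi> (B.star us vs) = dots A2 (map j us) \<otimes>\<^bsub>A2\<^esub> dots A2 (map j vs)"
    if uv: "us \<in> B.L" "vs \<in> B.L" for us vs
  proof -
    have b: "\<psi> (B.w (brace_blocks (brace FB) ij us vs)) =
        A.ev (A.W.w (brace_blocks (brace A.Br) ij (map j us) (map j vs)))"
      if ij: "ij \<in> set (tuple_pairs k (length us) (length vs))" for ij k
    proof -
      obtain a b where ab: "ij = (a, b)" by fastforce
      have "map j (brace_blocks (brace FB) (a, b) us vs) = brace_blocks (brace A.Br) (a, b) (map j us) (map j vs)"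
        by (rule brace_blocks_map[OF _ uv]) (use ij ab in \<open>simp_all add: in_set_tuple_pairs j(3) A.Br_simps\<close>)
      then show ?thesis
        using B.blocks_closed[OF uv ij] jl[OF B.blocks_closed[OF uv ij]] by (simp add: ab psi_word A.ev_word)
    qed
    have L: "map j us \<in> A.W.L" "map j vs \<in> A.W.L" using jl uv by (simp_all add: A.Br_simps)
    have "\<psi> (B.star us vs) = A.ev (A.W.star (map j us) (map j vs))"
      unfolding B.linear_map_lsum_star[OF psi_linear A.mA uv] A.W.linear_map_lsum_star[OF A.ev_linear A.mA L] length_map
      by (intro arg_cong[where f = "lsum A2"] arg_cong[where f = concat] map_cong HOL.refl b)
    then show ?thesis using A.ev_star jl uv by simp
  qed
  have psi: "two_as_hom K (Tfc K FB) A2 \<psi>"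
  proof -
    have "\<psi> (B.mul X Y) = \<psi> X \<otimes>\<^bsub>A2\<^esub> \<psi> Y" if "X \<in> carrier B.T" "Y \<in> carrier B.T" for X Y
      by (rule B.bilinear_words_ext[OF bilinear_comp[OF B.mul_bilinear psi_linear]
          bilinear_comp_args[OF A.star_bilinear psi_linear psi_linear] A.mA that])
        (simp add: B.mul_word psi_star psi_word)
    moreover have "\<psi> (B.conc X Y) = dot A2 (\<psi> X) (\<psi> Y)" if "X \<in> carrier B.T" "Y \<in> carrier B.T" for X Y
      by (rule B.bilinear_words_ext[OF bilinear_comp[OF B.conc_bilinear psi_linear]
          bilinear_comp_args[OF A.dot_bilinear psi_linear psi_linear] A.mA that])
        (simp add: B.conc_word psi_word A.dots_append jl)
    ultimately show ?thesis
      using psi_linear by (simp add: two_as_hom_def B.Tfc_simps B.linear_map_Tfc psi_word A.dots_simps)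
  qed
  have psi_phi: "\<psi> (\<phi> x) = x" if "x \<in> carrier A2" for x
  proof (rule free_two_as_ext[OF two_as_hom_comp[OF phi psi] _ A.mA that])
    show "two_as_hom K A2 A2 (\<lambda>x. x)" by (simp add: two_as_hom_def linear_map_id)
    fix v assume "v \<in> carrier V"
    then show "\<psi> (\<phi> (gen2 v)) = gen2 v"
      by (simp add: phi_gen psi_word genB_closed j(2) A.dots_simps A.dot_one gen2_closed)
  qed
  have phi_linear: "linear_map K A2 (Tfc K FB) \<phi>" using phi by (simp add: two_as_hom_def)
  \<comment> \<open>Words are products of their letters under concatenation, so the composite need
    only be known on letters. There \<open>\<phi>\<close> after \<open>j\<close> and the inclusion
    of letters both preserve braces, the former by \<open>two_as_hom_brace\<close> and the latter by
    \<open>brace_letters\<close>, and they agree on generators.\<close>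
  have phi_j: "\<phi> (j r) = B.w [r]" if "r \<in> carrier FB" for r
  proof (rule free_binf_ext[OF linear_map_comp[OF j(1) phi_linear] w1 B.mH that,
        where m = "two_as_brace (Tfc K FB)"])
    show "\<phi> (j (genB v)) = B.w [genB v]" if "v \<in> carrier V" for v
      using that by (simp add: j(2) phi_gen)
    fix us vs assume uv: "us \<in> B.L" "vs \<in> B.L"
    show "\<phi> (j (brace FB us vs)) = two_as_brace (Tfc K FB) (map (\<lambda>a. \<phi> (j a)) us) (map (\<lambda>a. \<phi> (j a)) vs)"
      using two_as_hom_brace[OF phi two_as_alg_A2 B.two_as_alg_Tfc jl[OF uv(1)] jl[OF uv(2)]] uv
      by (simp add: j(3) o_def)
    show "B.w [brace FB us vs] = two_as_brace (Tfc K FB) (map (\<lambda>r. B.w [r]) us) (map (\<lambda>r. B.w [r]) vs)"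
      using B.brace_letters[OF uv] by simp
  qed
  have phi_psi: "\<phi> (\<psi> y) = y" if y: "y \<in> carrier (Tfc K FB)" for y
  proof (rule words_ext[OF linear_map_comp[OF psi_linear phi_linear[unfolded B.linear_map_Tfc]] linear_map_id B.mR B.mT])
    show "y \<in> carrier B.T" using y by (simp add: B.Tfc_simps)
    fix us assume us: "us \<in> B.L"
    have "map \<phi> (map j us) = map (\<lambda>r. B.w [r]) us"
      using us phi_j by (simp add: in_lists_conv_set)
    then show "\<phi> (\<psi> (B.w us)) = B.w us"
      by (simp only: psi_word[OF us] two_as_hom_dots[OF phi two_as_alg_A2 jl[OF us]] B.dots_letters[OF us])
  qed
  show ?thesis using phi psi psi_phi phi_psi phi_gen by blast
qed

text \<open>The two compatibilities express the coproduct of either product through the coproducts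
  of its factors, and the value on the unit is prescribed; so agreement spreads from
  \<open>V\<close> by induction.\<close>

lemma (in vspace) comult_unique:
  assumes D: "two_as_bialgebra K (with_comult A2 D)" "\<And>v. v \<in> carrier V \<Longrightarrow> gen2 v \<in> Prim K (with_comult A2 D)"
    and D': "two_as_bialgebra K (with_comult A2 D')" "\<And>v. v \<in> carrier V \<Longrightarrow> gen2 v \<in> Prim K (with_comult A2 D')"
    and "x \<in> carrier A2"
  shows "D x = D' x"
proof -
  have l: "linear_map K A2 (tensor K A2 A2) D" "linear_map K A2 (tensor K A2 A2) D'"
    using D(1) D'(1) by (simp_all add: two_as_bialgebra_def bialgebra_def coassociative_def)
  have mt: "module K (tensor K A2 A2)" by (simp add: module_tensor module_A2)
  show ?thesis using assms(5)
  proof (induction rule: free_two_as_induct)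
    case (Gen v)
    then show ?case using D(2) D'(2) by (simp add: Prim_def)
  next
    case Zero
    then show ?case
      using linear_map_zero[OF l(1) module_A2 mt] linear_map_zero[OF l(2) module_A2 mt] by simp
  next
    case (Plus X Y)
    then show ?case using linear_map_add[OF l(1)] linear_map_add[OF l(2)] by simp
  next
    case (Scale c X)
    then show ?case using linear_map_smult[OF l(1)] linear_map_smult[OF l(2)] by simp
  next
    case One
    then show ?case using D(1) D'(1) by (simp add: two_as_bialgebra_def bialgebra_def)
  next
    case (Star X Y)
    then show ?case using D(1) D'(1) by (simp add: two_as_bialgebra_def bialgebra_def)
  next
    case (Dot X Y)
    then show ?case using D(1) D'(1) by (simp add: two_as_bialgebra_def inf_bialgebra_def)
  qed
qed

text \<open>All identities are inherited, since \<open>binf_left\<close> and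
  \<open>binf_right\<close> do not refer to the carrier. Additive inverses stay in \<open>P\<close>
  as multiples by minus one.\<close>

lemma binf_algebra_restrict:
  assumes R: "binf_algebra K R" and P: "P \<subseteq> carrier R" "\<zero>\<^bsub>R\<^esub> \<in> P"
    and add: "\<And>x y. x \<in> P \<Longrightarrow> y \<in> P \<Longrightarrow> x \<oplus>\<^bsub>R\<^esub> y \<in> P"
    and smult: "\<And>c x. c \<in> carrier K \<Longrightarrow> x \<in> P \<Longrightarrow> c \<odot>\<^bsub>R\<^esub> x \<in> P"
    and brace: "\<And>us vs. us \<in> lists P \<Longrightarrow> vs \<in> lists P \<Longrightarrow> brace R us vs \<in> P"
  shows "binf_algebra K (R\<lparr>carrier := P\<rparr>)"
proof -
  interpret R: binf K R by (rule binf_if_algebra[OF R])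
  let ?S = "R\<lparr>carrier := P\<rparr>"
  have sub: "x \<in> carrier R" if "x \<in> P" for x using that P(1) by blast
  have subl: "us \<in> lists (carrier R)" if "us \<in> lists P" for us
    using that P(1) by (auto simp: in_lists_conv_set)
  have "abelian_group ?S"
  proof (rule abelian_groupI)
    fix x assume "x \<in> carrier ?S"
    then have x: "x \<in> P" by simp
    have "(\<ominus>\<^bsub>K\<^esub> \<one>\<^bsub>K\<^esub>) \<odot>\<^bsub>R\<^esub> x \<oplus>\<^bsub>R\<^esub> x = \<zero>\<^bsub>R\<^esub>"
      using sub[OF x] by (simp add: R.Rm.smult_l_minus R.Rm.M.l_neg)
    then show "\<exists>y\<in>carrier ?S. y \<oplus>\<^bsub>?S\<^esub> x = \<zero>\<^bsub>?S\<^esub>"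
      using smult[OF _ x, of "\<ominus>\<^bsub>K\<^esub> \<one>\<^bsub>K\<^esub>"] by auto
  qed (use P(2) add sub in \<open>auto simp: R.Rm.M.a_assoc intro: R.Rm.M.a_comm\<close>)
  then have m: "module K ?S"
    by (intro moduleI[OF module_cring[OF R.mR]])
      (use sub smult in \<open>simp_all add: R.Rm.smult_l_distr R.Rm.smult_r_distr R.Rm.smult_assoc1\<close>)
  have rel: "binf_left ?S us vs ws = binf_left R us vs ws" "binf_right ?S us vs ws = binf_right R us vs ws"
    for us vs ws
    by (simp_all add: binf_left_def binf_right_def lsum_def)
  have lin: "linear_map K ?S ?S f" if "linear_map K R R f" "\<And>x. x \<in> P \<Longrightarrow> f x \<in> P" for f
    using that sub by (auto simp: linear_map_def)
  have "binf K ?S"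
  proof (intro binf.intro pre_binf.intro binf_axioms.intro m)
    show "multilinear K ?S ?S (\<lambda>us. brace ?S us vs)" if "vs \<in> lists (carrier ?S)" for vs
    proof (rule multilinearI)
      fix us us' assume "us \<in> lists (carrier ?S)" "us' \<in> lists (carrier ?S)"
      then show "linear_map K ?S ?S (\<lambda>x. brace ?S (us @ x # us') vs)"
        using that multilinear_linear[OF R.brace_multilinear1[OF subl] subl subl]
        by (intro lin) (simp_all add: brace)
    qed (use that brace in simp)
    show "multilinear K ?S ?S (brace ?S us)" if "us \<in> lists (carrier ?S)" for us
    proof (rule multilinearI)
      fix vs vs' assume "vs \<in> lists (carrier ?S)" "vs' \<in> lists (carrier ?S)"
      then show "linear_map K ?S ?S (\<lambda>x. brace ?S us (vs @ x # vs'))"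
        using that multilinear_linear[OF R.brace_multilinear2[OF subl] subl subl]
        by (intro lin) (simp_all add: brace)
    qed (use that brace in simp)
  qed (simp_all add: rel sub subl R.brace_00 R.brace_10 R.brace_01 R.brace_n0 R.brace_0n R.brace_rel)
  then show ?thesis by (rule binf.binf_algebra)
qed

theorem corollary4p4:
  fixes K :: "('k, 'x) ring_scheme" and V :: "('k, 'v, 'y) module_scheme"
  assumes "field K" and "module K V"
  shows "(\<exists>\<phi>'. binf_iso K (Prim_binf K (free_two_as_bialg K V)) (free_binf K V) \<phi>') \<and>
         (\<exists>\<phi>. two_as_bialg_iso K (free_two_as_bialg K V) (Tfc K (free_binf K V)) \<phi>)"
proof -
  interpret vspace K V by (rule vspace.intro[OF assms(2)])
  interpret B: binf K FB by (rule binf_FB)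
  obtain \<phi> \<psi> where phi: "two_as_hom K A2 (Tfc K FB) \<phi>" and psi: "two_as_hom K (Tfc K FB) A2 \<psi>"
    and inv: "\<And>x. x \<in> carrier A2 \<Longrightarrow> \<psi> (\<phi> x) = x" "\<And>y. y \<in> carrier (Tfc K FB) \<Longrightarrow> \<phi> (\<psi> y) = y"
    and gen: "\<And>v. v \<in> carrier V \<Longrightarrow> \<phi> (gen2 v) = B.w [genB v]"
    using free_two_as_iso_words by metis
  interpret transport K A2 "Tfc K FB" \<phi> \<psi>
    by (intro transport.intro transport_axioms.intro two_as_alg_A2 B.two_as_bialgebra_Tfc phi psi inv)
  have prim: "gen2 v \<in> Prim K HA" if "v \<in> carrier V" for v
    using that by (simp add: Prim_HA gen2_closed gen B.Prim_Tfc genB_closed)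
  \<comment> \<open>The transported coproduct shows existence; uniqueness is
    \<open>comult_unique\<close> on the carrier and extensionality outside it.\<close>
  have "(THE \<Delta>. \<Delta> \<in> extensional (carrier A2) \<and> two_as_bialgebra K (with_comult A2 \<Delta>) \<and>
      (\<forall>v\<in>carrier V. gen2 v \<in> Prim K (with_comult A2 \<Delta>))) = D"
  proof (rule the_equality)
    show "D \<in> extensional (carrier A2) \<and> two_as_bialgebra K HA \<and> (\<forall>v\<in>carrier V. gen2 v \<in> Prim K HA)"
      using two_as_bialgebra_HA prim by (simp add: D_def)
    fix \<Delta> assume "\<Delta> \<in> extensional (carrier A2) \<and> two_as_bialgebra K (with_comult A2 \<Delta>) \<and>
      (\<forall>v\<in>carrier V. gen2 v \<in> Prim K (with_comult A2 \<Delta>))"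
    then show "\<Delta> = D"
      using comult_unique[OF _ _ two_as_bialgebra_HA prim, of \<Delta>]
      by (intro extensionalityI[of _ "carrier A2"]) (auto simp: D_def)
  qed
  then have free: "free_two_as_bialg K V = HA" by (simp add: free_two_as_bialg_def)
  interpret HA: two_as_alg K HA
    using two_as_bialgebra_HA
    by (intro two_as_alg.intro)
      (simp add: two_as_algebra_def two_as_bialgebra_def bialgebra_def inf_bialgebra_def)
  have homHA: "two_as_hom K HA (Tfc K FB) \<phi>" using phi by (simp add: two_as_hom_def)
  \<comment> \<open>The map on primitives: \<open>\<phi>\<close> takes them to one-letter words,
    from which \<open>B.letter\<close> reads off the letter.\<close>
  let ?P = "Prim K HA" and ?f = "\<lambda>x. B.letter (\<phi> x)"
  have Pc: "x \<in> carrier A2" if "x \<in> ?P" for x using that by (simp add: Prim_def)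
  have phi_P: "?f x \<in> carrier FB" "\<phi> x = B.w [?f x]" if "x \<in> ?P" for x
  proof -
    have "\<phi> x \<in> (\<lambda>r. B.w [r]) ` carrier FB"
      using Prim_HA[OF Pc[OF that]] that by (simp only: B.Prim_Tfc)
    then obtain r where "r \<in> carrier FB" "\<phi> x = B.w [r]" by blast
    then show "?f x \<in> carrier FB" "\<phi> x = B.w [?f x]" by (simp_all add: B.letter_word)
  qed
  have P_I: "x \<in> ?P" if "x \<in> carrier A2" "\<phi> x = B.w [r]" "r \<in> carrier FB" for x r
    using that by (simp add: Prim_HA B.Prim_Tfc)
  have w1: "linear_map K FB B.T (\<lambda>r. B.w [r])"
    using multilinear_linear[OF B.w_multilinear, of "[]" "[]"] by simp
  have phi_lin: "linear_map K A2 B.T \<phi>" using phi_linear by (simp add: B.linear_map_Tfc)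
  have f_lin: "linear_map K A2 FB ?f" by (rule linear_map_comp[OF phi_lin B.letter_linear])
  \<comment> \<open>\<open>\<phi>\<close> takes these braces to braces in \<open>Tfc\<close> of
    one-letter words, which by \<open>brace_letters\<close> are one-letter words again. Closure of
    the primitives and compatibility of the map with braces follow together.\<close>
  have brace: "two_as_brace HA us vs \<in> ?P \<and> ?f (two_as_brace HA us vs) = brace FB (map ?f us) (map ?f vs)"
    if "us \<in> lists ?P" "vs \<in> lists ?P" for us vs
  proof -
    have c: "map ?f us \<in> B.L" "map ?f vs \<in> B.L" "us \<in> lists (carrier HA)" "vs \<in> lists (carrier HA)"
      using that phi_P(1) Pc by (auto simp: in_lists_conv_set)
    have m: "map \<phi> us = map (\<lambda>r. B.w [r]) (map ?f us)" "map \<phi> vs = map (\<lambda>r. B.w [r]) (map ?f vs)"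
      using that phi_P(2) by (simp_all add: in_lists_conv_set)
    have e: "\<phi> (two_as_brace HA us vs) = B.w [brace FB (map ?f us) (map ?f vs)]"
      by (simp only: two_as_hom_brace[OF homHA HA.two_as_alg_axioms B.two_as_alg_Tfc c(3,4)] m
        B.brace_letters[OF c(1,2)])
    then show ?thesis
      using P_I[OF _ e] HA.two_as_brace_closed[OF c(3,4)] c by (simp add: B.brace_closed B.letter_word)
  qed
  have binf_P: "binf_algebra K (Prim_binf K HA)"
    unfolding Prim_binf_def
  proof (rule binf_algebra_restrict[OF binf.binf_algebra[OF HA.binf_Br]])
    have z: "\<phi> \<zero>\<^bsub>A2\<^esub> = B.w [\<zero>\<^bsub>FB\<^esub>]"
      using linear_map_zero[OF phi_lin mA B.mT] linear_map_zero[OF w1 B.mR B.mT] by simp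
    show "\<zero>\<^bsub>HA.Br\<^esub> \<in> ?P" using P_I[OF _ z] by (simp add: HA.Br_simps)
    show "x \<oplus>\<^bsub>HA.Br\<^esub> y \<in> ?P" if "x \<in> ?P" "y \<in> ?P" for x y
    proof -
      have "\<phi> (x \<oplus>\<^bsub>A2\<^esub> y) = B.w [?f x \<oplus>\<^bsub>FB\<^esub> ?f y]"
        using linear_map_add[OF phi_lin Pc Pc] linear_map_add[OF w1 phi_P(1) phi_P(1)] phi_P(2) that by simp
      then show ?thesis using P_I that phi_P(1) Pc by (simp add: HA.Br_simps)
    qed
    show "c \<odot>\<^bsub>HA.Br\<^esub> x \<in> ?P" if "c \<in> carrier K" "x \<in> ?P" for c x
    proof -
      have "\<phi> (c \<odot>\<^bsub>A2\<^esub> x) = B.w [c \<odot>\<^bsub>FB\<^esub> ?f x]"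
        using linear_map_smult[OF phi_lin _ Pc] linear_map_smult[OF w1 _ phi_P(1)] phi_P(2) that by simp
      then show ?thesis using P_I that phi_P(1) Pc by (simp add: HA.Br_simps)
    qed
  qed (use Pc brace in \<open>auto simp: HA.Br_simps\<close>)
  have P_simps: "carrier (Prim_binf K HA) = ?P" "brace (Prim_binf K HA) = two_as_brace HA"
    "add (Prim_binf K HA) = add A2" "smult (Prim_binf K HA) = smult A2"
    by (simp_all add: Prim_binf_def binf_of_two_as_def)
  have "bij_betw ?f ?P (carrier FB)"
  proof (rule bij_betw_byWitness[of _ "\<lambda>r. \<psi> (B.w [r])"])
    show "\<forall>x\<in>?P. \<psi> (B.w [?f x]) = x" using phi_P(2) inv(1) Pc by metis
    have wc: "B.w [r] \<in> carrier (Tfc K FB)" if "r \<in> carrier FB" for r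
      using that by (simp add: B.Tfc_simps B.w_closed)
    show "\<forall>r\<in>carrier FB. ?f (\<psi> (B.w [r])) = r" using wc by (simp add: inv(2) B.letter_word)
    show "(\<lambda>r. \<psi> (B.w [r])) ` carrier FB \<subseteq> ?P"
      using wc by (auto intro!: P_I[OF psi_closed] simp: inv(2))
  qed (use phi_P(1) in blast)
  moreover have "linear_map K (Prim_binf K HA) FB ?f"
    using f_lin Pc by (auto simp: linear_map_def P_simps)
  ultimately have "binf_iso K (Prim_binf K HA) FB ?f"
    using binf_P B.binf_algebra brace by (simp add: binf_iso_def P_simps)
  then show ?thesis unfolding free using iso_HA by blast
qed

end
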